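(* Use the setting and notation of the context. Let $\epsilon\in\mathbf L$ and let $\mathbf s\in C_c^\infty(M)$ have support a compact subset of $\Omega_\epsilon^\circ$. Let $\mathcal L^\epsilon:V_{\boldsymbol J}\to V_{\boldsymbol J}$ be an invertible linear map such that $\Sigma_{\mathbf s}=\Phi^\epsilon_{\boldsymbol J}(\mathrm{Supp}(\mathbf s))$ is contained in a fundamental domain of the lattice $\Lambda_\epsilon^\star$. Let $\Gamma_M^\epsilon\subset M$ be a discrete subset such that $$A_{\mathbf s,\Gamma_M^\epsilon,\Lambda^\star}:=\inf_{m\in M}\sum_{\gamma\in\Gamma_M^\epsilon}|\Upsilon(\gamma m)|^2>0\quad\text{and}\quad B_{\mathbf s,\Gamma_M^\epsilon,\Lambda^\star}:=\sup_{m\in M}\sum_{\gamma\in\Gamma_M^\epsilon}|\Upsilon(\gamma m)|^2<\infty,$$ and let $\Gamma^\epsilon=(\Gamma_M^\epsilon)^{-1}\Gamma_P^\epsilon$. Then the system $\{\pi_\lambda(\kappa)\mathbf s:\kappa\in\Gamma^\epsilon\}$ is a frame for $L^2(M,d\mu_M)$ with optimal lower and upper frame bounds $A_{\mathbf s,\Gamma_M^\epsilon,\Lambda^\star}$ and $B_{\mathbf s,\Gamma_M^\epsilon,\Lambda^\star}$ respectively.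
   Context: $G$ is a connected, simply connected completely solvable Lie group (its Lie algebra $\mathfrak g$ is a finite-dimensional real solvable Lie algebra and $\mathrm{ad}(Z)$ has only real eigenvalues for every $Z\in\mathfrak g$; then $\exp:\mathfrak g\to G$ is a bijection with inverse $\log$). $G=P\rtimes M$ where $P=\exp\mathfrak p$ is a closed normal subgroup and $M=\exp\mathfrak m$ is a closed subgroup; $n_1=\dim\mathfrak p$, $n_2=\dim\mathfrak m$. $d\mu_M$ is a fixed left Haar measure on $M$. $\lambda\in\mathfrak p^*$ satisfies $\lambda([\mathfrak p,\mathfrak p])=0$, $\chi_\lambda(\exp X)=e^{2\pi i\lambda(X)}$, and $\pi_\lambda=\mathrm{ind}_P^G(\chi_\lambda)$ is realized on $L^2(M,d\mu_M)$ by $[\pi_\lambda(pn)\mathbf f](m)=e^{2\pi i\langle\lambda,\log(m^{-1}pm)\rangle}\mathbf f(n^{-1}m)$ ($p\in P$, $n,m\in M$) and is assumed irreducible. A strong Malcev basis of a Lie algebra $\mathfrak s$ is an ordered basis $(Z_1,\dots,Z_d)$ such that $\mathrm{span}\{Z_1,\dots,Z_i\}$ is an ideal of $\mathfrak s$ for every $i$. Fix strong Malcev bases $(X_1,\dots,X_{n_1})$ of $\mathfrak p$ and $(A_1,\dots,A_{n_2})$ of $\mathfrak m$, with dual basis $(X_k^* )$ of $\mathfrak p^*$; Lebesgue measures are taken in these coordinates. For $A=\sum_k a_kA_k$ put $\mathbf e(A)=\exp(a_1A_1)\cdots\exp(a_{n_2}A_{n_2})$; $\mathbf e:\mathfrak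 m\to M$ is a diffeomorphism. Put $\mathbf C(a)=\big(e^{-\mathrm{ad}(a_{n_2}A_{n_2})}\cdots e^{-\mathrm{ad}(a_1A_1)}\big)|_{\mathfrak p}$ and $\theta_\lambda(A)=\mathbf C(a)^*\lambda=\lambda\circ\mathbf C(a)\in\mathfrak p^*$. Let $D_{\theta_\lambda}$ be the $n_1\times n_2$ Jacobian matrix of $\theta_\lambda$ at $0$. Fix $\boldsymbol J=\boldsymbol J(\lambda)=(j_1<\cdots<j_{n_2})$, $1\le j_i\le n_1$, such that the submatrix of $D_{\theta_\lambda}$ formed by rows $j_1,\dots,j_{n_2}$ is invertible. Put $V_{\boldsymbol J}=\sum_{j\in\boldsymbol J}\mathbb R X_j$, $V_{\boldsymbol J}^*=\sum_{j\in\boldsymbol J}\mathbb R X_j^*$ and define $\beta_{\boldsymbol J}:\mathfrak m\to V_{\boldsymbol J}^*$ by $\beta_{\boldsymbol J}(A)=\sum_{j\in\boldsymbol J}\langle\theta_\lambda(A),X_j\rangle X_j^*$. Fix a connected open neighbourhood $\mathcal O$ of $0$ in $\mathfrak m$ such that $\beta_{\boldsymbol J}|_{\mathcal O}$ is a diffeomorphism onto its image, and let $\mathbf L=\{s>0:\sum_{k=1}^{n_2}[-\tfrac s2,\tfrac s2]A_k\subset\mathcal O\}$. For $\epsilon\in\mathbf L$: $\mathcal O_\epsilon=\sum_{k=1}^{n_2}(-\tfrac\epsilon2,\tfrac\epsilon2)A_k$, $\Omega_\epsilon^\circ=\mathbf e(\mathcal O_\epsilon)\subset M$, and $\Phi^\epsilon_{\boldsymbol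 J}:\Omega_\epsilon^\circ\to\beta_{\boldsymbol J}(\mathcal O_\epsilon)$ is the diffeomorphism $\Phi^\epsilon_{\boldsymbol J}(\mathbf e(A))=\beta_{\boldsymbol J}(A)$. $\Psi^\epsilon_{\boldsymbol J}$ is the positive smooth function on $\beta_{\boldsymbol J}(\mathcal O_\epsilon)$ with $\Psi^\epsilon_{\boldsymbol J}(\xi)\,d\xi=d\mu_M([\Phi^\epsilon_{\boldsymbol J}]^{-1}(\xi))$ ($d\xi$ Lebesgue measure), i.e. the density of the push-forward of $\mu_M|_{\Omega_\epsilon^\circ}$ under $\Phi^\epsilon_{\boldsymbol J}$. For an invertible linear $\mathcal L^\epsilon$ on $V_{\boldsymbol J}$: $\Lambda_\epsilon=\sum_{j\in\boldsymbol J}\mathbb Z\,\mathcal L^\epsilon X_j$, $\Gamma_P^\epsilon=\exp(\Lambda_\epsilon)\subset P$, $\Lambda_\epsilon^\star=\sum_{j\in\boldsymbol J}\mathbb Z\,(\mathcal L^\epsilon)^\top X_j^*\subset V_{\boldsymbol J}^*$, where $(\mathcal L^\epsilon)^\top$ denotes the inverse transpose of $\mathcal L^\epsilon$. The function $\Upsilon$ on $M$ is $$\Upsilon(m)=\sqrt{\Psi^\epsilon_{\boldsymbol J}(\Phi^\epsilon_{\boldsymbol J}(m))\,|\det(\mathcal L^\epsilon)^\top|}\;\mathbf s(m)$$ for $m\in\Omega_\epsilon^\circ$ and $\Upsilon(m)=0$ otherwise. A family is a frame with optimal bounds $a,b$ if $a\|\mathbf h\|^2\le\sum_{\kappa}|\langle\mathbf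 h,\pi_\lambda(\kappa)\mathbf s\rangle|^2\le b\|\mathbf h\|^2$ for all $\mathbf h\in L^2(M,d\mu_M)$, with $0<a\le b<\infty$, $a$ being the largest and $b$ the smallest such constants. *)

theory Defs
  imports "HOL-Analysis.Analysis" "HOL-Algebra.Coset"
begin

text \<open>Smooth maps between open subsets of normed spaces (the domain is finite-dimensional in all uses).\<close>

primrec Ck_on :: "nat \<Rightarrow> 'a::real_normed_vector set \<Rightarrow> ('a \<Rightarrow> 'b::real_normed_vector) \<Rightarrow> bool" where
  "Ck_on 0 S f \<longleftrightarrow> continuous_on S f"
| "Ck_on (Suc k) S f \<longleftrightarrow>
     (\<forall>x\<in>S. f differentiable (at x)) \<and> (\<forall>v. Ck_on k S (\<lambda>x. frechet_derivative f (at x) v))"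

definition smooth_on :: "'a::real_normed_vector set \<Rightarrow> ('a \<Rightarrow> 'b::real_normed_vector) \<Rightarrow> bool" where
  "smooth_on S f \<longleftrightarrow> open S \<and> (\<forall>k. Ck_on k S f)"

definition diffeo_onto_image :: "'a::real_normed_vector set \<Rightarrow> ('a \<Rightarrow> 'b::real_normed_vector) \<Rightarrow> bool" where
  "diffeo_onto_image S f \<longleftrightarrow>
     smooth_on S f \<and> inj_on f S \<and> smooth_on (f ` S) (inv_into S f)"

text \<open>Smooth manifolds modelled on the Euclidean space \<open>'g\<close>; the underlying set is the whole type \<open>'G\<close>.\<close>

type_synonym ('G, 'g) chart = "'G set \<times> ('G \<Rightarrow> 'g)"

definition smooth_atlas :: "('G::topological_space, 'g::euclidean_space) chart set \<Rightarrow> bool" where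
  "smooth_atlas \<A> \<longleftrightarrow>
     (\<Union>(U, \<phi>)\<in>\<A>. U) = UNIV \<and>
     (\<forall>(U, \<phi>)\<in>\<A>. open U \<and> open (\<phi> ` U) \<and> homeomorphism U (\<phi> ` U) \<phi> (inv_into U \<phi>)) \<and>
     (\<forall>(U, \<phi>)\<in>\<A>. \<forall>(V, \<psi>)\<in>\<A>. smooth_on (\<phi> ` (U \<inter> V)) (\<lambda>x. \<psi> (inv_into U \<phi> x)))"

definition smooth_mfd_on ::
  "('G::topological_space, 'g::euclidean_space) chart set \<Rightarrow> 'G set \<Rightarrow> ('G \<Rightarrow> 'b::real_normed_vector) \<Rightarrow> bool" where
  "smooth_mfd_on \<A> W f \<longleftrightarrow> open W \<and>
     (\<forall>(U, \<phi>)\<in>\<A>. smooth_on (\<phi> ` (U \<inter> W)) (\<lambda>x. f (inv_into U \<phi> x)))"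

definition smooth_funs :: "('G::topological_space, 'g::euclidean_space) chart set \<Rightarrow> ('G \<Rightarrow> real) set" where
  "smooth_funs \<A> = {f. smooth_mfd_on \<A> UNIV f}"

text \<open>Smoothness on an embedded submanifold \<open>S\<close>, here a closed subgroup of a Lie group:
  local extendability to a smooth function on the ambient manifold.\<close>

definition smooth_on_subset ::
  "('G::topological_space, 'g::euclidean_space) chart set \<Rightarrow> 'G set \<Rightarrow> ('G \<Rightarrow> 'b::real_normed_vector) \<Rightarrow> bool" where
  "smooth_on_subset \<A> S f \<longleftrightarrow>
     (\<forall>x\<in>S. \<exists>W g. x \<in> W \<and> smooth_mfd_on \<A> W g \<and> (\<forall>y\<in>S \<inter> W. g y = f y))"

definition lie_group ::
  "'G::{t2_space,second_countable_topology} monoid \<Rightarrow> ('G, 'g::euclidean_space) chart set \<Rightarrow> bool" where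
  "lie_group G \<A> \<longleftrightarrow>
     group G \<and> carrier G = UNIV \<and> smooth_atlas \<A> \<and>
     continuous_on UNIV (\<lambda>(x, y). x \<otimes>\<^bsub>G\<^esub> y) \<and>
     continuous_on UNIV (\<lambda>x. inv\<^bsub>G\<^esub> x) \<and>
     (\<forall>(U, \<phi>)\<in>\<A>. \<forall>(V, \<psi>)\<in>\<A>. \<forall>(W, \<eta>)\<in>\<A>.
        smooth_on {(x, y). x \<in> \<phi> ` U \<and> y \<in> \<psi> ` V \<and> inv_into U \<phi> x \<otimes>\<^bsub>G\<^esub> inv_into V \<psi> y \<in> W}
          (\<lambda>(x, y). \<eta> (inv_into U \<phi> x \<otimes>\<^bsub>G\<^esub> inv_into V \<psi> y))) \<and>
     (\<forall>(U, \<phi>)\<in>\<A>. \<forall>(V, \<psi>)\<in>\<A>.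
        smooth_on {x \<in> \<phi> ` U. inv\<^bsub>G\<^esub> (inv_into U \<phi> x) \<in> V} (\<lambda>x. \<psi> (inv\<^bsub>G\<^esub> (inv_into U \<phi> x))))"

text \<open>Left-invariant vector fields, as derivations of the algebra of smooth functions.\<close>

definition left_invariant_field ::
  "'G::{t2_space,second_countable_topology} monoid \<Rightarrow> ('G, 'g::euclidean_space) chart set
     \<Rightarrow> (('G \<Rightarrow> real) \<Rightarrow> 'G \<Rightarrow> real) \<Rightarrow> bool" where
  "left_invariant_field G \<A> D \<longleftrightarrow>
     (\<forall>f\<in>smooth_funs \<A>. D f \<in> smooth_funs \<A>) \<and>
     (\<forall>f\<in>smooth_funs \<A>. \<forall>h\<in>smooth_funs \<A>. \<forall>a b x. D (\<lambda>y. a * f y + b * h y) x = a * D f x + b * D h x) \<and>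
     (\<forall>f\<in>smooth_funs \<A>. \<forall>h\<in>smooth_funs \<A>. \<forall>x. D (\<lambda>y. f y * h y) x = D f x * h x + f x * D h x) \<and>
     (\<forall>f\<in>smooth_funs \<A>. \<forall>g x. D (\<lambda>y. f (g \<otimes>\<^bsub>G\<^esub> y)) x = D f (g \<otimes>\<^bsub>G\<^esub> x))"

text \<open>\<open>vf\<close> identifies the vector space \<open>'g\<close> with the Lie algebra of \<open>G\<close>, i.e. with the space of
  left-invariant vector fields. Fields are compared on smooth functions only, since their values
  on other functions carry no meaning.\<close>

definition lie_algebra_iso ::
  "'G::{t2_space,second_countable_topology} monoid \<Rightarrow> ('G, 'g::euclidean_space) chart set
     \<Rightarrow> ('g \<Rightarrow> ('G \<Rightarrow> real) \<Rightarrow> 'G \<Rightarrow> real) \<Rightarrow> bool" where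
  "lie_algebra_iso G \<A> vf \<longleftrightarrow>
     (\<forall>X. left_invariant_field G \<A> (vf X)) \<and>
     (\<forall>X Y a b. \<forall>f\<in>smooth_funs \<A>. \<forall>x. vf (a *\<^sub>R X + b *\<^sub>R Y) f x = a * vf X f x + b * vf Y f x) \<and>
     (\<forall>D. left_invariant_field G \<A> D \<longrightarrow> (\<exists>!X. \<forall>f\<in>smooth_funs \<A>. vf X f = D f))"

definition lie_bracket ::
  "('G::topological_space, 'g::euclidean_space) chart set \<Rightarrow> ('g \<Rightarrow> ('G \<Rightarrow> real) \<Rightarrow> 'G \<Rightarrow> real)
     \<Rightarrow> 'g \<Rightarrow> 'g \<Rightarrow> 'g" where
  "lie_bracket \<A> vf X Y =
     (THE Z. \<forall>f\<in>smooth_funs \<A>. \<forall>x. vf Z f x = vf X (vf Y f) x - vf Y (vf X f) x)"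

text \<open>\<open>t \<mapsto> Exp (t X)\<close> is the integral curve of the left-invariant field \<open>X\<close> through the identity;
  this determines \<open>Exp\<close> uniquely.\<close>

definition lie_exponential ::
  "'G::{t2_space,second_countable_topology} monoid \<Rightarrow> ('G, 'g::euclidean_space) chart set
     \<Rightarrow> ('g \<Rightarrow> ('G \<Rightarrow> real) \<Rightarrow> 'G \<Rightarrow> real) \<Rightarrow> ('g \<Rightarrow> 'G) \<Rightarrow> bool" where
  "lie_exponential G \<A> vf Exp \<longleftrightarrow>
     Exp 0 = \<one>\<^bsub>G\<^esub> \<and>
     (\<forall>X t. \<forall>f\<in>smooth_funs \<A>.
        ((\<lambda>r. f (Exp (r *\<^sub>R X))) has_real_derivative vf X f (Exp (t *\<^sub>R X))) (at t))"

primrec derived_series :: "('g::real_vector \<Rightarrow> 'g \<Rightarrow> 'g) \<Rightarrow> nat \<Rightarrow> 'g set" where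
  "derived_series br 0 = UNIV"
| "derived_series br (Suc k) = span {br X Y | X Y. X \<in> derived_series br k \<and> Y \<in> derived_series br k}"

text \<open>Eigenvalues of the complexification of a real endomorphism: \<open>u + iv\<close> is the eigenvector.\<close>

definition complex_eigenvalue :: "('g::real_vector \<Rightarrow> 'g) \<Rightarrow> complex \<Rightarrow> bool" where
  "complex_eigenvalue T z \<longleftrightarrow>
     (\<exists>u v. (u \<noteq> 0 \<or> v \<noteq> 0) \<and>
        T u = Re z *\<^sub>R u - Im z *\<^sub>R v \<and> T v = Im z *\<^sub>R u + Re z *\<^sub>R v)"

definition completely_solvable :: "('g::real_vector \<Rightarrow> 'g \<Rightarrow> 'g) \<Rightarrow> bool" where
  "completely_solvable br \<longleftrightarrow>
     (\<exists>k. derived_series br k = {0}) \<and> (\<forall>Z z. complex_eigenvalue (br Z) z \<longrightarrow> z \<in> \<real>)"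

definition lie_subalgebra :: "('g::real_vector \<Rightarrow> 'g \<Rightarrow> 'g) \<Rightarrow> 'g set \<Rightarrow> bool" where
  "lie_subalgebra br s \<longleftrightarrow> subspace s \<and> (\<forall>X\<in>s. \<forall>Y\<in>s. br X Y \<in> s)"

text \<open>An ordered basis is a family over a finite linear order, whose cardinality is the dimension.\<close>

definition strong_malcev_basis ::
  "('g::real_vector \<Rightarrow> 'g \<Rightarrow> 'g) \<Rightarrow> 'g set \<Rightarrow> ('i::{finite,linorder} \<Rightarrow> 'g) \<Rightarrow> bool" where
  "strong_malcev_basis br s Z \<longleftrightarrow>
     inj Z \<and> independent (range Z) \<and> span (range Z) = s \<and>
     (\<forall>i. \<forall>Y\<in>s. \<forall>W\<in>span (Z ` {..i}). br Y W \<in> span (Z ` {..i}))"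

definition op_exp :: "('g::real_normed_vector \<Rightarrow> 'g) \<Rightarrow> 'g \<Rightarrow> 'g" where
  "op_exp T Y = (\<Sum>n. (1 / fact n) *\<^sub>R (T ^^ n) Y)"

text \<open>The map \<open>a \<mapsto> exp(a\<^sub>1 A\<^sub>1) \<cdots> exp(a\<^sub>n A\<^sub>n)\<close>.\<close>

definition malcev_coord ::
  "'G monoid \<Rightarrow> ('g::real_vector \<Rightarrow> 'G) \<Rightarrow> ('m \<Rightarrow> 'g) \<Rightarrow> real^'m::{finite,linorder} \<Rightarrow> 'G" where
  "malcev_coord G Exp A a =
     foldr (\<lambda>k g. Exp ((a $ k) *\<^sub>R A k) \<otimes>\<^bsub>G\<^esub> g) (sorted_list_of_set UNIV) \<one>\<^bsub>G\<^esub>"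

text \<open>The operator \<open>exp(-ad(a\<^sub>n A\<^sub>n)) \<cdots> exp(-ad(a\<^sub>1 A\<^sub>1))\<close>: the factor with index 1 acts first.\<close>

definition ad_exp_prod ::
  "('g::real_normed_vector \<Rightarrow> 'g \<Rightarrow> 'g) \<Rightarrow> ('m \<Rightarrow> 'g) \<Rightarrow> real^'m::{finite,linorder} \<Rightarrow> 'g \<Rightarrow> 'g" where
  "ad_exp_prod br A a =
     fold (\<lambda>k T. op_exp (\<lambda>Y. - br ((a $ k) *\<^sub>R A k) Y) \<circ> T) (sorted_list_of_set UNIV) id"

definition left_haar_measure ::
  "'G::topological_space monoid \<Rightarrow> 'G set \<Rightarrow> 'G measure \<Rightarrow> bool" where
  "left_haar_measure G M \<mu> \<longleftrightarrow>
     space \<mu> = M \<and> sets \<mu> = sets (restrict_space borel M) \<and>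
     emeasure \<mu> M \<noteq> 0 \<and>
     (\<forall>K. compact K \<and> K \<subseteq> M \<longrightarrow> emeasure \<mu> K < \<infinity>) \<and>
     (\<forall>x\<in>M. \<forall>S\<in>sets \<mu>. emeasure \<mu> ((\<lambda>y. x \<otimes>\<^bsub>G\<^esub> y) ` S) = emeasure \<mu> S)"

text \<open>Square-integrable functions are handled as representatives: everything below is insensitive
  to changes on null sets, and to the values outside \<open>space \<mu>\<close>.\<close>

definition L2_normsq :: "'a measure \<Rightarrow> ('a \<Rightarrow> complex) \<Rightarrow> ennreal" where
  "L2_normsq \<mu> f = (\<integral>\<^sup>+x. ennreal ((cmod (f x))\<^sup>2) \<partial>\<mu>)"

definition L2_space :: "'a measure \<Rightarrow> ('a \<Rightarrow> complex) set" where
  "L2_space \<mu> = {f \<in> borel_measurable \<mu>. L2_normsq \<mu> f < \<infinity>}"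

definition L2_inner :: "'a measure \<Rightarrow> ('a \<Rightarrow> complex) \<Rightarrow> ('a \<Rightarrow> complex) \<Rightarrow> complex" where
  "L2_inner \<mu> f h = (LINT x|\<mu>. f x * cnj (h x))"

definition closed_L2_subspace :: "'a measure \<Rightarrow> ('a \<Rightarrow> complex) set \<Rightarrow> bool" where
  "closed_L2_subspace \<mu> W \<longleftrightarrow>
     W \<subseteq> L2_space \<mu> \<and> (\<lambda>_. 0) \<in> W \<and>
     (\<forall>f\<in>W. \<forall>h\<in>W. \<forall>a b. (\<lambda>x. a * f x + b * h x) \<in> W) \<and>
     (\<forall>f\<in>L2_space \<mu>. (\<forall>\<epsilon>>0. \<exists>h\<in>W. L2_normsq \<mu> (\<lambda>x. f x - h x) < \<epsilon>) \<longrightarrow> f \<in> W)"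

definition irreducible_on_L2 ::
  "'G monoid \<Rightarrow> 'a measure \<Rightarrow> ('G \<Rightarrow> ('a \<Rightarrow> complex) \<Rightarrow> 'a \<Rightarrow> complex) \<Rightarrow> bool" where
  "irreducible_on_L2 G \<mu> \<rho> \<longleftrightarrow>
     (\<forall>W. closed_L2_subspace \<mu> W \<and> (\<forall>x\<in>carrier G. \<forall>f\<in>W. \<rho> x f \<in> W) \<longrightarrow>
        W = L2_space \<mu> \<or> W = {f \<in> L2_space \<mu>. L2_normsq \<mu> f = 0})"

text \<open>\<open>[\<pi>(pn) f](m) = exp(2\<pi>i \<langle>\<lambda>, log(m\<^sup>-\<^sup>1 p m)\<rangle>) f(n\<^sup>-\<^sup>1 m)\<close> for \<open>p \<in> P\<close> and \<open>n, m \<in> M\<close>.\<close>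

definition induced_rep ::
  "'G monoid \<Rightarrow> ('g \<Rightarrow> 'G) \<Rightarrow> 'G set \<Rightarrow> 'G set \<Rightarrow> ('g \<Rightarrow> real) \<Rightarrow> 'G \<Rightarrow> ('G \<Rightarrow> complex) \<Rightarrow> 'G \<Rightarrow> complex" where
  "induced_rep G Exp P M lam x f m =
     (let (p, n) = (THE pn. fst pn \<in> P \<and> snd pn \<in> M \<and> x = fst pn \<otimes>\<^bsub>G\<^esub> snd pn)
      in cis (2 * pi * lam (inv_into UNIV Exp (inv\<^bsub>G\<^esub> m \<otimes>\<^bsub>G\<^esub> p \<otimes>\<^bsub>G\<^esub> m))) * f (inv\<^bsub>G\<^esub> n \<otimes>\<^bsub>G\<^esub> m))"

definition frame_with_optimal_bounds ::
  "'a measure \<Rightarrow> 'k set \<Rightarrow> ('k \<Rightarrow> 'a \<Rightarrow> complex) \<Rightarrow> ennreal \<Rightarrow> ennreal \<Rightarrow> bool" where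
  "frame_with_optimal_bounds \<mu> K u a b \<longleftrightarrow>
     (let q = (\<lambda>h. \<Sum>\<^sub>\<infinity>\<kappa>\<in>K. ennreal ((cmod (L2_inner \<mu> h (u \<kappa>)))\<^sup>2));
          lower = (\<lambda>c. \<forall>h\<in>L2_space \<mu>. c * L2_normsq \<mu> h \<le> q h);
          upper = (\<lambda>c. \<forall>h\<in>L2_space \<mu>. q h \<le> c * L2_normsq \<mu> h)
      in (\<forall>\<kappa>\<in>K. u \<kappa> \<in> L2_space \<mu>) \<and> 0 < a \<and> a \<le> b \<and> b < \<infinity> \<and> lower a \<and> upper b \<and>
         (\<forall>c. lower c \<longrightarrow> c \<le> a) \<and> (\<forall>c. upper c \<longrightarrow> b \<le> c))"

definition int_vectors :: "(real^'m) set" where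
  "int_vectors = {k. \<forall>i. k $ i \<in> \<int>}"

text \<open>The translates of a fundamental domain tile the space up to null sets.\<close>

definition fundamental_domain :: "'a::euclidean_space set \<Rightarrow> 'a set \<Rightarrow> bool" where
  "fundamental_domain \<Lambda> F \<longleftrightarrow>
     F \<in> sets lebesgue \<and> negligible (UNIV - (\<Union>v\<in>\<Lambda>. (+) v ` F)) \<and>
     (\<forall>v\<in>\<Lambda>. \<forall>w\<in>\<Lambda>. v \<noteq> w \<longrightarrow> negligible ((+) v ` F \<inter> (+) w ` F))"

end

theory Submission
  imports Defs
begin

text \<open>
  Write \<open>l\<^sub>k = \<Sum>\<^sub>i (L k)\<^sub>i X\<^bsub>J i\<^esub>\<close> for integer vectors \<open>k\<close>, so that \<open>\<Gamma>\<close> consists of the elements \<open>\<gamma>\<^sup>-\<^sup>1 Exp l\<^sub>k\<close>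
  with \<open>\<gamma> \<in> \<Gamma>\<^sub>M\<close>. The function \<open>\<rho> (\<gamma>\<^sup>-\<^sup>1 Exp l\<^sub>k) s\<close> takes at \<open>m\<close> the value of \<open>s\<close> at \<open>\<gamma> m\<close> times a phase
  which involves \<open>lam\<close> at the logarithm of \<open>(\<gamma> m)\<^sup>-\<^sup>1 Exp l\<^sub>k (\<gamma> m)\<close> (\<open>induced_rep_normal_form\<close>). If \<open>\<gamma> m = e a\<close>,
  this logarithm is \<open>C a l\<^sub>k\<close>, because conjugation by \<open>Exp Y\<close> acts on the Lie algebra through \<open>exp (ad Y)\<close>
  (\<open>conj_Exp\<close>, \<open>ad_exp_prod_eq_Ad_inv\<close>). The phase is therefore \<open>(L k) \<bullet> \<beta> a\<close>: it is \<^emph>\<open>linear\<close> in the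
  coordinate \<open>\<xi> = \<beta> a = \<Phi> (\<gamma> m)\<close>. In this coordinate the system consists of left translates of the
  window \<open>s\<close>, modulated by the characters of a lattice.

  Let \<open>E\<close> be the inverse of \<open>\<Phi>\<close>. By left invariance of \<open>\<mu>\<close>, the inner product of \<open>h\<close> with
  \<open>\<rho> (\<gamma>\<^sup>-\<^sup>1 Exp l\<^sub>k) s\<close> is the Fourier coefficient at \<open>L k\<close> of
  \<open>F \<xi> = h (\<gamma>\<^sup>-\<^sup>1 E \<xi>) \<cdot> cnj (s (E \<xi>)) \<cdot> \<Psi> \<xi>\<close>. The support of \<open>F\<close> lies in a fundamental domain of the
  dual lattice, and Parseval's identity (\<open>Parseval_lattice\<close>) turns the sum over \<open>k\<close> of the squared
  coefficients into \<open>\<integral> |h m|\<^sup>2 |\<Upsilon> (\<gamma> m)|\<^sup>2 d\<mu>\<close> (\<open>sum_coefficients\<close>). Summation over \<open>\<gamma>\<close> gives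
  \<open>\<integral> |h|\<^sup>2 g d\<mu>\<close> with \<open>g m = \<Sum>\<^sub>\<gamma> |\<Upsilon> (\<gamma> m)|\<^sup>2\<close>, so the optimal frame bounds are the essential
  infimum and supremum of \<open>g\<close>. These are the true infimum and supremum since \<open>g\<close> is continuous and
  nonempty open subsets of \<open>M\<close> have positive measure (\<open>continuous_sum\<close>, \<open>open_positive\<close>): finiteness
  of the upper bound keeps \<open>\<Gamma>\<^sub>M\<close> from accumulating in \<open>M\<close>, whence the sum \<open>g\<close> is locally finite.

  Two bodies of theory carry this argument. From Lie theory: integral curves of an invariant field are
  unique, which identifies the conjugates of \<open>t \<mapsto> Exp (t Z)\<close> as curves of the same kind; and
  \<open>t \<mapsto> Ad (Exp (-t Y)) Z\<close> solves a linear differential equation, so that Taylor's formula identifies it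
  with the exponential series. The map \<open>e\<close> is continuous, and it is injective wherever \<open>\<beta>\<close> is,
  as \<open>\<beta> a\<close> depends on \<open>e a\<close> only. From Fourier analysis: on the torus, embedded in a complex vector space,
  polynomials are trigonometric polynomials, so the Stone--Weierstrass theorem and regularity of the
  measure make these dense in the mean square. This gives Parseval's identity on the unit cube.
  Folding a function whose support has almost disjoint integer translates into the cube, followed by
  a linear change of variables, yields the identity over an arbitrary lattice.
\<close>

section \<open>Smooth functions on Euclidean space\<close>

lemma Ck_on_SucD:
  assumes "Ck_on (Suc k) S f" "x \<in> S"
  shows "(f has_derivative frechet_derivative f (at x)) (at x)"
  using assms frechet_derivative_works by auto

lemma Ck_on_cong:
  assumes "open S" "Ck_on k S f" "\<And>x. x \<in> S \<Longrightarrow> f x = g x"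
  shows "Ck_on k S g"
  using assms(2,3)
proof (induction k arbitrary: f g)
  case 0
  then show ?case by (simp cong: continuous_on_cong)
next
  case (Suc k)
  have D: "(f has_derivative D) (at x) \<longleftrightarrow> (g has_derivative D) (at x)" if "x \<in> S" for x D
    using that Suc.prems(2) assms(1) has_derivative_transform_within_open[of f D x UNIV S g]
      has_derivative_transform_within_open[of g D x UNIV S f] by force
  have F: "frechet_derivative f (at x) = frechet_derivative g (at x)" if "x \<in> S" for x
    unfolding frechet_derivative_def using D[OF that] by simp
  show ?case
  proof -
    have "Ck_on k S (\<lambda>x. frechet_derivative g (at x) v)" for v
      by (rule Suc.IH[of "\<lambda>x. frechet_derivative f (at x) v"]) (use Suc.prems(1) F in auto)
    moreover have "g differentiable (at x)" if "x \<in> S" for x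
      using Ck_on_SucD[OF Suc.prems(1) that] D[OF that] unfolding differentiable_def by blast
    ultimately show ?thesis by simp
  qed
qed

lemma Ck_on_SucI:
  assumes "open S" "\<And>x. x \<in> S \<Longrightarrow> (f has_derivative f' x) (at x)" "\<And>v. Ck_on k S (\<lambda>x. f' x v)"
  shows "Ck_on (Suc k) S f"
proof -
  have "f' x = frechet_derivative f (at x)" if "x \<in> S" for x
    using frechet_derivative_at assms(2) that by blast
  then have "Ck_on k S (\<lambda>x. frechet_derivative f (at x) v)" for v
    by (intro Ck_on_cong[OF assms(1) assms(3)[of v]]) auto
  then show ?thesis using assms(2) by (auto simp: differentiable_def)
qed

lemma Ck_on_Suc_imp: "Ck_on (Suc k) S f \<Longrightarrow> Ck_on k S f"
proof (induction k arbitrary: f)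
  case 0
  then show ?case
    by (auto intro!: differentiable_imp_continuous_on simp: differentiable_on_def differentiable_at_withinI)
next
  case (Suc k)
  then show ?case by (metis Ck_on.simps(2))
qed

lemma Ck_on_imp_continuous_on: "Ck_on k S f \<Longrightarrow> continuous_on S f"
  by (induction k) (auto dest: Ck_on_Suc_imp simp del: Ck_on.simps(2))

lemma Ck_on_subset: "Ck_on k S f \<Longrightarrow> T \<subseteq> S \<Longrightarrow> Ck_on k T f"
  by (induction k arbitrary: f) (auto intro: continuous_on_subset)

text \<open>Differentiability of every order is a local property; this is what permits gluing functions that
  are given by different formulas on different charts.\<close>

lemma Ck_on_local:
  assumes "\<And>x. x \<in> S \<Longrightarrow> \<exists>T. open T \<and> x \<in> T \<and> Ck_on k T f"
  shows "Ck_on k S f"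
  using assms
proof (induction k arbitrary: f)
  case 0
  then show ?case
    by simp (metis continuous_at_imp_continuous_on continuous_on_eq_continuous_at)
next
  case (Suc k)
  show ?case
    unfolding Ck_on.simps
  proof (intro conjI ballI allI)
    fix x assume "x \<in> S"
    then show "f differentiable at x" using Suc.prems by fastforce
  next
    fix v
    show "Ck_on k S (\<lambda>x. frechet_derivative f (at x) v)"
    proof (rule Suc.IH)
      fix x assume "x \<in> S"
      then show "\<exists>T. open T \<and> x \<in> T \<and> Ck_on k T (\<lambda>x. frechet_derivative f (at x) v)"
        using Suc.prems[of x] by auto
    qed
  qed
qed

lemma Ck_on_const: "open S \<Longrightarrow> Ck_on k S (\<lambda>x. c)"
proof (induction k arbitrary: c)
  case (Suc k)
  show ?case by (rule Ck_on_SucI[where f'="\<lambda>x v. 0"]) (use Suc in auto)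
qed auto

lemma Ck_on_bounded_linear: "open S \<Longrightarrow> bounded_linear f \<Longrightarrow> Ck_on k S f"
proof (cases k)
  case 0
  then show "bounded_linear f \<Longrightarrow> ?thesis" by (simp add: linear_continuous_on)
next
  case (Suc j)
  assume "open S" "bounded_linear f"
  then show ?thesis unfolding Suc
    by (intro Ck_on_SucI[where f'="\<lambda>x. f"] Ck_on_const bounded_linear_imp_has_derivative) auto
qed

lemma Ck_on_add:
  assumes "open S" "Ck_on k S f" "Ck_on k S g"
  shows "Ck_on k S (\<lambda>x. f x + g x)"
  using assms(2,3)
proof (induction k arbitrary: f g)
  case (Suc k)
  show ?case
    by (rule Ck_on_SucI[OF assms(1) has_derivative_add[OF Ck_on_SucD Ck_on_SucD]])
      (use Suc in auto)
qed (auto intro: continuous_on_add)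

lemma Ck_on_sum:
  assumes "open S" "\<And>i. i \<in> I \<Longrightarrow> Ck_on k S (f i)"
  shows "Ck_on k S (\<lambda>x. \<Sum>i\<in>I. f i x)"
  using assms(2)
  by (induction I rule: infinite_finite_induct) (auto intro: Ck_on_const Ck_on_add assms(1))

lemma Ck_on_scaleR:
  assumes "open S" "Ck_on k S f" "Ck_on k S g"
  shows "Ck_on k S (\<lambda>x. f x *\<^sub>R g x)"
  using assms(2,3)
proof (induction k arbitrary: f g)
  case (Suc k)
  have "Ck_on k S f" "Ck_on k S g" using Suc.prems Ck_on_Suc_imp by blast+
  then show ?case
    by (intro Ck_on_SucI[OF assms(1) has_derivative_scaleR[OF Ck_on_SucD Ck_on_SucD]]
        Ck_on_add assms(1) Suc.IH)
      (use Suc.prems in auto)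
qed (auto intro: continuous_on_scaleR)

lemma Ck_on_bounded_linear_compose:
  assumes "open S" "bounded_linear l" "Ck_on k S f"
  shows "Ck_on k S (\<lambda>x. l (f x))"
  using assms(3)
proof (induction k arbitrary: f)
  case (Suc k)
  show ?case
    by (rule Ck_on_SucI[OF assms(1) bounded_linear.has_derivative[OF assms(2) Ck_on_SucD]])
      (use Suc in auto)
qed (use assms(2) in \<open>auto intro: bounded_linear.continuous_on\<close>)

text \<open>The chain rule expresses the derivative of a composition through the partial derivatives of
  the outer map, which is why the intermediate space is Euclidean: the induction on the order of
  differentiability then only needs sums and products.\<close>

lemma Ck_on_compose:
  fixes g :: "'a::real_normed_vector \<Rightarrow> 'b::euclidean_space"
  assumes "open S" "Ck_on k S g" "Ck_on k T f" "g ` S \<subseteq> T"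
  shows "Ck_on k S (\<lambda>x. f (g x))"
  using assms(2,3)
proof (induction k arbitrary: f)
  case 0
  then show ?case using assms(4) by (auto intro: continuous_on_compose2)
next
  case (Suc k)
  have g: "Ck_on k S g" using Suc.prems Ck_on_Suc_imp by blast
  let ?D = "\<lambda>x v. \<Sum>b\<in>Basis. (frechet_derivative g (at x) v \<bullet> b) *\<^sub>R frechet_derivative f (at (g x)) b"
  show ?case
  proof (rule Ck_on_SucI[OF assms(1), where f' = ?D])
    fix x assume x: "x \<in> S"
    then have gx: "g x \<in> T" using assms(4) by auto
    have f: "(f has_derivative frechet_derivative f (at (g x))) (at (g x))"
      using Ck_on_SucD[OF Suc.prems(2) gx] .
    interpret F: bounded_linear "frechet_derivative f (at (g x))"
      using f by (rule has_derivative_bounded_linear)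
    have chain: "((\<lambda>x. f (g x)) has_derivative (\<lambda>v. frechet_derivative f (at (g x)) (frechet_derivative g (at x) v))) (at x)"
      using diff_chain_at[OF Ck_on_SucD[OF Suc.prems(1) x] f] by (simp add: o_def)
    have eq: "frechet_derivative f (at (g x)) w = (\<Sum>b\<in>Basis. (w \<bullet> b) *\<^sub>R frechet_derivative f (at (g x)) b)" for w
      by (subst euclidean_representation[of w, symmetric]) (simp only: F.sum F.scaleR)
    have "(\<lambda>v. frechet_derivative f (at (g x)) (frechet_derivative g (at x) v)) = ?D x"
      by (rule ext) (rule eq)
    with chain show "((\<lambda>x. f (g x)) has_derivative ?D x) (at x)"
      by (rule back_subst[of "\<lambda>h. ((\<lambda>x. f (g x)) has_derivative h) (at x)"])
  next
    fix v
    show "Ck_on k S (\<lambda>x. ?D x v)"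
    proof (intro Ck_on_sum Ck_on_scaleR assms(1))
      fix b :: 'b
      show "Ck_on k S (\<lambda>x. frechet_derivative g (at x) v \<bullet> b)"
        using Suc.prems(1)
        by (intro Ck_on_bounded_linear_compose[OF assms(1) bounded_linear_inner_left]) auto
      show "Ck_on k S (\<lambda>x. frechet_derivative f (at (g x)) b)"
        by (rule Suc.IH[OF g]) (use Suc.prems(2) in auto)
    qed
  qed
qed

lemma Ck_on_inverse:
  fixes f :: "'a::real_normed_vector \<Rightarrow> real"
  assumes "open S" "Ck_on k S f" "\<And>x. x \<in> S \<Longrightarrow> f x \<noteq> 0"
  shows "Ck_on k S (\<lambda>x. inverse (f x))"
  using assms(2)
proof (induction k)
  case 0
  then show ?case using assms(3) by (auto intro: continuous_on_inverse)
next
  case (Suc k)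
  have f: "Ck_on k S (\<lambda>x. inverse (f x))" using Suc Ck_on_Suc_imp by blast
  let ?D = "\<lambda>x v. (- frechet_derivative f (at x) v) *\<^sub>R (inverse (f x) *\<^sub>R inverse (f x))"
  show ?case
  proof (rule Ck_on_SucI[OF assms(1), where f' = ?D])
    fix x assume "x \<in> S"
    from Deriv.has_derivative_inverse[OF assms(3)[OF this] Ck_on_SucD[OF Suc.prems this]]
    show "((\<lambda>x. inverse (f x)) has_derivative ?D x) (at x)"
      by (simp add: mult_ac)
  next
    fix v
    show "Ck_on k S (\<lambda>x. ?D x v)"
      using Suc.prems f
      by (intro Ck_on_scaleR assms(1) Ck_on_bounded_linear_compose[OF _ bounded_linear_minus[OF bounded_linear_ident]]) auto
  qed
qed

lemma smooth_on_imp_Ck_on: "smooth_on S f \<Longrightarrow> Ck_on k S f"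
  by (simp add: smooth_on_def)

lemma smooth_on_imp_continuous_on: "smooth_on S f \<Longrightarrow> continuous_on S f"
  using Ck_on_imp_continuous_on smooth_on_imp_Ck_on by blast

lemma smooth_on_local:
  assumes "open S" "\<And>x. x \<in> S \<Longrightarrow> \<exists>T. x \<in> T \<and> smooth_on T f"
  shows "smooth_on S f"
  using assms unfolding smooth_on_def by (metis Ck_on_local)

lemma smooth_on_cong:
  assumes "smooth_on S f" "\<And>x. x \<in> S \<Longrightarrow> f x = g x"
  shows "smooth_on S g"
  using assms unfolding smooth_on_def by (metis Ck_on_cong)

lemma smooth_on_subset: "smooth_on S f \<Longrightarrow> open T \<Longrightarrow> T \<subseteq> S \<Longrightarrow> smooth_on T f"
  unfolding smooth_on_def using Ck_on_subset by blast

lemma smooth_on_compose: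
  fixes g :: "'a::real_normed_vector \<Rightarrow> 'b::euclidean_space"
  assumes "smooth_on S g" "smooth_on T f" "g ` S \<subseteq> T"
  shows "smooth_on S (\<lambda>x. f (g x))"
  using assms unfolding smooth_on_def by (metis Ck_on_compose)

lemma smooth_on_scaleR: "smooth_on S f \<Longrightarrow> smooth_on S g \<Longrightarrow> smooth_on S (\<lambda>x. f x *\<^sub>R g x)"
  unfolding smooth_on_def using Ck_on_scaleR by blast

lemma smooth_on_add: "smooth_on S f \<Longrightarrow> smooth_on S g \<Longrightarrow> smooth_on S (\<lambda>x. f x + g x)"
  unfolding smooth_on_def using Ck_on_add by blast

lemma smooth_on_mult: "smooth_on S f \<Longrightarrow> smooth_on S g \<Longrightarrow> smooth_on S (\<lambda>x. f x * (g x :: real))"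
  using smooth_on_scaleR[of S f g] by simp

lemma smooth_on_const: "open S \<Longrightarrow> smooth_on S (\<lambda>x. c)"
  unfolding smooth_on_def using Ck_on_const by blast

lemma smooth_on_bounded_linear: "open S \<Longrightarrow> bounded_linear f \<Longrightarrow> smooth_on S f"
  unfolding smooth_on_def using Ck_on_bounded_linear by blast

text \<open>The additional factor \<open>x\<^sup>-\<^sup>n\<close> makes the linear span of these functions closed under differentiation,
  so that smoothness follows by induction on the order, for all \<open>n\<close> at once.\<close>

definition flat_at_0 :: "nat \<Rightarrow> real \<Rightarrow> real" where
  "flat_at_0 n x = (if x > 0 then exp (- inverse x) * inverse x ^ n else 0)"

lemma flat_at_0_tendsto: "(flat_at_0 n \<longlongrightarrow> 0) (at 0)"
proof -
  have "((\<lambda>x::real. inverse x ^ n / exp (inverse x)) \<longlongrightarrow> 0) (at_right 0)"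
    by (rule filterlim_compose[OF tendsto_power_div_exp_0 filterlim_inverse_at_top_right])
  then have "((\<lambda>x::real. flat_at_0 n x) \<longlongrightarrow> 0) (at_right 0)"
    by (rule tendsto_cong[THEN iffD1, rotated])
      (auto simp: flat_at_0_def eventually_at_filter exp_minus field_simps)
  moreover have "((\<lambda>x::real. flat_at_0 n x) \<longlongrightarrow> 0) (at_left 0)"
    by (rule tendsto_eventually) (auto simp: flat_at_0_def eventually_at_filter)
  ultimately show ?thesis by (simp add: filterlim_split_at)
qed

lemma flat_at_0_has_derivative:
  "(flat_at_0 n has_real_derivative (flat_at_0 (n + 2) x - real n * flat_at_0 (n + 1) x)) (at x)"
proof -
  consider "x > 0" | "x < 0" | "x = 0" by linarith
  then show ?thesis
  proof cases
    case 1
    have "((\<lambda>x. exp (- inverse x) * inverse x ^ n) has_real_derivative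
        (exp (- inverse x) * (inverse x * inverse x) * inverse x ^ n -
          exp (- inverse x) * (real n * inverse x ^ (n - 1) * (inverse x * inverse x)))) (at x)"
      using 1 by (auto intro!: derivative_eq_intros simp: algebra_simps)
    moreover have "real n * inverse x ^ (n - 1) * (inverse x * inverse x) = real n * inverse x ^ (n + 1)"
      by (cases n) auto
    ultimately have "((\<lambda>x. exp (- inverse x) * inverse x ^ n) has_real_derivative
         (flat_at_0 (n + 2) x - real n * flat_at_0 (n + 1) x)) (at x)"
      using 1 by (cases n) (simp_all add: flat_at_0_def algebra_simps)
    then show ?thesis
      by (rule has_field_derivative_transform_within_open[where S="{0<..}"]) (use 1 in \<open>auto simp: flat_at_0_def\<close>)
  next
    case 2
    have "((\<lambda>x. 0) has_real_derivative (flat_at_0 (n + 2) x - real n * flat_at_0 (n + 1) x)) (at x)"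
      using 2 by (simp add: flat_at_0_def)
    then show ?thesis
      by (rule has_field_derivative_transform_within_open[where S="{..<0}"]) (use 2 in \<open>auto simp: flat_at_0_def\<close>)
  next
    case 3
    have "((\<lambda>y. flat_at_0 n y / y) \<longlongrightarrow> 0) (at 0)"
      by (rule tendsto_cong[THEN iffD1, OF _ flat_at_0_tendsto[of "Suc n"]])
        (auto simp: flat_at_0_def eventually_at_filter divide_inverse)
    then show ?thesis using 3 by (simp add: has_field_derivative_iff flat_at_0_def)
  qed
qed

lemma smooth_on_flat_at_0: "smooth_on UNIV (flat_at_0 n)"
proof -
  have "Ck_on k UNIV (flat_at_0 n)" for k
  proof (induction k arbitrary: n)
    case 0
    then show ?case using flat_at_0_has_derivative
      by (auto intro!: DERIV_continuous_on)
  next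
    case (Suc k)
    show ?case
    proof (rule Ck_on_SucI[OF open_UNIV])
      fix x
      show "(flat_at_0 n has_derivative (\<lambda>v. v *\<^sub>R (flat_at_0 (n+2) x + (- real n) *\<^sub>R flat_at_0 (n+1) x))) (at x)"
        using flat_at_0_has_derivative[of n x]
        by (simp add: has_field_derivative_def mult.commute[of _ "_ - _"])
      show "Ck_on k UNIV (\<lambda>x. v *\<^sub>R (flat_at_0 (n+2) x + (- real n) *\<^sub>R flat_at_0 (n+1) x))" for v
        by (intro Ck_on_scaleR Ck_on_add Ck_on_const open_UNIV Suc.IH)
    qed
  qed
  then show ?thesis by (simp add: smooth_on_def)
qed

text \<open>The quotient \<open>f / (f + g)\<close>, where \<open>f\<close> vanishes far away from \<open>p\<close> and \<open>g\<close> vanishes near \<open>p\<close>, both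
  being flat functions of the squared distance; their zero sets are disjoint, which keeps \<open>f + g\<close> positive.\<close>

lemma exists_smooth_bump:
  fixes p :: "'a::euclidean_space"
  assumes "0 < r"
  obtains b :: "'a \<Rightarrow> real" where "smooth_on UNIV b" "\<And>x. dist p x \<le> r \<Longrightarrow> b x = 1"
    "\<And>x. dist p x \<ge> 2 * r \<Longrightarrow> b x = 0"
proof
  let ?q = "\<lambda>x. (x - p) \<bullet> (x - p)"
  let ?f = "\<lambda>x. flat_at_0 0 (4 * r\<^sup>2 - ?q x)"
  let ?g = "\<lambda>x. flat_at_0 0 (?q x - r\<^sup>2)"
  let ?b = "\<lambda>x. ?f x * inverse (?f x + ?g x)"
  have r: "r\<^sup>2 < 4 * r\<^sup>2" using assms by simp
  have q: "?q x = (dist p x)\<^sup>2" for x unfolding dist_norm norm_minus_commute[of p x] power2_norm_eq_inner ..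
  have lin: "smooth_on UNIV (\<lambda>x::'a. (x - p) \<bullet> b)" for b
  proof -
    have "smooth_on UNIV (\<lambda>x::'a. x \<bullet> b + (- (p \<bullet> b)))"
      by (intro smooth_on_add smooth_on_const smooth_on_bounded_linear bounded_linear_inner_left open_UNIV)
    then show ?thesis by (simp add: inner_diff_left)
  qed
  have "smooth_on UNIV (\<lambda>x. \<Sum>b\<in>Basis. ((x - p) \<bullet> b) *\<^sub>R ((x - p) \<bullet> b))"
    using lin unfolding smooth_on_def
    by (intro conjI allI open_UNIV Ck_on_sum[OF open_UNIV] Ck_on_scaleR[OF open_UNIV]) blast+
  then have sq: "smooth_on UNIV ?q"
    by (rule smooth_on_cong) (simp only: real_scaleR_def euclidean_inner[symmetric])
  have "smooth_on UNIV (\<lambda>x. flat_at_0 0 (4 * r\<^sup>2 + (-1) * ?q x))"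
    by (intro smooth_on_compose[OF _ smooth_on_flat_at_0] smooth_on_add smooth_on_const smooth_on_mult sq) auto
  then have f: "smooth_on UNIV ?f" by simp
  have "smooth_on UNIV (\<lambda>x. flat_at_0 0 (?q x + (- r\<^sup>2)))"
    by (intro smooth_on_compose[OF _ smooth_on_flat_at_0] smooth_on_add smooth_on_const sq) auto
  then have g: "smooth_on UNIV ?g" by simp
  have pos: "?f x + ?g x > 0" for x
  proof (cases "?q x < 4 * r\<^sup>2")
    case True
    then show ?thesis by (intro add_pos_nonneg) (auto simp: flat_at_0_def)
  next
    case False
    then have "?q x > r\<^sup>2" using r by linarith
    then show ?thesis by (intro add_nonneg_pos) (auto simp: flat_at_0_def)
  qed
  have "smooth_on UNIV (\<lambda>x. inverse (?f x + ?g x))"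
    unfolding smooth_on_def
    by (intro conjI allI open_UNIV Ck_on_inverse[OF open_UNIV] smooth_on_imp_Ck_on[OF smooth_on_add[OF f g]]
        less_imp_neq[OF pos, symmetric])
  then show "smooth_on UNIV ?b" by (intro smooth_on_mult f)
  show "?b x = 1" if "dist p x \<le> r" for x
  proof -
    have "?q x \<le> r\<^sup>2" unfolding q using that by (simp add: power_mono)
    moreover from this have "?q x < 4 * r\<^sup>2" using r by linarith
    ultimately have "?g x = 0" "?f x > 0" by (auto simp: flat_at_0_def)
    then show ?thesis by simp
  qed
  show "?b x = 0" if "dist p x \<ge> 2 * r" for x
  proof -
    have "?q x \<ge> (2 * r)\<^sup>2" unfolding q using that assms by (intro power_mono) auto
    then show ?thesis by (simp add: flat_at_0_def)
  qed
qed

section \<open>Invariant vector fields and the exponential map\<close>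

text \<open>The partial derivatives are bounded on the compact ball. This supplies the Lipschitz condition for
  the uniqueness of integral curves.\<close>

lemma Ck_on_1_lipschitz_on_cball:
  fixes F :: "'a::euclidean_space \<Rightarrow> 'b::real_normed_vector"
  assumes "Ck_on 1 S F" "cball p r \<subseteq> S"
  obtains L where "L \<ge> 0" "\<And>u w. u \<in> cball p r \<Longrightarrow> w \<in> cball p r \<Longrightarrow> norm (F u - F w) \<le> L * norm (u - w)"
proof -
  have "\<exists>B\<ge>0. \<forall>u\<in>cball p r. norm (frechet_derivative F (at u) b) \<le> B" for b
  proof -
    have "continuous_on (cball p r) (\<lambda>u. frechet_derivative F (at u) b)"
      using assms by (auto intro: continuous_on_subset)
    then have "bounded ((\<lambda>u. frechet_derivative F (at u) b) ` cball p r)"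
      by (intro compact_imp_bounded compact_continuous_image compact_cball)
    then obtain B where "B > 0" "\<forall>x\<in>(\<lambda>u. frechet_derivative F (at u) b) ` cball p r. norm x \<le> B"
      unfolding bounded_pos by blast
    then show ?thesis by (intro exI[of _ B]) auto
  qed
  then obtain B where B: "\<And>b. B b \<ge> 0" "\<And>b u. u \<in> cball p r \<Longrightarrow> norm (frechet_derivative F (at u) b) \<le> B b"
    by metis
  let ?L = "\<Sum>b\<in>Basis. B b"
  have der: "(F has_derivative frechet_derivative F (at u)) (at u)" if "u \<in> cball p r" for u
    using Ck_on_SucD[of 0 S F u] assms that by auto
  have on: "onorm (frechet_derivative F (at u)) \<le> ?L" if u: "u \<in> cball p r" for u
  proof (rule onorm_le)
    fix v :: 'a
    interpret D: bounded_linear "frechet_derivative F (at u)"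
      using der[OF u] by (rule has_derivative_bounded_linear)
    have "frechet_derivative F (at u) v = (\<Sum>b\<in>Basis. (v \<bullet> b) *\<^sub>R frechet_derivative F (at u) b)"
      by (subst euclidean_representation[of v, symmetric]) (simp only: D.sum D.scaleR)
    also have "norm \<dots> \<le> (\<Sum>b\<in>Basis. norm v * B b)"
      by (intro sum_norm_le) (auto intro!: mult_mono B u Basis_le_norm)
    finally show "norm (frechet_derivative F (at u) v) \<le> ?L * norm v"
      by (simp add: sum_distrib_left mult.commute)
  qed
  show thesis
  proof (rule that)
    show "0 \<le> ?L" using B(1) by (intro sum_nonneg) auto
    show "norm (F u - F w) \<le> ?L * norm (u - w)" if "u \<in> cball p r" "w \<in> cball p r" for u w
      using that on has_derivative_at_withinI[OF der]
      by (intro differentiable_bound[of "cball p r" F "\<lambda>u. frechet_derivative F (at u)"]) auto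
  qed
qed

locale lie_exp_group = group G
  for G :: "'G::{t2_space,second_countable_topology} monoid" (structure) +
  fixes \<A> :: "('G, 'g::euclidean_space) chart set"
    and vf :: "'g \<Rightarrow> ('G \<Rightarrow> real) \<Rightarrow> 'G \<Rightarrow> real"
    and Exp :: "'g \<Rightarrow> 'G"
  assumes lie: "lie_group G \<A>" and iso: "lie_algebra_iso G \<A> vf" and expo: "lie_exponential G \<A> vf Exp"
begin

lemma carrier_UNIV [simp]: "carrier G = UNIV"
  using lie by (simp add: lie_group_def)

lemma mult_inv_cancel: "x \<otimes> (inv x \<otimes> z) = z" and inv_mult_cancel: "inv x \<otimes> (x \<otimes> z) = z"
  by (simp_all add: m_assoc[symmetric])

lemma continuous_mult: "continuous_on UNIV (\<lambda>(x, y). x \<otimes> y)"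
  and continuous_inv: "continuous_on UNIV (\<lambda>x. inv x)"
  using lie by (auto simp: lie_group_def)

lemma continuous_on_gmult [continuous_intros]:
  "continuous_on S f \<Longrightarrow> continuous_on S g \<Longrightarrow> continuous_on S (\<lambda>x. f x \<otimes> g x)"
  using continuous_on_compose2[OF continuous_mult, of S "\<lambda>x. (f x, g x)"] by (auto intro: continuous_on_Pair)

lemma continuous_on_ginv [continuous_intros]:
  "continuous_on S f \<Longrightarrow> continuous_on S (\<lambda>x. inv (f x))"
  using continuous_on_compose2[OF continuous_inv, of S f] by auto

lemma atlas: "smooth_atlas \<A>"
  using lie by (simp add: lie_group_def)

lemma chart_exists: obtains U \<phi> where "(U, \<phi>) \<in> \<A>" "x \<in> U"
proof -
  have "x \<in> (\<Union>(U, \<phi>)\<in>\<A>. U)" using atlas by (simp add: smooth_atlas_def)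
  then show thesis using that by auto
qed

lemma chart:
  assumes "(U, \<phi>) \<in> \<A>"
  shows "open U" "open (\<phi> ` U)" "continuous_on U \<phi>" "continuous_on (\<phi> ` U) (inv_into U \<phi>)"
    "x \<in> U \<Longrightarrow> inv_into U \<phi> (\<phi> x) = x" "u \<in> \<phi> ` U \<Longrightarrow> \<phi> (inv_into U \<phi> u) = u"
    "u \<in> \<phi> ` U \<Longrightarrow> inv_into U \<phi> u \<in> U"
proof -
  have "open U" "open (\<phi> ` U)" and h: "homeomorphism U (\<phi> ` U) \<phi> (inv_into U \<phi>)"
    using bspec[OF conjunct1[OF conjunct2[OF atlas[unfolded smooth_atlas_def]]] assms]
    unfolding prod.case by (iprover elim: conjE)+
  then show "open U" "open (\<phi> ` U)" by iprover+
  show "continuous_on U \<phi>" "continuous_on (\<phi> ` U) (inv_into U \<phi>)"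
    "x \<in> U \<Longrightarrow> inv_into U \<phi> (\<phi> x) = x" "u \<in> \<phi> ` U \<Longrightarrow> \<phi> (inv_into U \<phi> u) = u"
    using h unfolding homeomorphism_def by blast+
  show "u \<in> \<phi> ` U \<Longrightarrow> inv_into U \<phi> u \<in> U" by (rule inv_into_into)
qed

lemma chart_open_image:
  assumes "(U, \<phi>) \<in> \<A>" "open W"
  shows "open (\<phi> ` (U \<inter> W))"
proof -
  have "\<phi> ` (U \<inter> W) = \<phi> ` U \<inter> inv_into U \<phi> -` W"
    using chart(5)[OF assms(1)] by auto
  then show ?thesis
    using continuous_open_preimage[OF chart(4)[OF assms(1)] chart(2)[OF assms(1)] assms(2)] by simp
qed

lemma transition_smooth:
  "(U, \<phi>) \<in> \<A> \<Longrightarrow> (V, \<psi>) \<in> \<A> \<Longrightarrow> smooth_on (\<phi> ` (U \<inter> V)) (\<lambda>x. \<psi> (inv_into U \<phi> x))"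
  using bspec[OF bspec[OF conjunct2[OF conjunct2[OF atlas[unfolded smooth_atlas_def]]],
        of "(U, \<phi>)", unfolded prod.case], of "(V, \<psi>)"] by auto

lemma smooth_funs_iff:
  "f \<in> smooth_funs \<A> \<longleftrightarrow> (\<forall>(U, \<phi>)\<in>\<A>. smooth_on (\<phi> ` U) (\<lambda>x. f (inv_into U \<phi> x)))"
  by (simp add: smooth_funs_def smooth_mfd_on_def)

lemma smooth_funsD: "f \<in> smooth_funs \<A> \<Longrightarrow> (U, \<phi>) \<in> \<A> \<Longrightarrow> smooth_on (\<phi> ` U) (\<lambda>x. f (inv_into U \<phi> x))"
  by (auto simp: smooth_funs_iff)

lemma smooth_funs_continuous:
  assumes "f \<in> smooth_funs \<A>" shows "continuous_on UNIV f"
proof (rule continuous_at_imp_continuous_on, rule ballI)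
  fix x
  obtain U \<phi> where U: "(U, \<phi>) \<in> \<A>" "x \<in> U" by (rule chart_exists)
  have "continuous_on U (\<lambda>x. f (inv_into U \<phi> (\<phi> x)))"
    using smooth_on_imp_continuous_on[OF smooth_funsD[OF assms U(1)]] chart(3)[OF U(1)]
    by (rule continuous_on_compose2) auto
  then have "continuous_on U f" by (rule continuous_on_eq) (simp add: chart[OF U(1)])
  then show "isCont f x" using U chart(1)[OF U(1)] continuous_on_eq_continuous_at by blast
qed

text \<open>A smooth function of the chart coordinates with compact support extends by zero; this is
  where the Hausdorff property is used: the compact support is closed in the group.\<close>

lemma smooth_funs_extend_chart:
  assumes U: "(U, \<phi>) \<in> \<A>" and k: "smooth_on UNIV k" "compact C" "C \<subseteq> \<phi> ` U" "\<And>u. u \<notin> C \<Longrightarrow> k u = 0"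
  shows "(\<lambda>x. if x \<in> U then k (\<phi> x) else (0::real)) \<in> smooth_funs \<A>" (is "?F \<in> _")
  unfolding smooth_funs_iff
proof safe
  fix V \<psi> assume V: "(V, \<psi>) \<in> \<A>"
  show "smooth_on (\<psi> ` V) (\<lambda>x. ?F (inv_into V \<psi> x))"
  proof (rule smooth_on_local[OF chart(2)[OF V]])
    fix v assume v: "v \<in> \<psi> ` V"
    let ?x = "inv_into V \<psi> v"
    show "\<exists>T. v \<in> T \<and> smooth_on T (\<lambda>x. ?F (inv_into V \<psi> x))"
    proof (cases "?x \<in> U")
      case True
      let ?T = "\<psi> ` (V \<inter> U)"
      have "smooth_on ?T (\<lambda>v. k (\<phi> (inv_into V \<psi> v)))"
        by (rule smooth_on_compose[OF transition_smooth[OF V U] k(1)]) simp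
      then have "smooth_on ?T (\<lambda>x. ?F (inv_into V \<psi> x))"
      proof (rule smooth_on_cong)
        fix w assume "w \<in> ?T"
        then have "inv_into V \<psi> w \<in> U" using chart(5)[OF V] by auto
        then show "k (\<phi> (inv_into V \<psi> w)) = ?F (inv_into V \<psi> w)" by simp
      qed
      moreover have "v \<in> ?T" using True v chart(6,7)[OF V v] by (intro image_eqI[of _ _ ?x]) auto
      ultimately show ?thesis by (intro exI[of _ ?T] conjI)
    next
      case False
      let ?K = "inv_into U \<phi> ` C"
      let ?T = "\<psi> ` (V \<inter> - ?K)"
      have "compact ?K"
        by (rule compact_continuous_image[OF continuous_on_subset[OF chart(4)[OF U] k(3)] k(2)])
      then have "open (- ?K)" by (simp add: compact_imp_closed open_Compl)
      then have "smooth_on ?T (\<lambda>x. 0::real)"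
        by (intro smooth_on_const chart_open_image[OF V])
      moreover have "0 = ?F (inv_into V \<psi> w)" if w: "w \<in> ?T" for w
      proof -
        have "inv_into V \<psi> w \<notin> ?K" using w chart(5)[OF V] by auto
        then have "\<phi> (inv_into V \<psi> w) \<notin> C" if "inv_into V \<psi> w \<in> U"
          using chart(5)[OF U that] by (metis image_eqI)
        then show ?thesis using k(4) by auto
      qed
      ultimately have "smooth_on ?T (\<lambda>x. ?F (inv_into V \<psi> x))" by (rule smooth_on_cong)
      moreover have "v \<in> ?T"
      proof -
        have "?x \<notin> ?K" using False k(3) chart(7)[OF U] by auto
        then show ?thesis using v chart(6,7)[OF V v] by (intro image_eqI[of _ _ ?x]) auto
      qed
      ultimately show ?thesis by (intro exI[of _ ?T] conjI)
    qed
  qed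
qed

lemma bump_function:
  assumes "open W" "x0 \<in> W"
  obtains f where "f \<in> smooth_funs \<A>" "f x0 = 1" "\<And>x. x \<notin> W \<Longrightarrow> f x = 0"
proof -
  obtain U \<phi> where U: "(U, \<phi>) \<in> \<A>" "x0 \<in> U" by (rule chart_exists)
  have "open (\<phi> ` (U \<inter> W))" "\<phi> x0 \<in> \<phi> ` (U \<inter> W)" using U assms by (auto intro: chart_open_image)
  then obtain R where R: "R > 0" "cball (\<phi> x0) R \<subseteq> \<phi> ` (U \<inter> W)" by (meson open_contains_cball)
  obtain b :: "'g \<Rightarrow> real" where b: "smooth_on UNIV b" "\<And>x. dist (\<phi> x0) x \<le> R/2 \<Longrightarrow> b x = 1"
    "\<And>x. dist (\<phi> x0) x \<ge> 2 * (R/2) \<Longrightarrow> b x = 0"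
    using exists_smooth_bump[of "R/2" "\<phi> x0"] R(1) by auto
  show thesis
  proof
    show "(\<lambda>x. if x \<in> U then b (\<phi> x) else 0) \<in> smooth_funs \<A>"
      by (rule smooth_funs_extend_chart[OF U(1) b(1), of "cball (\<phi> x0) R"]) (use R b(3) in \<open>auto simp: not_le\<close>)
    show "(if x0 \<in> U then b (\<phi> x0) else 0) = 1" using U b(2) R by auto
    fix x assume x: "x \<notin> W"
    show "(if x \<in> U then b (\<phi> x) else 0) = 0"
    proof (cases "x \<in> U")
      case True
      have "\<phi> x \<notin> cball (\<phi> x0) R"
        using R(2) x chart(5)[OF U(1)] True by (metis IntE imageE subsetD)
      then show ?thesis using b(3)[of "\<phi> x"] by auto
    qed auto
  qed
qed

text \<open>Chart coordinates, cut off so that they become globally defined smooth functions.\<close>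

lemma coordinate_functions:
  obtains U \<phi> N f where "(U, \<phi>) \<in> \<A>" "open N" "x0 \<in> N" "N \<subseteq> U"
    "\<And>b. f b \<in> smooth_funs \<A>" "\<And>b x. x \<in> N \<Longrightarrow> f b x = \<phi> x \<bullet> b"
proof -
  obtain U \<phi> where U: "(U, \<phi>) \<in> \<A>" "x0 \<in> U" by (rule chart_exists)
  have "open (\<phi> ` U)" "\<phi> x0 \<in> \<phi> ` U" using U chart(2)[OF U(1)] by auto
  then obtain R where R: "R > 0" "cball (\<phi> x0) R \<subseteq> \<phi> ` U" by (meson open_contains_cball)
  obtain k :: "'g \<Rightarrow> real" where k: "smooth_on UNIV k" "\<And>x. dist (\<phi> x0) x \<le> R/2 \<Longrightarrow> k x = 1"
    "\<And>x. dist (\<phi> x0) x \<ge> 2 * (R/2) \<Longrightarrow> k x = 0"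
    using exists_smooth_bump[of "R/2" "\<phi> x0"] R(1) by auto
  let ?N = "U \<inter> \<phi> -` ball (\<phi> x0) (R/2)"
  show thesis
  proof
    show "(U, \<phi>) \<in> \<A>" by fact
    show "open ?N" by (rule continuous_open_preimage[OF chart(3,1)]) (use U in auto)
    show "x0 \<in> ?N" "?N \<subseteq> U" using U R by auto
    fix b
    have "smooth_on UNIV (\<lambda>u. k u * (u \<bullet> b))"
      by (intro smooth_on_mult k smooth_on_bounded_linear bounded_linear_inner_left open_UNIV)
    then show "(\<lambda>x. if x \<in> U then k (\<phi> x) * (\<phi> x \<bullet> b) else 0) \<in> smooth_funs \<A>"
      by (rule smooth_funs_extend_chart[OF U(1), of _ "cball (\<phi> x0) R"]) (use R k(3) in \<open>auto simp: not_le\<close>)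
    show "(if x \<in> U then k (\<phi> x) * (\<phi> x \<bullet> b) else 0) = \<phi> x \<bullet> b" if "x \<in> ?N" for x
      using that k(2)[of "\<phi> x"] by auto
  qed
qed

lemma smooth_mult_in_charts:
  assumes h: "h \<in> smooth_funs \<A>" and U: "(U, \<phi>) \<in> \<A>" and V: "(V, \<psi>) \<in> \<A>"
  shows "smooth_on (\<phi> ` U \<times> \<psi> ` V) (\<lambda>p. h (inv_into U \<phi> (fst p) \<otimes> inv_into V \<psi> (snd p)))" (is "smooth_on _ ?H")
proof (rule smooth_on_local)
  show "open (\<phi> ` U \<times> \<psi> ` V)" by (intro open_Times chart(2)[OF U] chart(2)[OF V])
  fix p assume p: "p \<in> \<phi> ` U \<times> \<psi> ` V"
  obtain W \<eta> where W: "(W, \<eta>) \<in> \<A>" "inv_into U \<phi> (fst p) \<otimes> inv_into V \<psi> (snd p) \<in> W" by (rule chart_exists)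
  let ?Z = "{(x, y). x \<in> \<phi> ` U \<and> y \<in> \<psi> ` V \<and> inv_into U \<phi> x \<otimes> inv_into V \<psi> y \<in> W}"
  have m: "smooth_on ?Z (\<lambda>(x, y). \<eta> (inv_into U \<phi> x \<otimes> inv_into V \<psi> y))"
    using lie U V W(1) unfolding lie_group_def by blast
  have "smooth_on ?Z (\<lambda>p. h (inv_into W \<eta> (case p of (x, y) \<Rightarrow> \<eta> (inv_into U \<phi> x \<otimes> inv_into V \<psi> y))))"
    by (rule smooth_on_compose[OF m smooth_funsD[OF h W(1)]]) auto
  then have "smooth_on ?Z ?H"
    by (rule smooth_on_cong) (auto simp: chart(5)[OF W(1)])
  moreover have "p \<in> ?Z" using p W by (auto simp: case_prod_beta)
  ultimately show "\<exists>T. p \<in> T \<and> smooth_on T ?H" by (intro exI[of _ ?Z] conjI)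
qed

lemma smooth_funs_right_translate:
  assumes h: "h \<in> smooth_funs \<A>" shows "(\<lambda>y. h (y \<otimes> g)) \<in> smooth_funs \<A>"
  unfolding smooth_funs_iff
proof safe
  fix U \<phi> assume U: "(U, \<phi>) \<in> \<A>"
  obtain V \<psi> where V: "(V, \<psi>) \<in> \<A>" "g \<in> V" by (rule chart_exists)
  have "smooth_on (\<phi> ` U) (\<lambda>u. (u, 0) + (0, \<psi> g))"
    by (intro smooth_on_add smooth_on_const smooth_on_bounded_linear bounded_linear_Pair bounded_linear_ident
        bounded_linear_zero chart(2)[OF U])
  from smooth_on_compose[OF this smooth_mult_in_charts[OF h U V(1)]]
  show "smooth_on (\<phi> ` U) (\<lambda>u. h (inv_into U \<phi> u \<otimes> g))"
    using V by (auto simp: chart(5)[OF V(1)])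
qed

lemma smooth_funs_left_translate:
  assumes h: "h \<in> smooth_funs \<A>" shows "(\<lambda>y. h (g \<otimes> y)) \<in> smooth_funs \<A>"
  unfolding smooth_funs_iff
proof safe
  fix U \<phi> assume U: "(U, \<phi>) \<in> \<A>"
  obtain V \<psi> where V: "(V, \<psi>) \<in> \<A>" "g \<in> V" by (rule chart_exists)
  have "smooth_on (\<phi> ` U) (\<lambda>u. (0, u) + (\<psi> g, 0))"
    by (intro smooth_on_add smooth_on_const smooth_on_bounded_linear bounded_linear_Pair bounded_linear_ident
        bounded_linear_zero chart(2)[OF U])
  from smooth_on_compose[OF this smooth_mult_in_charts[OF h V(1) U]]
  show "smooth_on (\<phi> ` U) (\<lambda>u. h (g \<otimes> inv_into U \<phi> u))"
    using V by (auto simp: chart(5)[OF V(1)])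
qed

lemma vf_left_invariant: "left_invariant_field G \<A> (vf X)"
  using iso by (simp add: lie_algebra_iso_def)

lemma vf_smooth: "f \<in> smooth_funs \<A> \<Longrightarrow> vf X f \<in> smooth_funs \<A>"
  and vf_left: "f \<in> smooth_funs \<A> \<Longrightarrow> vf X (\<lambda>y. f (g \<otimes> y)) x = vf X f (g \<otimes> x)"
  and vf_lincomb: "f \<in> smooth_funs \<A> \<Longrightarrow> h \<in> smooth_funs \<A> \<Longrightarrow>
    vf X (\<lambda>y. a * f y + b * h y) x = a * vf X f x + b * vf X h x"
  and vf_Leibniz: "f \<in> smooth_funs \<A> \<Longrightarrow> h \<in> smooth_funs \<A> \<Longrightarrow>
    vf X (\<lambda>y. f y * h y) x = vf X f x * h x + f x * vf X h x"
  using vf_left_invariant[of X] unfolding left_invariant_field_def by blast+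

lemma vf_linear: "f \<in> smooth_funs \<A> \<Longrightarrow> vf (a *\<^sub>R X + b *\<^sub>R Y) f x = a * vf X f x + b * vf Y f x"
  using iso by (simp add: lie_algebra_iso_def)

lemma vf_scale: "f \<in> smooth_funs \<A> \<Longrightarrow> vf (a *\<^sub>R X) f x = a * vf X f x"
  using vf_linear[of f a X 0 0 x] by simp

lemma vf_minus: "f \<in> smooth_funs \<A> \<Longrightarrow> vf (- X) f x = - vf X f x"
  using vf_scale[of f "-1" X x] by simp

lemma vf_add: "f \<in> smooth_funs \<A> \<Longrightarrow> vf (X + Y) f x = vf X f x + vf Y f x"
  using vf_linear[of f 1 X 1 Y x] by simp

lemma vf_eqI:
  assumes "\<And>f x. f \<in> smooth_funs \<A> \<Longrightarrow> vf X f x = vf Y f x" shows "X = Y"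
  using iso vf_left_invariant[of X] assms unfolding lie_algebra_iso_def by (metis ext)

text \<open>Left translation carries the value of an invariant field at the identity to every other point.\<close>

lemma vf_eqI_at_one:
  assumes "\<And>f. f \<in> smooth_funs \<A> \<Longrightarrow> vf X f \<one> = vf Y f \<one>" shows "X = Y"
proof (rule vf_eqI)
  fix f x assume f: "f \<in> smooth_funs \<A>"
  show "vf X f x = vf Y f x"
    using assms[OF smooth_funs_left_translate[OF f, of x]] by (simp add: vf_left f)
qed

lemma field_representable:
  assumes "left_invariant_field G \<A> D"
  shows "\<exists>X. \<forall>f\<in>smooth_funs \<A>. \<forall>x. vf X f x = D f x"
proof -
  have "\<exists>!X. \<forall>f\<in>smooth_funs \<A>. vf X f = D f"
    using iso assms by (simp add: lie_algebra_iso_def)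
  then obtain X where "\<forall>f\<in>smooth_funs \<A>. vf X f = D f" by (elim ex1E)
  then show ?thesis by (intro exI[of _ X]) simp
qed

text \<open>A curve with velocity \<open>X\<close>, tested on smooth functions only; no differentiability of the curve itself
  has to be expressed.\<close>

definition integral_curve :: "'g \<Rightarrow> (real \<Rightarrow> 'G) \<Rightarrow> bool" where
  "integral_curve X c \<longleftrightarrow>
    (\<forall>f\<in>smooth_funs \<A>. \<forall>t. ((\<lambda>r. f (c r)) has_real_derivative vf X f (c t)) (at t))"

lemma integral_curve_Exp: "integral_curve X (\<lambda>t. Exp (t *\<^sub>R X))"
  using expo by (auto simp: integral_curve_def lie_exponential_def)

lemma Exp_0 [simp]: "Exp 0 = \<one>"
  using expo by (simp add: lie_exponential_def)

lemma integral_curveD: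
  "integral_curve X c \<Longrightarrow> f \<in> smooth_funs \<A> \<Longrightarrow> ((\<lambda>r. f (c r)) has_real_derivative vf X f (c t)) (at t)"
  by (simp add: integral_curve_def)

lemma integral_curve_left_translate: "integral_curve X c \<Longrightarrow> integral_curve X (\<lambda>t. g \<otimes> c t)"
  unfolding integral_curve_def using smooth_funs_left_translate[of _ g] by (fastforce simp: vf_left)

lemma integral_curve_shift: assumes "integral_curve X c" shows "integral_curve X (\<lambda>t. c (a + t))"
  unfolding integral_curve_def
proof (intro ballI allI)
  fix f t assume f: "f \<in> smooth_funs \<A>"
  show "((\<lambda>r. f (c (a + r))) has_real_derivative vf X f (c (a + t))) (at t)"
    using integral_curveD[OF assms f, of "a + t"] DERIV_shift[of "\<lambda>r. f (c r)" _ t a] by (simp add: add.commute)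
qed

lemma integral_curve_reverse: assumes "integral_curve X c" shows "integral_curve (- X) (\<lambda>t. c (- t))"
  unfolding integral_curve_def
proof (intro ballI allI)
  fix f t assume f: "f \<in> smooth_funs \<A>"
  show "((\<lambda>r. f (c (- r))) has_real_derivative vf (- X) f (c (- t))) (at t)"
    using DERIV_chain2[OF integral_curveD[OF assms f] DERIV_minus[OF DERIV_ident]] f by (simp add: vf_minus)
qed

text \<open>Bump functions detect neighbourhoods: along the curve, a bump function at \<open>c t\<close> is continuous in the
  parameter.\<close>

lemma integral_curve_continuous:
  assumes "integral_curve X c" shows "continuous_on UNIV c"
proof (rule continuous_at_imp_continuous_on, rule ballI)
  fix t
  show "isCont c t"
    unfolding continuous_at_open
  proof (intro allI impI)
    fix W assume "open W \<and> c t \<in> W"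
    then obtain f where f: "f \<in> smooth_funs \<A>" "f (c t) = 1" "\<And>x. x \<notin> W \<Longrightarrow> f x = 0"
      using bump_function by metis
    have "continuous_on UNIV (\<lambda>r. f (c r))"
      using integral_curveD[OF assms f(1)] by (intro DERIV_continuous_on) auto
    then have "open ((\<lambda>r. f (c r)) -` {0<..})" by (rule open_vimage[OF open_greaterThan])
    then show "\<exists>S. open S \<and> t \<in> S \<and> (\<forall>x'\<in>S. c x' \<in> W)"
      using f by (intro exI[of _ "(\<lambda>r. f (c r)) -` {0<..}"]) force
  qed
qed

text \<open>In chart coordinates two integral curves solve the same ordinary differential equation with a
  Lipschitz right hand side; the weighted squared distance \<open>exp (- 2 L t) |y\<^sub>1 - y\<^sub>2|\<^sup>2\<close>
  cannot increase.\<close>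

lemma integral_curve_unique_forward:
  assumes c: "integral_curve X c1" "integral_curve X c2" and eq: "c1 0 = c2 0"
  obtains \<delta> where "\<delta> > 0" "\<And>t. 0 \<le> t \<Longrightarrow> t < \<delta> \<Longrightarrow> c1 t = c2 t"
proof -
  obtain U \<phi> N f where U: "(U, \<phi>) \<in> \<A>" "open N" "c1 0 \<in> N" "N \<subseteq> U"
    and f: "\<And>b. f b \<in> smooth_funs \<A>" "\<And>b x. x \<in> N \<Longrightarrow> f b x = \<phi> x \<bullet> b"
    using coordinate_functions[of "c1 0"] by metis
  \<comment> \<open>The coordinate expression of the field; it is continuously differentiable because
    \<open>vf X\<close> preserves smoothness.\<close>
  define F where "F u = (\<Sum>b\<in>Basis. vf X (f b) (inv_into U \<phi> u) *\<^sub>R b)" for u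
  have F: "Ck_on 1 (\<phi> ` U) F"
    unfolding F_def
    by (intro Ck_on_sum Ck_on_scaleR Ck_on_const chart(2)[OF U(1)] smooth_on_imp_Ck_on[OF smooth_funsD[OF _ U(1)]]
        vf_smooth f)
  have "open (\<phi> ` (U \<inter> N))" "\<phi> (c1 0) \<in> \<phi> ` (U \<inter> N)" using U by (auto intro: chart_open_image)
  then obtain R where R: "R > 0" "cball (\<phi> (c1 0)) R \<subseteq> \<phi> ` (U \<inter> N)" by (meson open_contains_cball)
  then have "cball (\<phi> (c1 0)) R \<subseteq> \<phi> ` U" by blast
  from Ck_on_1_lipschitz_on_cball[OF F this] obtain L where L: "L \<ge> 0"
    "\<And>u w. u \<in> cball (\<phi> (c1 0)) R \<Longrightarrow> w \<in> cball (\<phi> (c1 0)) R \<Longrightarrow> norm (F u - F w) \<le> L * norm (u - w)" by metis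
  define N' where "N' = N \<inter> (U \<inter> \<phi> -` ball (\<phi> (c1 0)) R)"
  have N': "open N'" "c1 0 \<in> N'" "N' \<subseteq> N"
    using U R chart(3,1)[OF U(1)] unfolding N'_def by (auto intro!: open_Int[OF U(2)] continuous_open_preimage)
  define y where "y c t = (\<Sum>b\<in>Basis. f b (c t) *\<^sub>R b)" for c and t :: real
  define y' where "y' c t = (\<Sum>b\<in>Basis. vf X (f b) (c t) *\<^sub>R b)" for c and t :: real
  have y: "(y c has_vector_derivative y' c t) (at t)" if "integral_curve X c" for c t
    unfolding y_def y'_def
    by (intro has_vector_derivative_sum has_vector_derivative_scaleR[OF integral_curveD[OF that f(1)], THEN has_vector_derivative_eq_rhs]
      has_vector_derivative_const) auto
  have yphi: "y c t = \<phi> (c t)" if "c t \<in> N" for c t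
    unfolding y_def using f(2)[OF that] by (simp add: euclidean_representation)
  have y'F: "y' c t = F (y c t)" if "c t \<in> N" for c t
    using that U(4) unfolding yphi[of c t, OF that] F_def y'_def by (auto simp: chart(5)[OF U(1)])
  have "\<exists>d>0. \<forall>t. \<bar>t\<bar> < d \<longrightarrow> c t \<in> N'" if "integral_curve X c" "c 0 \<in> N'" for c
  proof -
    have "open (c -` N')" using integral_curve_continuous[OF that(1)] N'(1) by (simp add: open_vimage)
    moreover have "0 \<in> c -` N'" using that by simp
    ultimately obtain d where "d > 0" "ball 0 d \<subseteq> c -` N'" by (meson openE)
    then show ?thesis by (intro exI[of _ d]) (auto simp: dist_real_def)
  qed
  then obtain d1 d2 where d: "d1 > 0" "\<And>t. \<bar>t\<bar> < d1 \<Longrightarrow> c1 t \<in> N'" "d2 > 0" "\<And>t. \<bar>t\<bar> < d2 \<Longrightarrow> c2 t \<in> N'"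
    using c eq N'(2) by metis
  show thesis
  proof (rule that)
    show "min d1 d2 > 0" using d by simp
    fix t assume t: "0 \<le> t" "t < min d1 d2"
    define z where "z = (\<lambda>t. y c1 t - y c2 t)"
    define E where "E = (\<lambda>t. exp (- 2 * L * t) * (z t \<bullet> z t))"
    have "E t \<le> E 0"
    proof (rule DERIV_nonpos_imp_nonincreasing[OF t(1)])
      fix x assume x: "0 \<le> x" "x \<le> t"
      then have "\<bar>x\<bar> < d1" "\<bar>x\<bar> < d2" using t by auto
      then have xN: "c1 x \<in> N'" "c2 x \<in> N'" using d by auto
      then have xN2: "c1 x \<in> N" "c2 x \<in> N" using N' by auto
      have zd: "(z has_vector_derivative (y' c1 x - y' c2 x)) (at x)"
        unfolding z_def by (intro has_vector_derivative_diff y c)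
      have "norm (y' c1 x - y' c2 x) \<le> L * norm (z x)"
        unfolding z_def y'F[of c1 x, OF xN2(1)] y'F[of c2 x, OF xN2(2)]
        by (rule L(2)) (use xN xN2 in \<open>auto simp: yphi N'_def\<close>)
      then have ineq: "z x \<bullet> (y' c1 x - y' c2 x) \<le> L * (z x \<bullet> z x)"
        using norm_cauchy_schwarz[of "z x" "y' c1 x - y' c2 x"]
        by (smt (verit) dot_square_norm mult.left_commute mult_left_mono norm_ge_zero power2_eq_square)
      have "((\<lambda>t. z t \<bullet> z t) has_real_derivative 2 * (z x \<bullet> (y' c1 x - y' c2 x))) (at x)"
        using has_derivative_inner[OF zd[unfolded has_vector_derivative_def] zd[unfolded has_vector_derivative_def]]
        unfolding has_field_derivative_def
        by (rule has_derivative_eq_rhs) (simp add: fun_eq_iff inner_commute algebra_simps)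
      then have "(E has_real_derivative exp (- 2 * L * x) * (2 * (z x \<bullet> (y' c1 x - y' c2 x))) + (- 2 * L * exp (- 2 * L * x)) * (z x \<bullet> z x)) (at x)"
        unfolding E_def by (auto intro!: derivative_eq_intros)
      moreover have "exp (- 2 * L * x) * (2 * (z x \<bullet> (y' c1 x - y' c2 x))) + (- 2 * L * exp (- 2 * L * x)) * (z x \<bullet> z x)
          = 2 * exp (- 2 * L * x) * (z x \<bullet> (y' c1 x - y' c2 x) - L * (z x \<bullet> z x))" by (simp add: algebra_simps)
      moreover have "\<dots> \<le> 0" using ineq by (intro mult_nonneg_nonpos) auto
      ultimately show "\<exists>y. DERIV E x :> y \<and> y \<le> 0" by metis
    qed
    moreover have "E 0 = 0" unfolding E_def z_def y_def using eq by simp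
    ultimately have "z t \<bullet> z t \<le> 0" unfolding E_def by (simp add: mult_le_0_iff)
    then have "z t = 0" using inner_gt_zero_iff[of "z t"] by linarith
    moreover have "c1 t \<in> N'" "c2 t \<in> N'" using d t by auto
    ultimately have "\<phi> (c1 t) = \<phi> (c2 t)" "c1 t \<in> U" "c2 t \<in> U"
      using N'(3) U(4) unfolding z_def by (auto simp: yphi subset_iff)
    then show "c1 t = c2 t" by (metis chart(5)[OF U(1)])
  qed
qed

text \<open>The set on which the two curves agree is closed and, by the local statement applied to shifted and
  reversed curves, open.\<close>

lemma integral_curve_unique:
  assumes c: "integral_curve X c1" "integral_curve X c2" and eq: "c1 0 = c2 0"
  shows "c1 t = c2 t"
proof -
  let ?S = "{t. c1 t = c2 t}"
  have "closed ?S"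
    by (intro closed_Collect_eq integral_curve_continuous[OF c(1)] integral_curve_continuous[OF c(2)])
  moreover have "open ?S"
    unfolding open_dist
  proof
    fix t assume t: "t \<in> ?S"
    have s: "integral_curve X (\<lambda>r. c1 (t + r))" "integral_curve X (\<lambda>r. c2 (t + r))"
      using c integral_curve_shift by auto
    obtain d1 where d1: "d1 > 0" "\<And>r. 0 \<le> r \<Longrightarrow> r < d1 \<Longrightarrow> c1 (t + r) = c2 (t + r)"
      using integral_curve_unique_forward[OF s] t by auto
    obtain d2 where d2: "d2 > 0" "\<And>r. 0 \<le> r \<Longrightarrow> r < d2 \<Longrightarrow> c1 (t - r) = c2 (t - r)"
      using integral_curve_unique_forward[OF s[THEN integral_curve_reverse]] t by auto
    show "\<exists>e>0. \<forall>y. dist y t < e \<longrightarrow> y \<in> ?S"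
    proof (intro exI[of _ "min d1 d2"] conjI allI impI)
      fix y assume "dist y t < min d1 d2"
      then show "y \<in> ?S"
        using d1(2)[of "y - t"] d2(2)[of "t - y"] by (cases "y \<ge> t") (auto simp: dist_real_def)
    qed (use d1 d2 in auto)
  qed
  ultimately have "?S = {} \<or> ?S = UNIV" unfolding clopen[symmetric] ..
  moreover have "0 \<in> ?S" using eq by simp
  ultimately have "t \<in> ?S" by (metis UNIV_I empty_iff)
  then show ?thesis by simp
qed

lemma integral_curve_eq_Exp: "integral_curve X c \<Longrightarrow> c 0 = \<one> \<Longrightarrow> c t = Exp (t *\<^sub>R X)"
  using integral_curve_unique[OF _ integral_curve_Exp, of X c t] by simp

lemma Exp_add: "Exp ((a + b) *\<^sub>R X) = Exp (a *\<^sub>R X) \<otimes> Exp (b *\<^sub>R X)"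
proof -
  have "integral_curve X (\<lambda>t. inv (Exp (a *\<^sub>R X)) \<otimes> Exp ((a + t) *\<^sub>R X))"
    by (intro integral_curve_left_translate integral_curve_shift[of X "\<lambda>t. Exp (t *\<^sub>R X)"] integral_curve_Exp)
  from integral_curve_eq_Exp[OF this, of b]
  have "inv (Exp (a *\<^sub>R X)) \<otimes> Exp ((a + b) *\<^sub>R X) = Exp (b *\<^sub>R X)" by simp
  then show ?thesis by (metis mult_inv_cancel)
qed

lemma inv_Exp: "inv (Exp X) = Exp (- X)"
proof -
  have "Exp (- X) \<otimes> Exp X = \<one>" using Exp_add[of "-1" 1 X] by simp
  then show ?thesis by (rule inv_equality) simp_all
qed

end

section \<open>The adjoint action\<close>

lemma mvt_unordered:
  fixes f :: "real \<Rightarrow> real"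
  assumes "\<And>x. (f has_real_derivative f' x) (at x)"
  obtains z where "\<bar>z - a\<bar> \<le> \<bar>b - a\<bar>" "f b - f a = (b - a) * f' z"
proof -
  consider "a < b" | "a = b" | "b < a" by linarith
  then show thesis
  proof cases
    case 1
    from MVT2[OF 1, of f f'] assms obtain z where "a < z" "z < b" "f b - f a = (b - a) * f' z" by metis
    then show thesis by (intro that[of z]) auto
  next
    case 2
    then show thesis by (intro that[of a]) auto
  next
    case 3
    from MVT2[OF 3, of f f'] assms obtain z where "b < z" "z < a" "f a - f b = (a - b) * f' z" by metis
    then show thesis by (intro that[of z]) (auto simp: algebra_simps)
  qed
qed

lemma continuous_at_pair_real:
  fixes K :: "real \<Rightarrow> real \<Rightarrow> real"
  assumes "continuous_on UNIV (\<lambda>p. K (fst p) (snd p))" "e > 0"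
  obtains d where "d > 0" "\<And>r' t'. \<bar>r' - r\<bar> < d \<Longrightarrow> \<bar>t' - t\<bar> < d \<Longrightarrow> \<bar>K r' t' - K r t\<bar> < e"
proof -
  have "isCont (\<lambda>p. K (fst p) (snd p)) (r, t)"
    using assms(1) by (simp add: continuous_on_eq_continuous_at)
  then obtain d where d: "d > 0" "\<And>p. dist p (r, t) < d \<Longrightarrow> dist (K (fst p) (snd p)) (K r t) < e"
    using assms(2) unfolding continuous_at_eps_delta by force
  show thesis
  proof (rule that[of "d/2"])
    fix r' t' assume "\<bar>r' - r\<bar> < d/2" "\<bar>t' - t\<bar> < d/2"
    then have "dist (r', t') (r, t) < d"
      using sqrt_sum_squares_le_sum_abs[of "r' - r" "t' - t"] by (simp add: dist_Pair_Pair dist_real_def)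
    then show "\<bar>K r' t' - K r t\<bar> < e" using d(2) by (force simp: dist_real_def)
  qed (use d in auto)
qed

text \<open>Interchange of partial derivatives in the asymmetric form in which only one of the two
  mixed derivatives is known to exist: a second difference quotient is a value of that derivative.\<close>

lemma mixed_partial_derivatives:
  fixes F Ft Fr K :: "real \<Rightarrow> real \<Rightarrow> real"
  assumes Ft: "\<And>r t. ((\<lambda>t. F r t) has_real_derivative Ft r t) (at t)"
    and Fr: "\<And>r t. ((\<lambda>r. F r t) has_real_derivative Fr r t) (at r)"
    and K: "\<And>r t. ((\<lambda>r. Ft r t) has_real_derivative K r t) (at r)"
    and cont: "continuous_on UNIV (\<lambda>p. K (fst p) (snd p))"
  shows "((\<lambda>t. Fr r t) has_real_derivative K r t) (at t)"
  unfolding has_field_derivative_iff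
proof (rule LIM_I)
  fix e :: real assume "e > 0"
  then obtain d where d: "d > 0" "\<And>r' t'. \<bar>r' - r\<bar> < d \<Longrightarrow> \<bar>t' - t\<bar> < d \<Longrightarrow> \<bar>K r' t' - K r t\<bar> < e/2"
    using continuous_at_pair_real[OF cont, of "e/2"] by (metis half_gt_zero)
  have "norm ((Fr r y - Fr r t) / (y - t) - K r t) < e" if y: "y \<noteq> t" "norm (y - t) < d" for y
  proof -
    \<comment> \<open>The second difference quotient; its limit for \<open>r'\<close> tending to
      \<open>r\<close> is the difference quotient of \<open>Fr\<close>.\<close>
    let ?q = "\<lambda>r'. ((F r' y - F r y) / (r' - r) - (F r' t - F r t) / (r' - r)) / (y - t)"
    have "(?q \<longlongrightarrow> (Fr r y - Fr r t) / (y - t)) (at r)"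
      using Fr[of y r] Fr[of t r] y(1) unfolding has_field_derivative_iff
      by (intro tendsto_divide tendsto_diff tendsto_const) auto
    then have lim: "((\<lambda>r'. norm (?q r' - K r t)) \<longlongrightarrow> norm ((Fr r y - Fr r t) / (y - t) - K r t)) (at r)"
      by (intro tendsto_norm tendsto_diff tendsto_const)
    have "norm (?q r' - K r t) \<le> e/2" if r': "r' \<noteq> r" "dist r' r < d" for r'
    proof -
      have "((\<lambda>t. F r' t - F r t) has_real_derivative Ft r' t - Ft r t) (at t)" for t
        by (intro DERIV_diff Ft)
      then obtain \<tau> where \<tau>: "\<bar>\<tau> - t\<bar> \<le> \<bar>y - t\<bar>" "(F r' y - F r y) - (F r' t - F r t) = (y - t) * (Ft r' \<tau> - Ft r \<tau>)"
        by (rule mvt_unordered)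
      obtain \<sigma> where \<sigma>: "\<bar>\<sigma> - r\<bar> \<le> \<bar>r' - r\<bar>" "Ft r' \<tau> - Ft r \<tau> = (r' - r) * K \<sigma> \<tau>"
        by (rule mvt_unordered[where f = "\<lambda>r. Ft r \<tau>" and f' = "\<lambda>r. K r \<tau>" and a = r and b = r', OF K])
      have "?q r' = ((F r' y - F r y) - (F r' t - F r t)) / ((y - t) * (r' - r))"
        using r'(1) y(1) by (simp add: diff_divide_distrib mult.commute)
      also have "\<dots> = K \<sigma> \<tau>" unfolding \<tau> \<sigma> using r'(1) y(1) by simp
      finally show ?thesis using d(2)[of \<sigma> \<tau>] \<sigma>(1) \<tau>(1) r'(2) y(2) by (simp add: dist_real_def)
    qed
    then have "\<forall>\<^sub>F r' in at r. norm (?q r' - K r t) \<le> e/2"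
      unfolding eventually_at using d(1) by blast
    from tendsto_upperbound[OF lim this] \<open>e > 0\<close> show ?thesis by simp
  qed
  then show "\<exists>s>0. \<forall>x. x \<noteq> t \<and> norm (x - t) < s \<longrightarrow> norm ((Fr r x - Fr r t) / (x - t) - K r t) < e"
    using d(1) by blast
qed

text \<open>The chain rule on the diagonal, under continuity of only one of the two partial derivatives.\<close>

lemma derivative_along_diagonal:
  fixes K Kt :: "real \<Rightarrow> real \<Rightarrow> real"
  assumes Kt: "\<And>s t. ((\<lambda>t. K s t) has_real_derivative Kt s t) (at t)"
    and cont: "continuous_on UNIV (\<lambda>p. Kt (fst p) (snd p))"
    and Ks: "((\<lambda>s. K s 0) has_real_derivative k) (at 0)"
  shows "((\<lambda>t. K t t) has_real_derivative (Kt 0 0 + k)) (at 0)"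
proof -
  have "((\<lambda>t. K t t - K t 0) has_real_derivative Kt 0 0) (at 0)"
    unfolding has_field_derivative_iff
  proof (rule LIM_I)
    fix e :: real assume "e > 0"
    then obtain d where d: "d > 0" "\<And>r' t'. \<bar>r' - 0\<bar> < d \<Longrightarrow> \<bar>t' - 0\<bar> < d \<Longrightarrow> \<bar>Kt r' t' - Kt 0 0\<bar> < e"
      using continuous_at_pair_real[OF cont, of e] by metis
    have "norm ((K x x - K x 0 - (K 0 0 - K 0 0)) / (x - 0) - Kt 0 0) < e" if x: "x \<noteq> 0" "norm (x - 0) < d" for x
    proof -
      obtain \<tau> where "\<bar>\<tau> - 0\<bar> \<le> \<bar>x - 0\<bar>" "K x x - K x 0 = (x - 0) * Kt x \<tau>"
        using mvt_unordered[OF Kt[of x]] by metis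
      then show ?thesis using d(2)[of x \<tau>] x by simp
    qed
    then show "\<exists>s>0. \<forall>x. x \<noteq> 0 \<and> norm (x - 0) < s \<longrightarrow>
        norm ((K x x - K x 0 - (K 0 0 - K 0 0)) / (x - 0) - Kt 0 0) < e"
      using d(1) by blast
  qed
  from DERIV_add[OF this Ks] show ?thesis by simp
qed

lemma tendsto_of_abs_diff_le:
  fixes a :: real
  assumes "\<And>n. \<bar>a - f n\<bar> \<le> e n" "e \<longlonglongrightarrow> 0"
  shows "f \<longlonglongrightarrow> a"
proof -
  have "(\<lambda>n. a - f n) \<longlonglongrightarrow> 0"
    by (rule Lim_null_comparison[OF _ assms(2)]) (simp add: assms(1))
  from tendsto_diff[OF tendsto_const[of a] this] show ?thesis by simp
qed

lemma tendsto_power_over_fact: "(\<lambda>n. B ^ n / fact n :: real) \<longlonglongrightarrow> 0"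
  using summable_LIMSEQ_zero[OF summable_exp[of B]] by (simp add: divide_inverse mult.commute)

context lie_exp_group
begin

lemma smooth_funs_mult: "f \<in> smooth_funs \<A> \<Longrightarrow> h \<in> smooth_funs \<A> \<Longrightarrow> (\<lambda>x. f x * h x) \<in> smooth_funs \<A>"
  and smooth_funs_add: "f \<in> smooth_funs \<A> \<Longrightarrow> h \<in> smooth_funs \<A> \<Longrightarrow> (\<lambda>x. f x + h x) \<in> smooth_funs \<A>"
  unfolding smooth_funs_iff by (auto intro!: smooth_on_mult smooth_on_add dest!: bspec)

lemma smooth_funs_const: "(\<lambda>x. c) \<in> smooth_funs \<A>"
  unfolding smooth_funs_iff by (auto intro!: smooth_on_const chart(2))

lemma smooth_funs_lincomb:
  "f \<in> smooth_funs \<A> \<Longrightarrow> h \<in> smooth_funs \<A> \<Longrightarrow> (\<lambda>x. a * f x + b * h x) \<in> smooth_funs \<A>"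
  by (intro smooth_funs_add smooth_funs_mult smooth_funs_const)

lemma vf_fun_add: "f \<in> smooth_funs \<A> \<Longrightarrow> h \<in> smooth_funs \<A> \<Longrightarrow>
    vf X (\<lambda>y. f y + h y) x = vf X f x + vf X h x"
  using vf_lincomb[of f h X 1 1 x] by simp

text \<open>The adjoint action of \<open>g\<^sup>-\<^sup>1\<close>. It is obtained by transporting the field \<open>Z\<close> along the right translation
  by \<open>g\<close>: on left-invariant fields this has the effect of conjugation, and it requires no
  differential of the group operation.\<close>

definition Ad_inv :: "'G \<Rightarrow> 'g \<Rightarrow> 'g" where
  "Ad_inv g Z = (SOME W. \<forall>f\<in>smooth_funs \<A>. \<forall>x. vf W f x = vf Z (\<lambda>y. f (y \<otimes> g)) (x \<otimes> inv g))"

lemma vf_Ad_inv: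
  assumes "f \<in> smooth_funs \<A>"
  shows "vf (Ad_inv g Z) f x = vf Z (\<lambda>y. f (y \<otimes> g)) (x \<otimes> inv g)"
proof -
  let ?D = "\<lambda>f x. vf Z (\<lambda>y. f (y \<otimes> g)) (x \<otimes> inv g)"
  have "left_invariant_field G \<A> ?D"
    unfolding left_invariant_field_def
  proof (intro conjI ballI allI)
    fix f assume f: "f \<in> smooth_funs \<A>"
    show "?D f \<in> smooth_funs \<A>"
      by (intro smooth_funs_right_translate vf_smooth f)
    fix a x
    have "vf Z (\<lambda>y. f (a \<otimes> (y \<otimes> g))) (x \<otimes> inv g) = vf Z (\<lambda>y. f ((a \<otimes> y) \<otimes> g)) (x \<otimes> inv g)"
      by (simp add: m_assoc)
    also have "\<dots> = vf Z (\<lambda>y. f (y \<otimes> g)) (a \<otimes> (x \<otimes> inv g))"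
      by (rule vf_left[OF smooth_funs_right_translate[OF f]])
    finally show "?D (\<lambda>y. f (a \<otimes> y)) x = ?D f (a \<otimes> x)" by (simp add: m_assoc)
  next
    fix f h a b x assume fh: "f \<in> smooth_funs \<A>" "h \<in> smooth_funs \<A>"
    show "?D (\<lambda>y. a * f y + b * h y) x = a * ?D f x + b * ?D h x"
      by (intro vf_lincomb smooth_funs_right_translate fh)
  next
    fix f h x assume fh: "f \<in> smooth_funs \<A>" "h \<in> smooth_funs \<A>"
    show "?D (\<lambda>y. f y * h y) x = ?D f x * h x + f x * ?D h x"
      using vf_Leibniz[OF fh[THEN smooth_funs_right_translate], of Z g g "x \<otimes> inv g"] by (simp add: m_assoc)
  qed
  from field_representable[OF this] obtain W where "\<forall>f\<in>smooth_funs \<A>. \<forall>x. vf W f x = ?D f x" ..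
  then have "\<forall>f\<in>smooth_funs \<A>. \<forall>x. vf (Ad_inv g Z) f x = ?D f x"
    unfolding Ad_inv_def by (rule someI)
  then show ?thesis using assms by blast
qed

text \<open>The conjugated curve \<open>t \<mapsto> g\<^sup>-\<^sup>1 Exp (t Z) g\<close> is an integral curve of the transported field.\<close>

lemma conj_Exp: "inv g \<otimes> Exp Z \<otimes> g = Exp (Ad_inv g Z)"
proof -
  have "integral_curve (Ad_inv g Z) (\<lambda>t. inv g \<otimes> Exp (t *\<^sub>R Z) \<otimes> g)"
    unfolding integral_curve_def
  proof (intro ballI allI)
    fix f t assume f: "f \<in> smooth_funs \<A>"
    let ?h = "\<lambda>y. f (y \<otimes> g)"
    have h: "?h \<in> smooth_funs \<A>" by (rule smooth_funs_right_translate[OF f])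
    have "((\<lambda>r. ?h (inv g \<otimes> Exp (r *\<^sub>R Z))) has_real_derivative vf Z ?h (inv g \<otimes> Exp (t *\<^sub>R Z))) (at t)"
      by (rule integral_curveD[OF integral_curve_left_translate[OF integral_curve_Exp] h])
    moreover have "vf (Ad_inv g Z) f (inv g \<otimes> Exp (t *\<^sub>R Z) \<otimes> g) = vf Z ?h (inv g \<otimes> Exp (t *\<^sub>R Z))"
      by (simp add: vf_Ad_inv[OF f] m_assoc)
    ultimately show "((\<lambda>r. f (inv g \<otimes> Exp (r *\<^sub>R Z) \<otimes> g)) has_real_derivative
        vf (Ad_inv g Z) f (inv g \<otimes> Exp (t *\<^sub>R Z) \<otimes> g)) (at t)" by simp
  qed
  from integral_curve_eq_Exp[OF this, of 1] show ?thesis by simp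
qed

lemma linear_Ad_inv: "linear (Ad_inv g)"
proof (rule linearI)
  show "Ad_inv g (X + Y) = Ad_inv g X + Ad_inv g Y" for X Y
    by (rule vf_eqI) (simp add: vf_Ad_inv vf_add smooth_funs_right_translate)
  show "Ad_inv g (a *\<^sub>R X) = a *\<^sub>R Ad_inv g X" for a X
    by (rule vf_eqI) (simp add: vf_Ad_inv vf_scale smooth_funs_right_translate)
qed

lemma Ad_inv_mult: "Ad_inv (g \<otimes> h) Z = Ad_inv h (Ad_inv g Z)"
  by (rule vf_eqI) (simp add: vf_Ad_inv smooth_funs_right_translate m_assoc inv_mult_group)

lemma Ad_inv_one: "Ad_inv \<one> Z = Z"
  by (rule vf_eqI) (simp add: vf_Ad_inv)

text \<open>In charts, \<open>(x, g) \<mapsto> h (x g)\<close> is continuously differentiable, and \<open>vf Z\<close> is a derivative in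
  the first variable whose direction depends continuously on \<open>x\<close>.\<close>

lemma continuous_vf_right_translate:
  assumes h: "h \<in> smooth_funs \<A>"
  shows "continuous_on UNIV (\<lambda>p. vf Z (\<lambda>y. h (y \<otimes> snd p)) (fst p))"
proof (rule continuous_at_imp_continuous_on, rule ballI)
  fix p0 :: "'G \<times> 'G"
  obtain U \<phi> N f where U: "(U, \<phi>) \<in> \<A>" "open N" "fst p0 \<in> N" "N \<subseteq> U"
    and f: "\<And>b. f b \<in> smooth_funs \<A>" "\<And>b x. x \<in> N \<Longrightarrow> f b x = \<phi> x \<bullet> b"
    using coordinate_functions[of "fst p0"] by metis
  obtain V \<psi> where V: "(V, \<psi>) \<in> \<A>" "snd p0 \<in> V" by (rule chart_exists)
  define H where "H = (\<lambda>p. h (inv_into U \<phi> (fst p) \<otimes> inv_into V \<psi> (snd p)))"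
  have H: "Ck_on 1 (\<phi> ` U \<times> \<psi> ` V) H"
    unfolding H_def by (rule smooth_on_imp_Ck_on[OF smooth_mult_in_charts[OF h U(1) V(1)]])
  let ?G = "\<lambda>p. \<Sum>b\<in>Basis. vf Z (f b) (fst p) * frechet_derivative H (at (\<phi> (fst p), \<psi> (snd p))) (b, 0)"
  have "vf Z (\<lambda>y. h (y \<otimes> snd p)) (fst p) = ?G p" if p: "p \<in> N \<times> V" for p
  proof -
    define x g where "x = fst p" and "g = snd p"
    have xg: "x \<in> N" "g \<in> V" using p by (auto simp: x_def g_def)
    define c where "c r = x \<otimes> Exp (r *\<^sub>R Z)" for r
    have c: "integral_curve Z c" unfolding c_def by (intro integral_curve_left_translate integral_curve_Exp)
    have c0: "c 0 = x" by (simp add: c_def)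
    define y where "y r = (\<Sum>b\<in>Basis. f b (c r) *\<^sub>R b)" for r
    let ?y' = "\<Sum>b\<in>Basis. vf Z (f b) x *\<^sub>R b"
    have "((\<lambda>r. f b (c r) *\<^sub>R b) has_derivative (\<lambda>r. r *\<^sub>R (vf Z (f b) x *\<^sub>R b))) (at 0)" for b
      using integral_curveD[OF c f(1), of b 0, unfolded has_field_derivative_def c0]
      by (auto intro!: derivative_eq_intros simp: fun_eq_iff mult.commute)
    then have "(y has_derivative (\<lambda>r. \<Sum>b\<in>Basis. r *\<^sub>R (vf Z (f b) x *\<^sub>R b))) (at 0)"
      unfolding y_def by (intro has_derivative_sum)
    then have y: "(y has_derivative (\<lambda>r. r *\<^sub>R ?y')) (at 0)" by (simp add: scaleR_sum_right)
    have yphi: "y r = \<phi> (c r)" if "c r \<in> N" for r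
      unfolding y_def using f(2)[OF that] by (simp add: euclidean_representation)
    have y0: "y 0 = \<phi> x" using yphi[of 0] c0 xg by simp
    have inset: "(\<phi> x, \<psi> g) \<in> \<phi> ` U \<times> \<psi> ` V" using xg U(4) by auto
    let ?H' = "frechet_derivative H (at (\<phi> x, \<psi> g))"
    have H': "(H has_derivative ?H') (at (\<phi> x, \<psi> g))" using Ck_on_SucD[of 0 _ H, OF _ inset] H by simp
    interpret H': bounded_linear ?H' using H' by (rule has_derivative_bounded_linear)
    have "((\<lambda>r. H (y r, \<psi> g)) has_derivative (\<lambda>r. ?H' (r *\<^sub>R ?y', 0))) (at 0)"
      using diff_chain_at[OF has_derivative_Pair[OF y has_derivative_const[of "\<psi> g"]], of H ?H'] H' y0
      by (simp add: o_def)
    moreover have "?H' (r *\<^sub>R ?y', 0) = r * ?G p" for r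
    proof -
      have "(r *\<^sub>R ?y', 0) = r *\<^sub>R (\<Sum>b\<in>Basis. vf Z (f b) x *\<^sub>R (b, 0 :: 'g))"
        by (simp add: scaleR_prod_def sum_prod)
      then have "?H' (r *\<^sub>R ?y', 0) = r * (\<Sum>b\<in>Basis. vf Z (f b) x * ?H' (b, 0))"
        by (simp only: H'.scaleR H'.sum real_scaleR_def)
      then show ?thesis by (simp only: x_def g_def)
    qed
    ultimately have "((\<lambda>r. H (y r, \<psi> g)) has_derivative (\<lambda>r. r * ?G p)) (at 0)" by simp
    then have D1: "((\<lambda>r. H (y r, \<psi> g)) has_real_derivative ?G p) (at 0)"
      unfolding has_field_derivative_def by (rule has_derivative_eq_rhs) (rule ext, rule mult.commute)
    have "((\<lambda>r. h (c r \<otimes> g)) has_real_derivative ?G p) (at 0)"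
    proof (rule has_field_derivative_transform_within_open[OF D1])
      show "open (c -` N)" using integral_curve_continuous[OF c] U(2) by (simp add: open_vimage)
      show "0 \<in> c -` N" using c0 xg by simp
      fix r assume "r \<in> c -` N"
      then have "c r \<in> N" "c r \<in> U" using U(4) by auto
      then show "H (y r, \<psi> g) = h (c r \<otimes> g)"
        using xg by (simp add: H_def yphi chart(5)[OF U(1)] chart(5)[OF V(1)])
    qed
    moreover have "((\<lambda>r. h (c r \<otimes> g)) has_real_derivative vf Z (\<lambda>y. h (y \<otimes> g)) x) (at 0)"
      using integral_curveD[OF c smooth_funs_right_translate[OF h], of g 0] by (simp add: c0)
    ultimately show ?thesis using DERIV_unique x_def g_def by blast
  qed
  moreover have "continuous_on (N \<times> V) ?G"
  proof (intro continuous_on_sum continuous_on_mult)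
    fix b
    show "continuous_on (N \<times> V) (\<lambda>p. vf Z (f b) (fst p))"
      by (rule continuous_on_compose2[OF smooth_funs_continuous[OF vf_smooth[OF f(1)]]]) (auto intro: continuous_intros)
    have "continuous_on (\<phi> ` U \<times> \<psi> ` V) (\<lambda>q. frechet_derivative H (at q) (b, 0))"
      using H by simp
    then show "continuous_on (N \<times> V) (\<lambda>p. frechet_derivative H (at (\<phi> (fst p), \<psi> (snd p))) (b, 0))"
      by (rule continuous_on_compose2)
        (use U(4) in \<open>auto intro!: continuous_intros continuous_on_compose2[OF chart(3)[OF U(1)]]
          continuous_on_compose2[OF chart(3)[OF V(1)]]\<close>)
  qed
  ultimately have "continuous_on (N \<times> V) (\<lambda>p. vf Z (\<lambda>y. h (y \<otimes> snd p)) (fst p))"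
    by (subst continuous_on_cong[OF refl]) auto
  moreover have "open (N \<times> V)" "p0 \<in> N \<times> V" using U V chart(1)[OF V(1)] by (auto intro: open_Times simp: mem_Times_iff)
  ultimately show "isCont (\<lambda>p. vf Z (\<lambda>y. h (y \<otimes> snd p)) (fst p)) p0"
    using continuous_on_eq_continuous_at by blast
qed

lemma continuous_Exp_line: "continuous_on S f \<Longrightarrow> continuous_on S (\<lambda>x. Exp (f x *\<^sub>R X))"
  by (rule continuous_on_compose2[OF integral_curve_continuous[OF integral_curve_Exp]]) auto

text \<open>Both sides are mixed derivatives of \<open>(r, t) \<mapsto> h (x Exp (r Z) Exp (t Y))\<close>, taken in different orders.\<close>

lemma vf_right_translate_derivative:
  assumes h: "h \<in> smooth_funs \<A>"
  shows "((\<lambda>t. vf Z (\<lambda>y. h (y \<otimes> Exp (t *\<^sub>R Y))) x) has_real_derivative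
    vf Z (\<lambda>y. vf Y h (y \<otimes> Exp (t *\<^sub>R Y))) x) (at t)"
proof -
  let ?x = "\<lambda>r. x \<otimes> Exp (r *\<^sub>R Z)"
  let ?F = "\<lambda>r t. h (?x r \<otimes> Exp (t *\<^sub>R Y))"
  let ?Ft = "\<lambda>r t. vf Y h (?x r \<otimes> Exp (t *\<^sub>R Y))"
  let ?Fr = "\<lambda>r t. vf Z (\<lambda>y. h (y \<otimes> Exp (t *\<^sub>R Y))) (?x r)"
  let ?K = "\<lambda>r t. vf Z (\<lambda>y. vf Y h (y \<otimes> Exp (t *\<^sub>R Y))) (?x r)"
  have "((\<lambda>t. ?Fr 0 t) has_real_derivative ?K 0 t) (at t)"
  proof (rule mixed_partial_derivatives[where F = ?F and Ft = ?Ft and K = ?K and Fr = ?Fr])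
    show "((\<lambda>t. ?F r t) has_real_derivative ?Ft r t) (at t)" for r t
      by (rule integral_curveD[OF integral_curve_left_translate[OF integral_curve_Exp] h])
    show "((\<lambda>r. ?F r t) has_real_derivative ?Fr r t) (at r)" for r t
      by (rule integral_curveD[OF integral_curve_left_translate[OF integral_curve_Exp] smooth_funs_right_translate[OF h]])
    show "((\<lambda>r. ?Ft r t) has_real_derivative ?K r t) (at r)" for r t
      by (rule integral_curveD[OF integral_curve_left_translate[OF integral_curve_Exp]
            smooth_funs_right_translate[OF vf_smooth[OF h]]])
    have "continuous_on UNIV (\<lambda>p. (?x (fst p), Exp (snd p *\<^sub>R Y)))"
      by (intro continuous_on_Pair continuous_on_gmult continuous_Exp_line continuous_intros)
    from continuous_on_compose2[OF continuous_vf_right_translate[OF vf_smooth[OF h]] this]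
    show "continuous_on UNIV (\<lambda>p. ?K (fst p) (snd p))" by simp
  qed
  then show ?thesis by simp
qed

lemma vf_bracket:
  assumes f: "f \<in> smooth_funs \<A>"
  shows "vf (lie_bracket \<A> vf X Y) f x = vf X (vf Y f) x - vf Y (vf X f) x"
proof -
  let ?D = "\<lambda>f x. vf X (vf Y f) x - vf Y (vf X f) x"
  have "left_invariant_field G \<A> ?D"
    unfolding left_invariant_field_def
  proof (intro conjI ballI allI)
    fix f assume f: "f \<in> smooth_funs \<A>"
    show "?D f \<in> smooth_funs \<A>"
      using smooth_funs_lincomb[of "vf X (vf Y f)" "vf Y (vf X f)" 1 "-1"] by (simp add: vf_smooth f)
    fix a x
    show "?D (\<lambda>y. f (a \<otimes> y)) x = ?D f (a \<otimes> x)"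
    proof -
      have "vf W (\<lambda>y. f (a \<otimes> y)) = (\<lambda>y. vf W f (a \<otimes> y))" for W using vf_left[OF f] by auto
      then show ?thesis by (simp add: vf_left[OF vf_smooth[OF f]])
    qed
  next
    fix f h a b x assume fh: "f \<in> smooth_funs \<A>" "h \<in> smooth_funs \<A>"
    have "vf Z (\<lambda>y. a * f y + b * h y) = (\<lambda>y. a * vf Z f y + b * vf Z h y)" for Z
      using vf_lincomb[OF fh] by auto
    then show "?D (\<lambda>y. a * f y + b * h y) x = a * ?D f x + b * ?D h x"
      by (simp add: vf_lincomb vf_smooth fh algebra_simps)
  next
    fix f h x assume fh: "f \<in> smooth_funs \<A>" "h \<in> smooth_funs \<A>"
    have "vf Z (\<lambda>y. f y * h y) = (\<lambda>y. vf Z f y * h y + f y * vf Z h y)" for Z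
      using vf_Leibniz[OF fh] by auto
    then show "?D (\<lambda>y. f y * h y) x = ?D f x * h x + f x * ?D h x"
      by (simp add: vf_fun_add vf_Leibniz vf_smooth smooth_funs_mult fh algebra_simps)
  qed
  from field_representable[OF this] obtain W where W: "\<forall>f\<in>smooth_funs \<A>. \<forall>x. vf W f x = ?D f x" ..
  have "\<forall>f\<in>smooth_funs \<A>. \<forall>x. vf (lie_bracket \<A> vf X Y) f x = ?D f x"
    unfolding lie_bracket_def
    by (rule theI[of "\<lambda>Z. \<forall>f\<in>smooth_funs \<A>. \<forall>x. vf Z f x = ?D f x", OF W]) (use W in \<open>auto intro: vf_eqI\<close>)
  then show ?thesis using f by blast
qed

lemma linear_bracket_right: "linear (lie_bracket \<A> vf X)"
proof (rule linearI)
  have lin: "vf (a *\<^sub>R Y + b *\<^sub>R Z) f = (\<lambda>y. a * vf Y f y + b * vf Z f y)" if "f \<in> smooth_funs \<A>" for a b Y Z f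
    using vf_linear[OF that] by auto
  have *: "lie_bracket \<A> vf X (a *\<^sub>R Y + b *\<^sub>R Z) = a *\<^sub>R lie_bracket \<A> vf X Y + b *\<^sub>R lie_bracket \<A> vf X Z" for a b Y Z
    by (rule vf_eqI) (simp add: vf_bracket vf_linear lin vf_lincomb vf_smooth algebra_simps)
  show "lie_bracket \<A> vf X (Y + Z) = lie_bracket \<A> vf X Y + lie_bracket \<A> vf X Z" for Y Z
    using *[of 1 Y 1 Z] by simp
  show "lie_bracket \<A> vf X (a *\<^sub>R Y) = a *\<^sub>R lie_bracket \<A> vf X Y" for a Y
    using *[of a Y 0 Y] by simp
qed

lemma vf_at_one_inner:
  assumes "f \<in> smooth_funs \<A>"
  shows "vf X f \<one> = X \<bullet> (\<Sum>b\<in>Basis. vf b f \<one> *\<^sub>R b)"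
proof -
  have "linear (\<lambda>X. vf X f \<one>)" by (rule linearI) (simp_all add: vf_add vf_scale assms)
  then interpret L: linear "\<lambda>X. vf X f \<one>" .
  have "vf X f \<one> = vf (\<Sum>b\<in>Basis. (X \<bullet> b) *\<^sub>R b) f \<one>" by (simp add: euclidean_representation)
  also have "\<dots> = (\<Sum>b\<in>Basis. (X \<bullet> b) * vf b f \<one>)" unfolding L.sum L.scaleR by simp
  finally show ?thesis by (simp add: inner_sum_right mult.commute)
qed

text \<open>Smooth functions separate tangent vectors at the identity, so every linear functional on the
  Lie algebra is a differential \<open>X \<mapsto> vf X f \<one>\<close>.\<close>

lemma covector_is_differential:
  obtains f where "f \<in> smooth_funs \<A>" "\<And>X. vf X f \<one> = X \<bullet> v"
proof -
  let ?S = "{v. \<exists>f\<in>smooth_funs \<A>. \<forall>X. vf X f \<one> = X \<bullet> v}"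
  have "subspace ?S"
  proof (rule subspaceI)
    have "vf X (\<lambda>x. 0) \<one> = 0" for X
      using vf_lincomb[OF smooth_funs_const smooth_funs_const, of X 0 0 0 0 \<one>] by simp
    then show "0 \<in> ?S" using smooth_funs_const[of 0] by force
  next
    fix v w assume "v \<in> ?S" "w \<in> ?S"
    then obtain f h where "f \<in> smooth_funs \<A>" "\<And>X. vf X f \<one> = X \<bullet> v"
      "h \<in> smooth_funs \<A>" "\<And>X. vf X h \<one> = X \<bullet> w" by blast
    then show "v + w \<in> ?S"
      by (intro CollectI bexI[of _ "\<lambda>x. f x + h x"]) (auto simp: vf_fun_add smooth_funs_add inner_add_right)
  next
    fix a v assume "v \<in> ?S"
    then obtain f where f: "f \<in> smooth_funs \<A>" "\<And>X. vf X f \<one> = X \<bullet> v" by blast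
    then have "vf X (\<lambda>x. a * f x + 0 * f x) \<one> = X \<bullet> (a *\<^sub>R v)" for X
      by (subst vf_lincomb) auto
    then show "a *\<^sub>R v \<in> ?S"
      using smooth_funs_lincomb[OF f(1) f(1), of a 0] by blast
  qed
  moreover have "\<not> dim ?S < DIM('g)"
  proof
    assume "dim ?S < DIM('g)"
    then obtain x where x: "x \<noteq> 0" "\<And>y. y \<in> span ?S \<Longrightarrow> orthogonal x y"
      using orthogonal_to_subspace_exists by blast
    have "x = 0"
    proof (rule vf_eqI_at_one)
      fix f assume f: "f \<in> smooth_funs \<A>"
      have "(\<Sum>b\<in>Basis. vf b f \<one> *\<^sub>R b) \<in> ?S" using vf_at_one_inner[OF f] f by blast
      then have "orthogonal x (\<Sum>b\<in>Basis. vf b f \<one> *\<^sub>R b)" by (intro x span_base)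
      then have "vf x f \<one> = 0" using vf_at_one_inner[OF f, of x] by (simp add: orthogonal_def)
      moreover have "vf 0 f \<one> = 0" using vf_scale[OF f, of 0 0] by simp
      ultimately show "vf x f \<one> = vf 0 f \<one>" by simp
    qed
    then show False using x by simp
  qed
  moreover have "dim ?S \<le> DIM('g)" by (rule dim_subset_UNIV)
  ultimately have "span ?S = ?S" "dim ?S = DIM('g)" by (simp_all only: span_eq_iff)
  then have "?S = UNIV" by (simp only: dim_eq_full)
  then have "v \<in> ?S" by (metis UNIV_I)
  then obtain f where "f \<in> smooth_funs \<A>" "\<forall>X. vf X f \<one> = X \<bullet> v" unfolding mem_Collect_eq ..
  then show thesis by (intro that[of f]) auto
qed

text \<open>With \<open>f\<close> chosen such that \<open>Z \<mapsto> vf Z f \<one>\<close> is the pairing with \<open>v\<close>, the left-hand side is the derivative at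
  \<open>0\<close> of \<open>vf Z (\<lambda>y. f (y Exp (t Y))) (Exp (-t Y))\<close>. The two occurrences of \<open>t\<close> contribute the two terms
  of the commutator.\<close>

lemma Ad_inv_derivative_at_0:
  "((\<lambda>t. Ad_inv (Exp (t *\<^sub>R Y)) Z \<bullet> v) has_real_derivative (- lie_bracket \<A> vf Y Z) \<bullet> v) (at 0)"
proof -
  obtain f where f: "f \<in> smooth_funs \<A>" "\<And>X. vf X f \<one> = X \<bullet> v"
    by (rule covector_is_differential[of v]) blast
  let ?K = "\<lambda>s t. vf Z (\<lambda>y. f (y \<otimes> Exp (t *\<^sub>R Y))) (Exp (s *\<^sub>R (- Y)))"
  let ?Kt = "\<lambda>s t. vf Z (\<lambda>y. vf Y f (y \<otimes> Exp (t *\<^sub>R Y))) (Exp (s *\<^sub>R (- Y)))"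
  have "((\<lambda>t. ?K t t) has_real_derivative (?Kt 0 0 + vf (- Y) (vf Z f) \<one>)) (at 0)"
  proof (rule derivative_along_diagonal[where K = ?K and Kt = ?Kt])
    show "((\<lambda>t. ?K s t) has_real_derivative ?Kt s t) (at t)" for s t
      by (rule vf_right_translate_derivative[OF f(1)])
    have "continuous_on UNIV (\<lambda>p::real \<times> real. (Exp (fst p *\<^sub>R (- Y)), Exp (snd p *\<^sub>R Y)))"
      by (intro continuous_on_Pair continuous_Exp_line continuous_intros)
    from continuous_on_compose2[OF continuous_vf_right_translate[OF vf_smooth[OF f(1)]] this]
    show "continuous_on UNIV (\<lambda>p. ?Kt (fst p) (snd p))" by simp
    show "((\<lambda>s. ?K s 0) has_real_derivative vf (- Y) (vf Z f) \<one>) (at 0)"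
      using integral_curveD[OF integral_curve_Exp[of "- Y"] vf_smooth[OF f(1), of Z], of 0] by simp
  qed
  moreover have "?K t t = Ad_inv (Exp (t *\<^sub>R Y)) Z \<bullet> v" for t
    by (simp add: f(2)[symmetric] vf_Ad_inv[OF f(1)] inv_Exp)
  moreover have "?Kt 0 0 + vf (- Y) (vf Z f) \<one> = (- lie_bracket \<A> vf Y Z) \<bullet> v"
    using f(2)[of "lie_bracket \<A> vf Y Z"] by (simp add: vf_bracket f(1) vf_minus vf_smooth)
  ultimately show ?thesis by simp
qed

text \<open>The group law \<open>Ad_inv (Exp ((t + h) Y)) = Ad_inv (Exp (t Y)) \<circ> Ad_inv (Exp (h Y))\<close> reduces the claim to \<open>t = 0\<close>;
  the linear map on the left is moved to the other side of the inner product as an adjoint.\<close>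

lemma Ad_inv_derivative:
  "((\<lambda>t. Ad_inv (Exp (t *\<^sub>R Y)) Z \<bullet> v) has_real_derivative Ad_inv (Exp (t *\<^sub>R Y)) (- lie_bracket \<A> vf Y Z) \<bullet> v) (at t)"
proof -
  let ?W = "\<lambda>t. Ad_inv (Exp (t *\<^sub>R Y))"
  interpret L: linear "?W t" by (rule linear_Ad_inv)
  \<comment> \<open>The adjoint of \<open>Ad_inv (Exp (t Y))\<close> applied to \<open>v\<close>.\<close>
  define w where "w = (\<Sum>b\<in>Basis. (?W t b \<bullet> v) *\<^sub>R b)"
  have adj: "?W t u \<bullet> v = u \<bullet> w" for u
  proof -
    have "?W t u \<bullet> v = ?W t (\<Sum>b\<in>Basis. (u \<bullet> b) *\<^sub>R b) \<bullet> v" by (simp add: euclidean_representation)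
    also have "\<dots> = (\<Sum>b\<in>Basis. (u \<bullet> b) * (?W t b \<bullet> v))"
      unfolding L.sum L.scaleR by (simp add: inner_sum_left)
    finally show ?thesis by (simp add: w_def inner_sum_right mult.commute)
  qed
  have "?W (t + h) Z = ?W t (?W h Z)" for h
    unfolding add.commute[of t h] Exp_add Ad_inv_mult ..
  then have "((\<lambda>h. ?W (t + h) Z \<bullet> v) has_real_derivative (- lie_bracket \<A> vf Y Z) \<bullet> w) (at 0)"
    using Ad_inv_derivative_at_0[of Y Z w] by (simp add: adj)
  then show ?thesis
    using DERIV_shift[of "\<lambda>h. ?W h Z \<bullet> v" _ 0 t] by (simp add: adj add.commute)
qed

text \<open>Taylor's formula for \<open>t \<mapsto> Ad_inv (Exp (t Y)) Z\<close>, whose \<open>n\<close>-th derivative is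
  \<open>Ad_inv (Exp (t Y)) ((- ad Y)\<^sup>n Z)\<close>; the remainder vanishes because the operators
  \<open>Ad_inv (Exp (t Y))\<close> are bounded for \<open>t\<close> in a compact interval.\<close>

lemma Ad_inv_Exp: "Ad_inv (Exp Y) Z = op_exp (\<lambda>W. - lie_bracket \<A> vf Y W) Z"
proof -
  let ?T = "\<lambda>W. - lie_bracket \<A> vf Y W"
  let ?W = "\<lambda>t. Ad_inv (Exp (t *\<^sub>R Y))"
  have "linear ?T" by (intro linear_compose_neg linear_bracket_right)
  then obtain B where B: "B > 0" "\<And>x. norm (?T x) \<le> B * norm x"
    using linear_bounded_pos by blast
  have TB: "norm ((?T ^^ n) Z) \<le> B ^ n * norm Z" for n
  proof (induction n)
    case (Suc n)
    have "norm ((?T ^^ Suc n) Z) \<le> B * norm ((?T ^^ n) Z)" using B(2)[of "(?T ^^ n) Z"] by simp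
    also have "\<dots> \<le> B * (B ^ n * norm Z)" using Suc B(1) by (intro mult_left_mono) auto
    finally show ?case by simp
  qed simp
  have "((\<lambda>n. (\<Sum>m<n. (1 / fact m) *\<^sub>R (?T ^^ m) Z)) \<longlongrightarrow> ?W 1 Z) sequentially"
    unfolding tendsto_componentwise_iff[where f = "\<lambda>n. \<Sum>m<n. (1 / fact m) *\<^sub>R (?T ^^ m) Z"]
  proof
    fix v :: 'g assume "v \<in> Basis"
    let ?g = "\<lambda>n t. ?W t ((?T ^^ n) Z) \<bullet> v"
    have "\<exists>C. \<forall>t. \<bar>t\<bar> \<le> 1 \<longrightarrow> \<bar>?W t b \<bullet> v\<bar> \<le> C" for b
    proof -
      have "continuous_on {-1..1} (\<lambda>t. ?W t b \<bullet> v)"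
        by (rule DERIV_continuous_on, rule has_field_derivative_at_within[OF Ad_inv_derivative])
      then have "bounded ((\<lambda>t. ?W t b \<bullet> v) ` {-1..1})"
        by (intro compact_imp_bounded compact_continuous_image compact_Icc)
      then obtain C where "\<forall>x\<in>(\<lambda>t. ?W t b \<bullet> v) ` {-1..1}. norm x \<le> C" unfolding bounded_iff by blast
      then show ?thesis by (intro exI[of _ C]) (auto simp: abs_le_iff)
    qed
    then obtain C where C: "\<And>b t. \<bar>t\<bar> \<le> 1 \<Longrightarrow> \<bar>?W t b \<bullet> v\<bar> \<le> C b" by metis
    let ?C = "\<Sum>b\<in>Basis. C b"
    have bound: "\<bar>?W t u \<bullet> v\<bar> \<le> norm u * ?C" if t: "\<bar>t\<bar> \<le> 1" for t u
    proof -
      interpret L: linear "?W t" by (rule linear_Ad_inv)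
      have "?W t u \<bullet> v = ?W t (\<Sum>b\<in>Basis. (u \<bullet> b) *\<^sub>R b) \<bullet> v" by (simp add: euclidean_representation)
      also have "\<dots> = (\<Sum>b\<in>Basis. (u \<bullet> b) * (?W t b \<bullet> v))"
        unfolding L.sum L.scaleR by (simp add: inner_sum_left)
      also have "\<bar>\<dots>\<bar> \<le> (\<Sum>b\<in>Basis. norm u * C b)"
      proof (rule order_trans[OF sum_abs sum_mono])
        fix b :: 'g assume "b \<in> Basis"
        then show "\<bar>u \<bullet> b * (?W t b \<bullet> v)\<bar> \<le> norm u * C b"
          unfolding abs_mult by (intro mult_mono C t Basis_le_norm) auto
      qed
      finally show ?thesis by (simp add: sum_distrib_left)
    qed
    have "\<bar>?W 1 Z \<bullet> v - (\<Sum>m<n. (1 / fact m) *\<^sub>R (?T ^^ m) Z) \<bullet> v\<bar> \<le> (norm Z * ?C) * (B ^ n / fact n)" for n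
    proof -
      have "\<forall>m x. (?g m has_real_derivative ?g (Suc m) x) (at x)"
        using Ad_inv_derivative by auto
      from Maclaurin_all_le[OF refl this, of 1 n] obtain t where t: "\<bar>t\<bar> \<le> 1"
        "?W 1 Z \<bullet> v = (\<Sum>m<n. ?g m 0 / fact m) + ?g n t / fact n" by auto
      have "\<bar>?g n t\<bar> \<le> norm ((?T ^^ n) Z) * ?C" by (rule bound[OF t(1)])
      also have "\<dots> \<le> (B ^ n * norm Z) * ?C"
        using bound[of 0 v] C[of 0] by (intro mult_right_mono TB sum_nonneg) (auto intro: order_trans[OF abs_ge_zero])
      finally have "\<bar>?g n t / fact n\<bar> \<le> (norm Z * ?C) * (B ^ n / fact n)"
        by (simp add: divide_right_mono mult_ac)
      moreover have "(\<Sum>m<n. (1 / fact m) *\<^sub>R (?T ^^ m) Z) \<bullet> v = (\<Sum>m<n. ?g m 0 / fact m)"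
        by (simp add: inner_sum_left Ad_inv_one)
      ultimately show ?thesis unfolding t(2) by simp
    qed
    moreover have "(\<lambda>n. (norm Z * ?C) * (B ^ n / fact n)) \<longlonglongrightarrow> 0"
      by (rule tendsto_mult_right_zero[OF tendsto_power_over_fact])
    ultimately show "((\<lambda>n. (\<Sum>m<n. (1 / fact m) *\<^sub>R (?T ^^ m) Z) \<bullet> v) \<longlongrightarrow> ?W 1 Z \<bullet> v) sequentially"
      by (rule tendsto_of_abs_diff_le)
  qed
  then have "(\<lambda>m. (1 / fact m) *\<^sub>R (?T ^^ m) Z) sums ?W 1 Z" unfolding sums_def .
  from sums_unique[OF this] show ?thesis by (simp add: op_exp_def)
qed

text \<open>The operator reverses the order of the factors because \<open>Ad_inv\<close> is an anti-homomorphism.\<close>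

lemma ad_exp_prod_eq_Ad_inv: "ad_exp_prod (lie_bracket \<A> vf) A a = Ad_inv (malcev_coord G Exp A a)"
proof -
  have op: "op_exp (\<lambda>Y. - lie_bracket \<A> vf ((a $ k) *\<^sub>R A k) Y) = Ad_inv (Exp ((a $ k) *\<^sub>R A k))" for k
    by (rule ext) (simp add: Ad_inv_Exp)
  have "fold (\<lambda>k T. Ad_inv (Exp ((a $ k) *\<^sub>R A k)) \<circ> T) ks T0 =
      Ad_inv (foldr (\<lambda>k g. Exp ((a $ k) *\<^sub>R A k) \<otimes> g) ks \<one>) \<circ> T0" for ks T0
  proof (induction ks arbitrary: T0)
    case Nil
    then show ?case by (simp add: fun_eq_iff Ad_inv_one)
  next
    case (Cons k ks)
    show ?case unfolding fold_simps Cons.IH by (simp add: fun_eq_iff Ad_inv_mult)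
  qed
  from this[of "sorted_list_of_set UNIV" id] show ?thesis
    unfolding ad_exp_prod_def malcev_coord_def op by (simp only: o_id)
qed

lemma continuous_malcev_coord: "continuous_on UNIV (malcev_coord G Exp A)"
proof -
  have "continuous_on UNIV (\<lambda>a. foldr (\<lambda>k g. Exp ((a $ k) *\<^sub>R A k) \<otimes> g) ks \<one>)" for ks
    by (induction ks) (auto intro!: continuous_on_gmult continuous_Exp_line continuous_intros)
  then show ?thesis unfolding malcev_coord_def .
qed

end

section \<open>Polynomial approximation in the mean square\<close>

lemma cmod_add_squared_le: "(cmod (a + b))\<^sup>2 \<le> 2 * (cmod a)\<^sup>2 + 2 * (cmod b)\<^sup>2"
proof -
  have "(cmod (a + b))\<^sup>2 \<le> (cmod a + cmod b)\<^sup>2" by (intro power_mono norm_triangle_ineq) auto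
  also have "\<dots> \<le> 2 * (cmod a)\<^sup>2 + 2 * (cmod b)\<^sup>2"
    using sum_squares_ge_zero[of "cmod a - cmod b" 0] by (simp add: power2_eq_square algebra_simps)
  finally show ?thesis .
qed

lemma L2_normsq_cong: "(\<And>x. x \<in> space M \<Longrightarrow> f x = g x) \<Longrightarrow> L2_normsq M f = L2_normsq M g"
  unfolding L2_normsq_def by (intro nn_integral_cong) simp

lemma L2_normsq_add_le:
  assumes [measurable]: "f \<in> borel_measurable M" "g \<in> borel_measurable M"
  shows "L2_normsq M (\<lambda>x. f x + g x) \<le> 2 * L2_normsq M f + 2 * L2_normsq M g"
proof -
  have "L2_normsq M (\<lambda>x. f x + g x) \<le> (\<integral>\<^sup>+x. 2 * ennreal ((cmod (f x))\<^sup>2) + 2 * ennreal ((cmod (g x))\<^sup>2) \<partial>M)"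
    unfolding L2_normsq_def
  proof (rule nn_integral_mono)
    fix x
    have "ennreal ((cmod (f x + g x))\<^sup>2) \<le> ennreal (2 * (cmod (f x))\<^sup>2 + 2 * (cmod (g x))\<^sup>2)"
      by (intro ennreal_leI cmod_add_squared_le)
    then show "ennreal ((cmod (f x + g x))\<^sup>2) \<le> 2 * ennreal ((cmod (f x))\<^sup>2) + 2 * ennreal ((cmod (g x))\<^sup>2)"
      by (simp add: ennreal_mult ennreal_plus)
  qed
  also have "\<dots> = 2 * L2_normsq M f + 2 * L2_normsq M g"
    unfolding L2_normsq_def by (simp add: nn_integral_add nn_integral_cmult)
  finally show ?thesis .
qed

lemma L2_normsq_cmult:
  assumes [measurable]: "f \<in> borel_measurable M"
  shows "L2_normsq M (\<lambda>x. a * f x) = ennreal ((cmod a)\<^sup>2) * L2_normsq M f"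
  unfolding L2_normsq_def by (simp add: norm_mult power_mult_distrib ennreal_mult nn_integral_cmult)

definition L2_approximable :: "'a measure \<Rightarrow> ('a \<Rightarrow> complex) set \<Rightarrow> ('a \<Rightarrow> complex) \<Rightarrow> bool" where
  "L2_approximable M V f \<longleftrightarrow> (\<forall>e>0. \<exists>p\<in>V. L2_normsq M (\<lambda>x. f x - p x) \<le> ennreal e)"

lemma L2_approximable_cong:
  assumes "\<And>x. x \<in> space M \<Longrightarrow> f x = g x"
  shows "L2_approximable M V f \<longleftrightarrow> L2_approximable M V g"
  unfolding L2_approximable_def using assms by (simp cong: L2_normsq_cong)

lemma two_add_le_ennreal:
  assumes "a \<le> ennreal (e / 4)" "b \<le> ennreal (e / 4)" "e > 0"
  shows "2 * a + 2 * b \<le> ennreal e"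
proof -
  have "2 * a + 2 * b \<le> 2 * ennreal (e / 4) + 2 * ennreal (e / 4)"
    by (intro add_mono mult_left_mono assms) auto
  also have "2 * ennreal (e / 4) = ennreal (e / 2)"
    using ennreal_mult[of 2 "e / 4"] assms(3) by simp
  also have "ennreal (e / 2) + ennreal (e / 2) = ennreal e"
    using assms(3) by (subst ennreal_plus[symmetric]) auto
  finally show ?thesis .
qed

lemma L2_approximable_limit:
  assumes V: "V \<subseteq> borel_measurable M" and f: "f \<in> borel_measurable M"
    and g: "\<And>e::real. e > 0 \<Longrightarrow> \<exists>g\<in>borel_measurable M. L2_approximable M V g \<and> L2_normsq M (\<lambda>x. f x - g x) \<le> ennreal e"
  shows "L2_approximable M V f"
  unfolding L2_approximable_def
proof (intro allI impI)
  fix e :: real assume e: "e > 0"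
  obtain g where g: "g \<in> borel_measurable M" "L2_approximable M V g" "L2_normsq M (\<lambda>x. f x - g x) \<le> ennreal (e/4)"
    using assms(3)[of "e/4"] e by auto
  obtain p where p: "p \<in> V" "L2_normsq M (\<lambda>x. g x - p x) \<le> ennreal (e/4)"
    using g(2) e unfolding L2_approximable_def by (meson divide_pos_pos zero_less_numeral)
  have [measurable]: "f \<in> borel_measurable M" "g \<in> borel_measurable M" "p \<in> borel_measurable M"
    using V f g(1) p(1) by auto
  have "L2_normsq M (\<lambda>x. f x - p x) = L2_normsq M (\<lambda>x. (f x - g x) + (g x - p x))" by simp
  also have "\<dots> \<le> 2 * L2_normsq M (\<lambda>x. f x - g x) + 2 * L2_normsq M (\<lambda>x. g x - p x)"
    by (rule L2_normsq_add_le) measurable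
  also have "\<dots> \<le> ennreal e" by (rule two_add_le_ennreal[OF g(3) p(2) e])
  finally show "\<exists>p\<in>V. L2_normsq M (\<lambda>x. f x - p x) \<le> ennreal e" using p(1) by blast
qed

lemma L2_approximable_add:
  assumes V: "V \<subseteq> borel_measurable M" "\<And>p q. p \<in> V \<Longrightarrow> q \<in> V \<Longrightarrow> (\<lambda>x. p x + q x) \<in> V"
    and [measurable]: "f \<in> borel_measurable M" "g \<in> borel_measurable M"
    and fg: "L2_approximable M V f" "L2_approximable M V g"
  shows "L2_approximable M V (\<lambda>x. f x + g x)"
  unfolding L2_approximable_def
proof (intro allI impI)
  fix e :: real assume e: "e > 0"
  then have e4: "e/4 > 0" by simp
  obtain p where p: "p \<in> V" "L2_normsq M (\<lambda>x. f x - p x) \<le> ennreal (e/4)"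
    using fg(1) e4 unfolding L2_approximable_def by meson
  obtain q where q: "q \<in> V" "L2_normsq M (\<lambda>x. g x - q x) \<le> ennreal (e/4)"
    using fg(2) e4 unfolding L2_approximable_def by meson
  have [measurable]: "p \<in> borel_measurable M" "q \<in> borel_measurable M"
    using V(1) q(1) p(1) by auto
  have "L2_normsq M (\<lambda>x. f x + g x - (p x + q x)) = L2_normsq M (\<lambda>x. (f x - p x) + (g x - q x))"
    by (simp add: algebra_simps)
  also have "\<dots> \<le> 2 * L2_normsq M (\<lambda>x. f x - p x) + 2 * L2_normsq M (\<lambda>x. g x - q x)"
    by (rule L2_normsq_add_le) measurable
  also have "\<dots> \<le> ennreal e" by (rule two_add_le_ennreal[OF p(2) q(2) e])
  finally show "\<exists>p\<in>V. L2_normsq M (\<lambda>x. f x + g x - p x) \<le> ennreal e"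
    by (rule bexI[OF _ V(2)[OF p(1) q(1)]])
qed

lemma L2_approximable_cmult:
  assumes V: "V \<subseteq> borel_measurable M" "\<And>p a. p \<in> V \<Longrightarrow> (\<lambda>x. a * p x) \<in> V"
    and f[measurable]: "f \<in> borel_measurable M" "L2_approximable M V f"
  shows "L2_approximable M V (\<lambda>x. a * f x)"
  unfolding L2_approximable_def
proof (intro allI impI)
  fix e :: real assume e: "e > 0"
  define d where "d = e / ((cmod a)\<^sup>2 + 1)"
  have d: "d > 0" unfolding d_def using e by (intro divide_pos_pos add_nonneg_pos) auto
  obtain p where p: "p \<in> V" "L2_normsq M (\<lambda>x. f x - p x) \<le> ennreal d"
    using f(2) d unfolding L2_approximable_def by meson
  have [measurable]: "p \<in> borel_measurable M" using V(1) p(1) by auto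
  have "L2_normsq M (\<lambda>x. a * f x - a * p x) = L2_normsq M (\<lambda>x. a * (f x - p x))" by (simp add: algebra_simps)
  also have "\<dots> = ennreal ((cmod a)\<^sup>2) * L2_normsq M (\<lambda>x. f x - p x)" by (rule L2_normsq_cmult) measurable
  also have "\<dots> \<le> ennreal ((cmod a)\<^sup>2) * ennreal d" by (intro mult_left_mono p) auto
  also have "\<dots> = ennreal ((cmod a)\<^sup>2 * d)" using d by (simp add: ennreal_mult)
  also have "\<dots> \<le> ennreal e"
  proof (rule ennreal_leI)
    have "(cmod a)\<^sup>2 * d \<le> ((cmod a)\<^sup>2 + 1) * d" using d by (intro mult_right_mono) auto
    also have "\<dots> = e" unfolding d_def by (simp add: add_nonneg_eq_0_iff)
    finally show "(cmod a)\<^sup>2 * d \<le> e" .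
  qed
  finally show "\<exists>p\<in>V. L2_normsq M (\<lambda>x. a * f x - p x) \<le> ennreal e" by (rule bexI[OF _ V(2)[OF p(1)]])
qed

text \<open>Indicators generate the simple functions, and a sequence of simple functions dominated by \<open>2 |f|\<close>
  converges to \<open>f\<close> in the mean square.\<close>

lemma L2_approximable_if_indicators:
  assumes V: "V \<subseteq> borel_measurable M" "\<And>p q. p \<in> V \<Longrightarrow> q \<in> V \<Longrightarrow> (\<lambda>x. p x + q x) \<in> V"
      "\<And>p a. p \<in> V \<Longrightarrow> (\<lambda>x. a * p x) \<in> V"
    and ind: "\<And>B. B \<in> sets M \<Longrightarrow> L2_approximable M V (\<lambda>x. indicator B x)"
    and f: "f \<in> L2_space M"
  shows "L2_approximable M V f"
proof -
  have fm[measurable]: "f \<in> borel_measurable M" and fin: "L2_normsq M f < \<infinity>"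
    using f by (auto simp: L2_space_def)
  have sum: "L2_approximable M V (\<lambda>x. \<Sum>y\<in>Y. y * indicator (B y) x)"
    if "finite Y" "\<And>y. y \<in> Y \<Longrightarrow> B y \<in> sets M" for Y and B :: "complex \<Rightarrow> 'a set"
    using that
  proof (induction Y)
    case empty
    have "L2_approximable M V (\<lambda>x. indicator {} x)" by (rule ind) simp
    then show ?case by simp
  next
    case (insert y Y)
    have "L2_approximable M V (\<lambda>x. y * indicator (B y) x + (\<Sum>y\<in>Y. y * indicator (B y) x))"
    proof (rule L2_approximable_add[OF V(1,2)])
      show "L2_approximable M V (\<lambda>x. y * indicator (B y) x)"
        by (rule L2_approximable_cmult[OF V(1,3) _ ind]) (use insert.prems in auto)
      show "L2_approximable M V (\<lambda>x. \<Sum>y\<in>Y. y * indicator (B y) x)" using insert by simp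
      show "(\<lambda>x. y * indicator (B y) x) \<in> borel_measurable M"
        by (intro borel_measurable_times borel_measurable_const borel_measurable_indicator) (use insert.prems in simp)
      show "(\<lambda>x. \<Sum>y\<in>Y. y * indicator (B y) x) \<in> borel_measurable M"
        by (intro borel_measurable_sum borel_measurable_times borel_measurable_const borel_measurable_indicator)
          (use insert.prems in simp)
    qed auto
    then show ?case unfolding sum.insert[OF insert.hyps(1,2)] .
  qed
  have simple: "L2_approximable M V s" if s: "simple_function M s" for s
  proof -
    have app: "L2_approximable M V (\<lambda>x. \<Sum>y\<in>s ` space M. y * indicator (s -` {y} \<inter> space M) x)"
      using s by (intro sum) (auto simp: simple_function_def)
    have eq: "s x = (\<Sum>y\<in>s ` space M. y * indicator (s -` {y} \<inter> space M) x)" if "x \<in> space M" for x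
    proof -
      have "s x = (\<Sum>y\<in>s ` space M. indicator (s -` {y} \<inter> space M) x *\<^sub>R y)"
        by (rule simple_function_indicator_representation_banach[OF s that])
      also have "\<dots> = (\<Sum>y\<in>s ` space M. y * indicator (s -` {y} \<inter> space M) x)"
        by (intro sum.cong) (auto simp: indicator_def)
      finally show ?thesis .
    qed
    show ?thesis using app by (subst L2_approximable_cong[OF eq])
  qed
  obtain F where "\<forall>i. simple_function M (F i)" "\<forall>x\<in>space M. (\<lambda>i. F i x) \<longlonglongrightarrow> f x"
    "\<forall>i. \<forall>x\<in>space M. dist (F i x) 0 \<le> 2 * dist (f x) 0"
    using borel_measurable_implies_sequence_metric[OF fm, of 0] by auto
  then have F: "\<And>i. simple_function M (F i)" "\<And>x. x \<in> space M \<Longrightarrow> (\<lambda>i. F i x) \<longlonglongrightarrow> f x"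
    "\<And>i x. x \<in> space M \<Longrightarrow> norm (F i x) \<le> 2 * norm (f x)"
    by (auto simp: dist_norm)
  have Fm[measurable]: "F i \<in> borel_measurable M" for i using F(1) by (rule borel_measurable_simple_function)
  have "(\<lambda>i. \<integral>\<^sup>+x. ennreal ((cmod (f x - F i x))\<^sup>2) \<partial>M) \<longlonglongrightarrow> (\<integral>\<^sup>+x. 0 \<partial>M)"
  proof (rule nn_integral_dominated_convergence[where w = "\<lambda>x. 10 * ennreal ((cmod (f x))\<^sup>2)"])
    show "AE x in M. ennreal ((cmod (f x - F i x))\<^sup>2) \<le> 10 * ennreal ((cmod (f x))\<^sup>2)" for i
    proof (rule AE_I2)
      fix x assume x: "x \<in> space M"
      have "(cmod (F i x))\<^sup>2 \<le> (2 * cmod (f x))\<^sup>2" using F(3)[OF x] by (intro power_mono) auto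
      then have "(cmod (f x + - F i x))\<^sup>2 \<le> 10 * (cmod (f x))\<^sup>2"
        using cmod_add_squared_le[of "f x" "- F i x"] by simp
      then have "ennreal ((cmod (f x - F i x))\<^sup>2) \<le> ennreal (10 * (cmod (f x))\<^sup>2)"
        by (intro ennreal_leI) simp
      then show "ennreal ((cmod (f x - F i x))\<^sup>2) \<le> 10 * ennreal ((cmod (f x))\<^sup>2)"
        by (simp add: ennreal_mult)
    qed
    show "(\<integral>\<^sup>+x. 10 * ennreal ((cmod (f x))\<^sup>2) \<partial>M) < \<infinity>"
      using fin by (simp add: nn_integral_cmult L2_normsq_def ennreal_mult_less_top)
    show "AE x in M. (\<lambda>i. ennreal ((cmod (f x - F i x))\<^sup>2)) \<longlonglongrightarrow> 0"
    proof (rule AE_I2)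
      fix x assume x: "x \<in> space M"
      have "(\<lambda>i. (cmod (f x - F i x))\<^sup>2) \<longlonglongrightarrow> (cmod (f x - f x))\<^sup>2"
        by (intro tendsto_intros F(2) x)
      then have "(\<lambda>i. ennreal ((cmod (f x - F i x))\<^sup>2)) \<longlonglongrightarrow> ennreal ((cmod (f x - f x))\<^sup>2)"
        by (rule tendsto_ennrealI)
      then show "(\<lambda>i. ennreal ((cmod (f x - F i x))\<^sup>2)) \<longlonglongrightarrow> 0" by simp
    qed
  qed measurable
  then have lim: "(\<lambda>i. L2_normsq M (\<lambda>x. f x - F i x)) \<longlonglongrightarrow> 0" by (simp add: L2_normsq_def)
  show ?thesis
  proof (rule L2_approximable_limit[OF V(1) fm])
    fix e :: real assume "e > 0"
    then have "\<forall>\<^sub>F i in sequentially. L2_normsq M (\<lambda>x. f x - F i x) < ennreal e"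
      using lim by (intro order_tendstoD(2)) auto
    then obtain i where "L2_normsq M (\<lambda>x. f x - F i x) < ennreal e"
      using eventually_sequentially by auto
    then show "\<exists>g\<in>borel_measurable M. L2_approximable M V g \<and> L2_normsq M (\<lambda>x. f x - g x) \<le> ennreal e"
      using simple[OF F(1)] Fm by (intro bexI[of _ "F i"]) auto
  qed
qed

text \<open>Regularity sandwiches a Borel set between a compact and an open set, Urysohn's lemma
  interpolates between them continuously, and the Stone--Weierstrass theorem replaces the
  continuous function by a polynomial on the compact support of the measure.\<close>

lemma indicator_polynomial_approx:
  fixes \<nu> :: "'a::euclidean_space measure"
  assumes \<nu>: "sets \<nu> = sets borel" "finite_measure \<nu>" and K: "compact K" "AE x in \<nu>. x \<in> K"
    and B: "B \<in> sets borel" and e: "e > 0"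
  obtains p where "real_polynomial_function p"
    "(\<integral>\<^sup>+x. ennreal ((indicator B x - p x)\<^sup>2) \<partial>\<nu>) \<le> ennreal e"
proof -
  interpret finite_measure \<nu> by fact
  have sp: "space \<nu> = UNIV" using sets_eq_imp_space_eq[OF \<nu>(1)] by simp
  have fin: "emeasure \<nu> X \<noteq> \<infinity>" for X using emeasure_finite by simp
  \<comment> \<open>The error is at most
    \<open>2 \<nu> (U - C) + 2 \<delta>\<^sup>2 \<nu> UNIV \<le> 4 d + 2 d\<close>, whence the choice of
    \<open>d\<close> and \<open>\<delta>\<close>.\<close>
  define d where "d = e / 8"
  have d: "d > 0" using e by (simp add: d_def)
  have "\<exists>C\<in>{C. C \<subseteq> B \<and> compact C}. emeasure \<nu> B < emeasure \<nu> C + ennreal d"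
    using d fin by (intro SUP_approx_ennreal[OF _ _ inner_regular[OF \<nu>(1) fin B]]) auto
  then obtain C where C: "C \<subseteq> B" "compact C" "emeasure \<nu> B < emeasure \<nu> C + ennreal d" by blast
  have "\<exists>U\<in>{U. B \<subseteq> U \<and> open U}. emeasure \<nu> U < emeasure \<nu> B + ennreal d"
    using d fin by (intro INF_approx_ennreal[OF _ outer_regular[OF \<nu>(1) fin B]]) auto
  then obtain U where U: "B \<subseteq> U" "open U" "emeasure \<nu> U < emeasure \<nu> B + ennreal d" by blast
  have sets: "C \<in> sets \<nu>" "U \<in> sets \<nu>" using C U \<nu>(1) by (auto simp: borel_compact)
  have "emeasure \<nu> C + emeasure \<nu> (U - C) = emeasure \<nu> U"
    using C U sets by (subst plus_emeasure) (auto intro!: arg_cong[of _ _ "emeasure \<nu>"])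
  also have "\<dots> \<le> emeasure \<nu> C + ennreal d + ennreal d"
    using U(3) C(3) by (meson add_right_mono less_imp_le order_trans)
  finally have UC: "emeasure \<nu> (U - C) \<le> ennreal (2 * d)"
    using fin[of C] d by (simp add: add.assoc ennreal_plus[symmetric] del: ennreal_plus)
  have "closed C" "closed (- U)" "C \<inter> - U = {}" using C U by (auto simp: compact_imp_closed)
  then obtain g where g: "continuous_on UNIV g" "\<And>x. g x \<in> closed_segment 1 (0::real)"
     "\<And>x. x \<in> C \<Longrightarrow> g x = 1" "\<And>x. x \<in> - U \<Longrightarrow> g x = 0"
    using Urysohn[of C "- U" "1::real" 0] by metis
  have g01: "0 \<le> g x" "g x \<le> 1" for x using g(2)[of x] by (auto simp: closed_segment_eq_real_ivl)
  define T where "T = measure \<nu> (space \<nu>)"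
  define \<delta> where "\<delta> = sqrt (d / (T + 1))"
  have T: "T \<ge> 0" by (simp add: T_def)
  have \<delta>: "\<delta> > 0" "\<delta>\<^sup>2 * T \<le> d"
  proof -
    show "\<delta> > 0" using d T by (simp add: \<delta>_def)
    have "\<delta>\<^sup>2 = d / (T + 1)" using d T by (simp add: \<delta>_def)
    then have "\<delta>\<^sup>2 * T + \<delta>\<^sup>2 = d" using T by (simp add: field_simps)
    then show "\<delta>\<^sup>2 * T \<le> d" using zero_le_power2[of \<delta>] by linarith
  qed
  obtain p where p: "real_polynomial_function p" "\<And>x. x \<in> K \<Longrightarrow> \<bar>g x - p x\<bar> < \<delta>"
    using Stone_Weierstrass_real_polynomial_function[OF K(1) continuous_on_subset[OF g(1)] \<delta>(1)] by auto
  have [measurable]: "C \<in> sets \<nu>" "U \<in> sets \<nu>" by fact+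
  have "(\<integral>\<^sup>+x. ennreal ((indicator B x - p x)\<^sup>2) \<partial>\<nu>) \<le> (\<integral>\<^sup>+x. 2 * indicator (U - C) x + ennreal (2 * \<delta>\<^sup>2) \<partial>\<nu>)"
  proof (rule nn_integral_mono_AE)
    show "AE x in \<nu>. ennreal ((indicator B x - p x)\<^sup>2) \<le> 2 * indicator (U - C) x + ennreal (2 * \<delta>\<^sup>2)"
      using K(2)
    proof eventually_elim
      case (elim x)
      have gp: "(g x - p x)\<^sup>2 \<le> \<delta>\<^sup>2" using p(2)[OF elim] by (metis abs_ge_zero less_imp_le power2_abs power_mono)
      have Bg: "(indicator B x - g x)\<^sup>2 \<le> indicator (U - C) x"
      proof -
        consider "x \<in> C" | "x \<notin> U" | "x \<in> U - C" by blast
        then show ?thesis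
        proof cases
          case 2
          then have "x \<notin> B" using U(1) by blast
          then show ?thesis using 2 g(4) by simp
        next
          case 3
          have "\<bar>indicator B x - g x\<bar> \<le> 1" using g01[of x] by (auto simp: indicator_def)
          then have "(indicator B x - g x)\<^sup>2 \<le> 1" by (simp add: abs_square_le_1)
          then show ?thesis using 3 by simp
        qed (use C(1) U(1) g(3,4) in auto)
      qed
      have "(indicator B x - p x)\<^sup>2 \<le> 2 * (indicator B x - g x)\<^sup>2 + 2 * (g x - p x)\<^sup>2"
        using sum_squares_ge_zero[of "(indicator B x - g x) - (g x - p x)" 0]
        by (simp add: power2_eq_square algebra_simps)
      also have "\<dots> \<le> 2 * indicator (U - C) x + 2 * \<delta>\<^sup>2" using gp Bg by simp
      finally have "ennreal ((indicator B x - p x)\<^sup>2) \<le> ennreal (2 * indicator (U - C) x + 2 * \<delta>\<^sup>2)"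
        by (rule ennreal_leI)
      also have "\<dots> = 2 * indicator (U - C) x + ennreal (2 * \<delta>\<^sup>2)"
        by (subst ennreal_plus) (auto simp: indicator_def)
      finally show ?case .
    qed
  qed
  also have "\<dots> = 2 * emeasure \<nu> (U - C) + ennreal (2 * \<delta>\<^sup>2) * emeasure \<nu> (space \<nu>)"
    by (simp add: nn_integral_add nn_integral_cmult)
  also have "\<dots> \<le> 2 * ennreal (2 * d) + ennreal (2 * \<delta>\<^sup>2) * ennreal T"
    using UC by (intro add_mono mult_left_mono) (auto simp: T_def emeasure_eq_measure)
  also have "\<dots> = ennreal (4 * d + 2 * (\<delta>\<^sup>2 * T))"
    using d T by (simp add: ennreal_mult ennreal_plus algebra_simps)
  also have "\<dots> \<le> ennreal e" using \<delta>(2) e by (intro ennreal_leI) (simp add: d_def)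
  finally show thesis using that p(1) by blast
qed

section \<open>Density of the trigonometric polynomials\<close>

definition unit_cube :: "(real^'m) set" where
  "unit_cube = {x. \<forall>i. 0 \<le> x $ i \<and> x $ i < 1}"

definition torus_char :: "real^'m \<Rightarrow> real^'m \<Rightarrow> complex" where
  "torus_char k x = cis (2 * pi * (k \<bullet> x))"

lemma Basis_vec_real: "(Basis :: (real^'m) set) = range (\<lambda>i. axis i 1)"
  by (auto simp: Basis_vec_def)

lemma int_vectors_add: "k \<in> int_vectors \<Longrightarrow> l \<in> int_vectors \<Longrightarrow> k + l \<in> int_vectors"
  and int_vectors_minus: "k \<in> int_vectors \<Longrightarrow> - k \<in> int_vectors"
  and int_vectors_diff: "k \<in> int_vectors \<Longrightarrow> l \<in> int_vectors \<Longrightarrow> k - l \<in> int_vectors"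
  and int_vectors_axis: "axis i 1 \<in> int_vectors" and int_vectors_0: "0 \<in> int_vectors"
  by (auto simp: int_vectors_def axis_def)

lemma int_vectors_inner_Ints: "k \<in> int_vectors \<Longrightarrow> l \<in> int_vectors \<Longrightarrow> k \<bullet> l \<in> \<int>"
  by (auto simp: int_vectors_def inner_vec_def intro!: Ints_sum Ints_mult)

lemma torus_char_add_left: "torus_char (k + l) x = torus_char k x * torus_char l x"
  by (simp add: torus_char_def inner_add_left distrib_left cis_mult)

lemma torus_char_0 [simp]: "torus_char 0 x = 1"
  by (simp add: torus_char_def)

lemma norm_torus_char [simp]: "norm (torus_char k x) = 1"
  by (simp add: torus_char_def)

lemma cnj_torus_char: "cnj (torus_char k x) = torus_char (- k) x"
  by (simp add: torus_char_def cis_cnj)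

lemma torus_char_periodic:
  assumes "k \<in> int_vectors" "v \<in> int_vectors" shows "torus_char k (x + v) = torus_char k x"
  using cis_multiple_2pi[OF int_vectors_inner_Ints[OF assms]]
  by (simp add: torus_char_def inner_add_right distrib_left cis_mult[symmetric])

lemma continuous_torus_char: "continuous_on S (torus_char k)"
  unfolding torus_char_def by (intro continuous_intros)

lemma measurable_torus_char [measurable]: "torus_char k \<in> borel_measurable borel"
  by (rule borel_measurable_continuous_onI[OF continuous_torus_char])

lemma measurable_vec_nth [measurable]: "(\<lambda>x. x $ i) \<in> borel_measurable borel"
  by (rule borel_measurable_continuous_onI) (intro continuous_intros)

lemma unit_cube_borel [measurable]: "unit_cube \<in> sets borel"
proof -
  have "unit_cube = (\<Inter>i. {x \<in> space borel. 0 \<le> x $ i \<and> x $ i < (1::real)})" by (auto simp: unit_cube_def)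
  also have "\<dots> \<in> sets borel" by (rule sets.finite_INT) auto
  finally show ?thesis .
qed

lemma emeasure_unit_cube_finite: "emeasure lborel (unit_cube :: (real^'m) set) < \<infinity>"
proof -
  have "emeasure lborel (unit_cube :: (real^'m) set) \<le> emeasure lborel (cbox 0 (1 :: real^'m))"
    by (intro emeasure_mono) (auto simp: unit_cube_def mem_box_cart less_imp_le)
  also have "\<dots> < \<infinity>" by (rule emeasure_lborel_cbox_finite)
  finally show ?thesis .
qed

lemma integral_unit_interval_cis:
  assumes "n \<in> \<int>"
  shows "(LINT t|lborel. indicator {0..<1} t * cis (2 * pi * n * t)) = (if n = 0 then 1 else 0)"
    "integrable lborel (\<lambda>t. indicator {0..<1} t * cis (2 * pi * n * t))"
proof -
  let ?F = "\<lambda>t::real. if n = 0 then complex_of_real t else cis (2 * pi * n * t) / (2 * pi * n * \<i>)"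
  have "has_bochner_integral lborel (\<lambda>t. indicator {0..1} t *\<^sub>R cis (2 * pi * n * t)) (?F 1 - ?F 0)"
  proof (rule has_bochner_integral_FTC_Icc)
    fix t :: real
    show "(?F has_vector_derivative cis (2 * pi * n * t)) (at t within {0..1})"
    proof (cases "n = 0")
      case True
      then show ?thesis by (auto intro!: derivative_eq_intros simp: has_vector_derivative_def fun_eq_iff scaleR_conv_of_real)
    next
      case False
      have "((\<lambda>t. cis (2 * pi * n * t)) has_derivative (\<lambda>x. (2 * pi * n * x) *\<^sub>R (\<i> * cis (2 * pi * n * t)))) (at t within {0..1})"
        by (auto intro!: derivative_eq_intros)
      then have "((\<lambda>t. cis (2 * pi * n * t)) has_vector_derivative (2 * pi * n * \<i>) * cis (2 * pi * n * t)) (at t within {0..1})"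
        unfolding has_vector_derivative_def
        by (rule has_derivative_eq_rhs) (auto simp: fun_eq_iff scaleR_conv_of_real)
      from has_vector_derivative_divide[OF this, of "2 * pi * n * \<i>"] show ?thesis using False by simp
    qed
  qed (auto intro!: continuous_intros)
  moreover have "?F 1 - ?F 0 = (if n = 0 then 1 else 0)"
    using cis_multiple_2pi[OF assms] by simp
  moreover have "has_bochner_integral lborel (\<lambda>t. indicator {0..1} t *\<^sub>R cis (2 * pi * n * t)) x \<longleftrightarrow>
      has_bochner_integral lborel (\<lambda>t. indicator {0..<1} t * cis (2 * pi * n * t)) x" for x
  proof (rule has_bochner_integral_cong_AE)
    show "AE t in lborel. indicator {0..1} t *\<^sub>R cis (2 * pi * n * t) = indicator {0..<1} t * cis (2 * pi * n * t)"
      using AE_lborel_singleton[of "1::real"] by eventually_elim (auto simp: indicator_def)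
    have [measurable]: "cis \<in> borel_measurable borel"
      by (rule borel_measurable_continuous_onI) (intro continuous_intros)
    show "(\<lambda>t. indicator {0..1} t *\<^sub>R cis (2 * pi * n * t)) \<in> borel_measurable lborel"
      "(\<lambda>t. indicator {0..<1} t * cis (2 * pi * n * t)) \<in> borel_measurable lborel" by measurable
  qed
  ultimately have "has_bochner_integral lborel (\<lambda>t. indicator {0..<1} t * cis (2 * pi * n * t)) (if n = 0 then 1 else 0)"
    by simp
  then show "(LINT t|lborel. indicator {0..<1} t * cis (2 * pi * n * t)) = (if n = 0 then 1 else 0)"
    "integrable lborel (\<lambda>t. indicator {0..<1} t * cis (2 * pi * n * t))"
    by (auto simp: has_bochner_integral_iff)
qed

text \<open>Fubini's theorem for a product of functions of the single coordinates.\<close>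

lemma integral_lborel_prod:
  fixes g :: "'a::euclidean_space \<Rightarrow> real \<Rightarrow> complex"
  assumes "\<And>b. b \<in> Basis \<Longrightarrow> integrable lborel (g b)"
  shows "(LINT x|lborel. (\<Prod>b\<in>Basis. g b (x \<bullet> b))) = (\<Prod>b\<in>Basis. LINT t|lborel. g b t)"
proof -
  interpret product_sigma_finite "\<lambda>_::'a. lborel :: real measure" ..
  have m[measurable]: "b \<in> Basis \<Longrightarrow> g b \<in> borel_measurable borel" for b using assms by (auto dest: borel_measurable_integrable)
  have "(LINT x|lborel. (\<Prod>b\<in>Basis. g b (x \<bullet> b)))
      = (LINT f|(\<Pi>\<^sub>M b\<in>Basis. lborel). (\<Prod>b\<in>Basis. g b ((\<Sum>b\<in>Basis. f b *\<^sub>R b) \<bullet> b)))"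
    by (subst lborel_eq, subst integral_distr) (auto intro!: borel_measurable_prod)
  also have "\<dots> = (LINT f|(\<Pi>\<^sub>M b\<in>(Basis::'a set). lborel). (\<Prod>b\<in>Basis. g b (f b)))"
    by (intro Bochner_Integration.integral_cong refl prod.cong) simp
  also have "\<dots> = (\<Prod>b\<in>Basis. LINT t|lborel. g b t)"
    by (rule product_integral_prod) (use assms in auto)
  finally show ?thesis .
qed

lemma cis_sum: "finite I \<Longrightarrow> cis (\<Sum>i\<in>I. f i) = (\<Prod>i\<in>I. cis (f i))"
  by (induction I rule: finite_induct) (auto simp: cis_mult[symmetric])

abbreviation cube_measure :: "(real^'m) measure" where
  "cube_measure \<equiv> restrict_space lborel unit_cube"

lemma integral_cube_char:
  assumes "(k :: real^'m) \<in> int_vectors"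
  shows "(LINT x|cube_measure. torus_char k x) = (if k = 0 then 1 else 0)"
proof -
  let ?g = "\<lambda>b t. indicator {0..<1} t * cis (2 * pi * (k \<bullet> b) * t)"
  have kb: "k \<bullet> b \<in> \<int>" if "b \<in> Basis" for b
    using assms that by (auto simp: Basis_vec_real inner_axis int_vectors_def)
  have "(LINT x|cube_measure. torus_char k x) = (LINT x|lborel. indicator unit_cube x *\<^sub>R torus_char k x)"
    by (rule integral_restrict_space) simp
  also have "\<dots> = (LINT x|lborel. (\<Prod>b\<in>Basis. ?g b (x \<bullet> b)))"
  proof (rule Bochner_Integration.integral_cong[OF refl])
    fix x :: "real^'m"
    have "torus_char k x = (\<Prod>b\<in>Basis. cis (2 * pi * (k \<bullet> b) * (x \<bullet> b)))"
      by (simp add: torus_char_def euclidean_inner[of k x] sum_distrib_left cis_sum mult.assoc)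
    moreover have "(\<Prod>b\<in>Basis. indicator {0..<1} (x \<bullet> b)) = (indicator unit_cube x :: complex)"
    proof (cases "x \<in> unit_cube")
      case True
      then have "(\<Prod>b\<in>Basis. indicator {0..<1} (x \<bullet> b)) = (1 :: complex)"
        by (intro prod.neutral) (auto simp: unit_cube_def Basis_vec_real inner_axis)
      then show ?thesis using True by simp
    next
      case False
      then have "\<exists>b\<in>Basis. indicator {0..<1} (x \<bullet> b) = (0 :: complex)"
        by (auto simp: unit_cube_def Basis_vec_real inner_axis indicator_def not_le not_less)
      then show ?thesis using False prod_zero[OF finite_Basis] by simp
    qed
    ultimately show "indicator unit_cube x *\<^sub>R torus_char k x = (\<Prod>b\<in>Basis. ?g b (x \<bullet> b))"
      by (simp add: prod.distrib indicator_def)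
  qed
  also have "\<dots> = (\<Prod>b\<in>Basis. LINT t|lborel. ?g b t)"
    by (rule integral_lborel_prod) (rule integral_unit_interval_cis(2)[OF kb])
  also have "\<dots> = (\<Prod>b\<in>Basis. if k \<bullet> b = 0 then 1 else 0)"
    by (intro prod.cong refl integral_unit_interval_cis(1) kb)
  also have "\<dots> = (if k = 0 then 1 else 0)"
  proof (cases "k = 0")
    case False
    then obtain b where "b \<in> Basis" "k \<bullet> b \<noteq> 0" using euclidean_all_zero_iff by blast
    then have "\<exists>b\<in>Basis. (if k \<bullet> b = 0 then 1 else 0) = (0 :: complex)" by auto
    then show ?thesis using False prod_zero[OF finite_Basis] by simp
  qed simp
  finally show ?thesis .
qed

definition trig_polys :: "(real^'m \<Rightarrow> complex) set" where
  "trig_polys = {\<lambda>x. \<Sum>k\<in>F. a k * torus_char k x | F a. finite F \<and> F \<subseteq> int_vectors}"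

lemma trig_polys_char: "k \<in> int_vectors \<Longrightarrow> (\<lambda>x. c * torus_char k x) \<in> trig_polys"
  unfolding trig_polys_def by (rule CollectI, intro exI[of _ "{k}"] exI[of _ "\<lambda>_. c"]) auto

lemma trig_polys_const: "(\<lambda>x. c) \<in> trig_polys"
  using trig_polys_char[OF int_vectors_0, of c] by simp

lemma trig_polys_add:
  assumes "p \<in> trig_polys" "q \<in> trig_polys" shows "(\<lambda>x. p x + q x) \<in> trig_polys"
proof -
  obtain F a where F: "finite F" "F \<subseteq> int_vectors" "p = (\<lambda>x. \<Sum>k\<in>F. a k * torus_char k x)"
    using assms(1) by (auto simp: trig_polys_def)
  obtain H b where H: "finite H" "H \<subseteq> int_vectors" "q = (\<lambda>x. \<Sum>k\<in>H. b k * torus_char k x)"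
    using assms(2) by (auto simp: trig_polys_def)
  let ?c = "\<lambda>k. (if k \<in> F then a k else 0) + (if k \<in> H then b k else 0)"
  have "p x = (\<Sum>k\<in>F\<union>H. (if k \<in> F then a k else 0) * torus_char k x)" for x
    unfolding F(3) using F(1) H(1) by (intro sum.mono_neutral_cong_left) auto
  moreover have "q x = (\<Sum>k\<in>F\<union>H. (if k \<in> H then b k else 0) * torus_char k x)" for x
    unfolding H(3) using F(1) H(1) by (intro sum.mono_neutral_cong_left) auto
  ultimately have "(\<lambda>x. p x + q x) = (\<lambda>x. \<Sum>k\<in>F\<union>H. ?c k * torus_char k x)"
    by (simp add: fun_eq_iff sum.distrib distrib_right)
  then show ?thesis unfolding trig_polys_def using F(1,2) H(1,2) by (intro CollectI exI[of _ "F \<union> H"] exI[of _ ?c]) auto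
qed

lemma trig_polys_sum: "(\<And>i. i \<in> I \<Longrightarrow> p i \<in> trig_polys) \<Longrightarrow> (\<lambda>x. \<Sum>i\<in>I. p i x) \<in> trig_polys"
  by (induction I rule: infinite_finite_induct) (auto intro: trig_polys_const trig_polys_add)

lemma trig_polys_mult:
  assumes "p \<in> trig_polys" "q \<in> trig_polys" shows "(\<lambda>x. p x * q x) \<in> trig_polys"
proof -
  obtain F a where F: "finite F" "F \<subseteq> int_vectors" "p = (\<lambda>x. \<Sum>k\<in>F. a k * torus_char k x)"
    using assms(1) by (auto simp: trig_polys_def)
  obtain H b where H: "finite H" "H \<subseteq> int_vectors" "q = (\<lambda>x. \<Sum>k\<in>H. b k * torus_char k x)"
    using assms(2) by (auto simp: trig_polys_def)
  have "(\<lambda>x. \<Sum>k\<in>F. \<Sum>l\<in>H. (a k * b l) * torus_char (k + l) x) \<in> trig_polys"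
    by (intro trig_polys_sum trig_polys_char int_vectors_add) (use F(2) H(2) in auto)
  then show ?thesis unfolding F(3) H(3) by (simp add: sum_product torus_char_add_left mult_ac)
qed

lemma trig_polys_cmult: "p \<in> trig_polys \<Longrightarrow> (\<lambda>x. a * p x) \<in> trig_polys"
  using trig_polys_mult[OF trig_polys_const, of p a] by simp

lemma trig_polys_measurable: "trig_polys \<subseteq> borel_measurable borel"
  unfolding trig_polys_def by auto

text \<open>The unit cube is mapped onto the product of unit circles, a compact subset of a Euclidean space. There
  polynomials in the real coordinates are trigonometric polynomials, and Stone--Weierstrass applies.
  The inverse \<open>torus_coordinates\<close> is only Borel, which suffices to transfer indicators.\<close>

definition torus_embedding :: "real^'m \<Rightarrow> complex^'m" where
  "torus_embedding x = (\<chi> i. cis (2 * pi * x $ i))"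

definition torus_coordinates :: "complex^'m \<Rightarrow> real^'m" where
  "torus_coordinates z = (\<chi> i. Arg2pi (z $ i) / (2 * pi))"

lemma torus_coordinates_embedding:
  assumes "x \<in> unit_cube" shows "torus_coordinates (torus_embedding x) = x"
proof -
  have "Arg2pi (cis (2 * pi * x $ i)) = 2 * pi * x $ i" for i
    by (rule Arg2pi_unique[of 1]) (use assms in \<open>auto simp: unit_cube_def cis_conv_exp mult.commute\<close>)
  then show ?thesis by (simp add: torus_coordinates_def torus_embedding_def vec_eq_iff)
qed

lemma measurable_Arg2pi [measurable]: "Arg2pi \<in> borel_measurable borel"
proof -
  have "continuous_on (- \<real>\<^sub>\<ge>\<^sub>0) Arg2pi"
    using continuous_at_Arg2pi by (auto intro!: continuous_at_imp_continuous_on)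
  then have "(\<lambda>z. indicator (- \<real>\<^sub>\<ge>\<^sub>0) z *\<^sub>R Arg2pi z) \<in> borel_measurable borel"
    by (intro borel_measurable_continuous_on_indicator) auto
  moreover have "indicator (- \<real>\<^sub>\<ge>\<^sub>0) z *\<^sub>R Arg2pi z = Arg2pi z" for z
  proof (cases "z \<in> \<real>\<^sub>\<ge>\<^sub>0")
    case True
    then have "Arg2pi z = 0" by (auto simp: Arg2pi_eq_0 complex_nonneg_Reals_iff complex_is_Real_iff)
    then show ?thesis by simp
  qed simp
  ultimately show ?thesis by (simp only:)
qed

lemma borel_measurable_vec_lambda:
  fixes f :: "'a \<Rightarrow> 'b::euclidean_space ^ 'm"
  assumes "\<And>i. (\<lambda>x. f x $ i) \<in> borel_measurable M"
  shows "f \<in> borel_measurable M"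
  by (rule borel_measurable_euclidean_space[THEN iffD2])
    (use assms in \<open>auto simp: Basis_vec_def inner_axis\<close>)

lemma measurable_torus_coordinates [measurable]: "torus_coordinates \<in> borel \<rightarrow>\<^sub>M borel"
  by (rule borel_measurable_vec_lambda) (simp add: torus_coordinates_def)

lemma continuous_torus_embedding: "continuous_on S torus_embedding"
  unfolding torus_embedding_def by (intro continuous_intros)

lemma measurable_torus_embedding [measurable]: "torus_embedding \<in> borel \<rightarrow>\<^sub>M borel"
  by (rule borel_measurable_continuous_onI[OF continuous_torus_embedding])

text \<open>Cosine and sine are combinations of a character and its conjugate, and trigonometric polynomials form
  an algebra.\<close>

lemma real_polynomial_torus_embedding:
  assumes "real_polynomial_function p"
  shows "(\<lambda>x. complex_of_real (p (torus_embedding x))) \<in> trig_polys"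
  using assms
proof induction
  case (linear f)
  interpret f: bounded_linear f by fact
  have euler: "complex_of_real (cos t) = 1/2 * cis t + 1/2 * cis (- t)"
    "complex_of_real (sin t) = - \<i>/2 * cis t + \<i>/2 * cis (- t)" for t
    by (simp_all add: complex_eq_iff)
  have coord: "(\<lambda>x. complex_of_real (torus_embedding x \<bullet> b)) \<in> trig_polys" if "b \<in> Basis" for b :: "complex^'a"
  proof -
    from that obtain i u where b: "b = axis i u" "u = 1 \<or> u = \<i>"
      unfolding Basis_vec_def Basis_complex_def by blast
    have x: "torus_char (axis i 1) x = cis (2 * pi * x $ i)" "torus_char (- axis i 1) x = cis (- (2 * pi * x $ i))" for x :: "real^'a"
      by (simp_all add: torus_char_def inner_axis')
    have "(\<lambda>x. c * torus_char (axis i 1) x + d * torus_char (- axis i 1) x) \<in> trig_polys" for c d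
      by (intro trig_polys_add trig_polys_char int_vectors_axis int_vectors_minus)
    from this[of "1/2" "1/2"] this[of "- \<i>/2" "\<i>/2"]
    have "(\<lambda>x. complex_of_real (cos (2 * pi * x $ i))) \<in> trig_polys"
      "(\<lambda>x. complex_of_real (sin (2 * pi * x $ i))) \<in> trig_polys"
      unfolding x by (simp_all only: euler)
    then show ?thesis
      using b(2) by (elim disjE) (simp_all add: b(1) inner_axis torus_embedding_def inner_complex_def)
  qed
  have f_eq: "f z = (\<Sum>b\<in>Basis. (z \<bullet> b) * f b)" for z
    by (subst euclidean_representation[of z, symmetric]) (simp only: f.sum f.scaleR real_scaleR_def)
  have "(\<lambda>x. complex_of_real (f (torus_embedding x))) =
      (\<lambda>x. \<Sum>b\<in>Basis. complex_of_real (f b) * complex_of_real (torus_embedding x \<bullet> b))"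
    by (rule ext) (subst f_eq, simp add: mult.commute)
  then show ?case by (simp only:) (intro trig_polys_sum trig_polys_cmult coord)
next
  case (const c)
  show ?case by (rule trig_polys_const)
next
  case (add f g)
  then show ?case using trig_polys_add by fastforce
next
  case (mult f g)
  then show ?case using trig_polys_mult by fastforce
qed

lemma finite_measure_cube: "finite_measure (cube_measure :: (real^'m) measure)"
  by (rule finite_measureI) (use emeasure_unit_cube_finite[where 'm='m] in \<open>simp add: space_restrict_space emeasure_restrict_space\<close>)

text \<open>Approximation is carried out for the image measure on the torus, whose indicators pull back to those
  on the cube.\<close>

lemma trig_polys_dense:
  assumes "f \<in> L2_space cube_measure"
  shows "L2_approximable cube_measure trig_polys f"
proof (rule L2_approximable_if_indicators[OF _ trig_polys_add trig_polys_cmult _ assms])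
  show "(trig_polys :: (real^'m \<Rightarrow> complex) set) \<subseteq> borel_measurable cube_measure"
  proof
    fix p :: "real^'m \<Rightarrow> complex" assume "p \<in> trig_polys"
    then have "p \<in> borel_measurable lborel" using trig_polys_measurable by auto
    then show "p \<in> borel_measurable cube_measure" by (rule measurable_restrict_space1)
  qed
next
  fix B :: "(real^'m) set" assume B: "B \<in> sets cube_measure"
  then have B2: "B \<in> sets borel" "B \<subseteq> unit_cube" by (auto simp: sets_restrict_space_iff)
  let ?M = "cube_measure :: (real^'m) measure"
  interpret finite_measure ?M by (rule finite_measure_cube)
  have em[measurable]: "torus_embedding \<in> ?M \<rightarrow>\<^sub>M borel" by (rule measurable_restrict_space1) simp
  let ?\<nu> = "distr ?M borel torus_embedding"
  let ?B = "torus_coordinates -` B"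
  have B'[measurable]: "?B \<in> sets borel" using measurable_sets[OF measurable_torus_coordinates B2(1)] by simp
  show "L2_approximable ?M trig_polys (indicator B)"
    unfolding L2_approximable_def
  proof (intro allI impI)
    fix e :: real assume "e > 0"
    define K :: "(complex^'m) set" where "K = {z. \<forall>i. norm (z $ i) = 1}"
    have K: "compact K"
      unfolding compact_eq_bounded_closed
    proof
      show "closed K" unfolding K_def by (intro closed_Collect_all closed_Collect_eq continuous_intros)
      have "norm z \<le> real CARD('m)" if "z \<in> K" for z
        unfolding norm_vec_def
        by (rule order_trans[OF L2_set_le_sum]) (use that in \<open>simp_all add: K_def\<close>)
      then show "bounded K" by (rule boundedI)
    qed
    have AE: "AE z in ?\<nu>. z \<in> K"
      by (subst AE_distr_iff) (auto simp: K_def torus_embedding_def)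
    obtain p where p: "real_polynomial_function p"
      "(\<integral>\<^sup>+z. ennreal ((indicator ?B z - p z)\<^sup>2) \<partial>?\<nu>) \<le> ennreal e"
      by (rule indicator_polynomial_approx[OF _ _ K AE B' \<open>e > 0\<close>]) (auto intro: finite_measure_distr)
    have [measurable]: "p \<in> borel_measurable borel"
      using continuous_real_polymonial_function[OF p(1)]
      by (intro borel_measurable_continuous_onI continuous_at_imp_continuous_on) auto
    have "L2_normsq ?M (\<lambda>x. indicator B x - complex_of_real (p (torus_embedding x)))
        = (\<integral>\<^sup>+x. ennreal ((indicator ?B (torus_embedding x) - p (torus_embedding x))\<^sup>2) \<partial>?M)"
      unfolding L2_normsq_def
    proof (rule nn_integral_cong)
      fix x assume "x \<in> space ?M"
      then have "x \<in> unit_cube" by (simp add: space_restrict_space)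
      then have "indicator ?B (torus_embedding x) = (indicator B x :: real)"
        by (simp add: indicator_def torus_coordinates_embedding)
      moreover have "indicator B x - complex_of_real (p (torus_embedding x)) = complex_of_real (indicator B x - p (torus_embedding x))"
        by (simp add: indicator_def)
      ultimately show "ennreal ((cmod (indicator B x - complex_of_real (p (torus_embedding x))))\<^sup>2) =
          ennreal ((indicator ?B (torus_embedding x) - p (torus_embedding x))\<^sup>2)" by (simp only: norm_of_real power2_abs)
    qed
    also have "\<dots> = (\<integral>\<^sup>+z. ennreal ((indicator ?B z - p z)\<^sup>2) \<partial>?\<nu>)"
      by (subst nn_integral_distr) auto
    also have "\<dots> \<le> ennreal e" by (rule p(2))
    finally show "\<exists>p\<in>trig_polys. L2_normsq ?M (\<lambda>x. indicator B x - p x) \<le> ennreal e"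
      using real_polynomial_torus_embedding[OF p(1)] by (intro bexI) auto
  qed
qed

section \<open>Parseval's identity on the unit cube\<close>

lemma integrable_of_L2:
  fixes g :: "'a \<Rightarrow> complex"
  assumes "finite_measure M" "f \<in> L2_space M" "g \<in> borel_measurable M" "\<And>x. norm (g x) \<le> norm (f x)"
  shows "integrable M g"
proof -
  interpret finite_measure M by fact
  have [measurable]: "f \<in> borel_measurable M" using assms(2) by (simp add: L2_space_def)
  have "(\<integral>\<^sup>+x. ennreal (norm (g x)) \<partial>M) \<le> (\<integral>\<^sup>+x. 1 + ennreal ((cmod (f x))\<^sup>2) \<partial>M)"
  proof (rule nn_integral_mono)
    fix x
    have "cmod (f x) \<le> 1 + (cmod (f x))\<^sup>2"
      using zero_le_power2[of "cmod (f x) - 1/2"] by (simp add: power2_eq_square algebra_simps)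
    then have "ennreal (norm (g x)) \<le> ennreal (1 + (cmod (f x))\<^sup>2)"
      using assms(4)[of x] by (intro ennreal_leI) linarith
    then show "ennreal (norm (g x)) \<le> 1 + ennreal ((cmod (f x))\<^sup>2)" by (simp add: ennreal_plus)
  qed
  also have "\<dots> = emeasure M (space M) + L2_normsq M f"
    by (subst nn_integral_add) (auto simp: L2_normsq_def)
  also have "\<dots> < \<infinity>" using assms(2) by (simp add: L2_space_def less_top[symmetric])
  finally show ?thesis using assms(3) by (intro integrableI_bounded) auto
qed

lemma integrable_L2_square:
  assumes "f \<in> L2_space M" shows "integrable M (\<lambda>x. (cmod (f x))\<^sup>2)"
  using assms by (intro integrableI_bounded) (auto simp: L2_space_def L2_normsq_def)

lemma L2_normsq_eq_integral:
  assumes "integrable M (\<lambda>x. (cmod (f x))\<^sup>2)"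
  shows "L2_normsq M f = ennreal (LINT x|M. (cmod (f x))\<^sup>2)"
  unfolding L2_normsq_def by (rule nn_integral_eq_integral[OF assms]) auto

text \<open>Orthonormality of the characters makes a trigonometric polynomial's distance to \<open>f\<close> explicit
  in terms of its coefficients and the Fourier coefficients of \<open>f\<close>.\<close>

lemma trig_poly_distance:
  fixes f :: "real^'m \<Rightarrow> complex"
  assumes f: "f \<in> L2_space cube_measure" and F: "finite F" "F \<subseteq> int_vectors"
  defines "c \<equiv> \<lambda>k. LINT x|cube_measure. f x * torus_char (- k) x"
  shows "integrable cube_measure (\<lambda>x. (cmod (f x - (\<Sum>k\<in>F. a k * torus_char k x)))\<^sup>2)"
    and "(LINT x|cube_measure. (cmod (f x - (\<Sum>k\<in>F. a k * torus_char k x)))\<^sup>2)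
      = (LINT x|cube_measure. (cmod (f x))\<^sup>2) + (\<Sum>k\<in>F. (cmod (a k - c k))\<^sup>2) - (\<Sum>k\<in>F. (cmod (c k))\<^sup>2)"
proof -
  let ?M = "cube_measure :: (real^'m) measure"
  let ?p = "\<lambda>x. \<Sum>k\<in>F. a k * torus_char k x"
  interpret finite_measure ?M by (rule finite_measure_cube)
  have fm[measurable]: "f \<in> borel_measurable ?M" using f by (simp add: L2_space_def)
  have cm[measurable]: "torus_char k \<in> borel_measurable ?M" for k :: "real^'m"
    by (rule measurable_restrict_space1) simp
  have i0: "integrable ?M (\<lambda>x. complex_of_real ((cmod (f x))\<^sup>2))"
    using integrable_L2_square[OF f] by (simp only: complex_of_real_integrable_eq)
  have i1: "integrable ?M (\<lambda>x. f x * torus_char k x)" for k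
    by (rule integrable_of_L2[OF finite_measure_cube f]) (auto simp: norm_mult)
  have [measurable]: "(\<lambda>x. cnj (f x)) \<in> borel_measurable ?M"
    by (rule borel_measurable_continuous_on[OF _ fm]) (intro continuous_intros)
  have i2: "integrable ?M (\<lambda>x. cnj (f x) * torus_char k x)" for k
    by (rule integrable_of_L2[OF finite_measure_cube f]) (auto simp: norm_mult)
  have i3: "integrable ?M (torus_char k)" for k
    by (rule integrable_const_bound[of _ 1]) auto
  have c1: "(LINT x|?M. f x * torus_char (- k) x) = c k" for k by (simp add: c_def)
  have c2: "(LINT x|?M. cnj (f x) * torus_char k x) = cnj (c k)" for k
  proof -
    have "cnj (c k) = (LINT x|?M. cnj (f x * torus_char (- k) x))"
      unfolding c_def by (rule Bochner_Integration.integral_cnj[symmetric])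
    then show ?thesis by (simp add: cnj_torus_char)
  qed
  have expand: "complex_of_real ((cmod (f x - ?p x))\<^sup>2) = complex_of_real ((cmod (f x))\<^sup>2)
      - (\<Sum>k\<in>F. cnj (a k) * (f x * torus_char (- k) x)) - (\<Sum>k\<in>F. a k * (cnj (f x) * torus_char k x))
      + (\<Sum>k\<in>F. \<Sum>l\<in>F. a k * cnj (a l) * torus_char (k + - l) x)" for x
  proof -
    have "?p x * cnj (?p x) = (\<Sum>k\<in>F. \<Sum>l\<in>F. a k * cnj (a l) * torus_char (k + - l) x)"
      unfolding cnj_sum sum_product torus_char_add_left by (simp add: cnj_torus_char mult_ac)
    moreover have "f x * cnj (?p x) = (\<Sum>k\<in>F. cnj (a k) * (f x * torus_char (- k) x))"
      by (simp add: sum_distrib_left cnj_torus_char mult_ac)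
    moreover have "?p x * cnj (f x) = (\<Sum>k\<in>F. a k * (cnj (f x) * torus_char k x))"
      unfolding sum_distrib_right by (intro sum.cong refl) (simp add: mult_ac)
    moreover have "complex_of_real ((cmod (f x - ?p x))\<^sup>2) = f x * cnj (f x) - f x * cnj (?p x) - ?p x * cnj (f x) + ?p x * cnj (?p x)"
      unfolding complex_norm_square by (simp add: algebra_simps)
    ultimately show ?thesis by (simp only: complex_norm_square)
  qed
  have int: "integrable ?M (\<lambda>x. complex_of_real ((cmod (f x - ?p x))\<^sup>2))"
    unfolding expand
    by (intro Bochner_Integration.integrable_add Bochner_Integration.integrable_diff Bochner_Integration.integrable_sum
        integrable_mult_right i0 i1 i2 i3)
  then show int': "integrable ?M (\<lambda>x. (cmod (f x - ?p x))\<^sup>2)"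
    by (simp only: complex_of_real_integrable_eq)
  have ortho: "(LINT x|?M. torus_char (k + - l) x) = (if k = l then 1 else 0)" if "k \<in> F" "l \<in> F" for k l
    using integral_cube_char[OF int_vectors_diff, of k l] F(2) that by (auto simp: subset_iff)
  have "complex_of_real (LINT x|?M. (cmod (f x - ?p x))\<^sup>2) = (LINT x|?M. complex_of_real ((cmod (f x - ?p x))\<^sup>2))"
    by (rule integral_complex_of_real[symmetric])
  also have "\<dots> = complex_of_real (LINT x|?M. (cmod (f x))\<^sup>2)
      - (\<Sum>k\<in>F. cnj (a k) * c k) - (\<Sum>k\<in>F. a k * cnj (c k))
      + (\<Sum>k\<in>F. \<Sum>l\<in>F. a k * cnj (a l) * (LINT x|?M. torus_char (k + - l) x))"
    unfolding expand
    by (simp add: Bochner_Integration.integral_add Bochner_Integration.integral_diff Bochner_Integration.integral_sum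
        Bochner_Integration.integrable_add Bochner_Integration.integrable_diff Bochner_Integration.integrable_sum
        i0 i1 i2 i3 c1 c2 del: of_real_power)
  also have "(\<Sum>k\<in>F. \<Sum>l\<in>F. a k * cnj (a l) * (LINT x|?M. torus_char (k + - l) x)) = (\<Sum>k\<in>F. a k * cnj (a k))"
  proof (rule sum.cong[OF refl])
    fix k assume k: "k \<in> F"
    have "(\<Sum>l\<in>F. a k * cnj (a l) * (LINT x|?M. torus_char (k + - l) x)) = (\<Sum>l\<in>F. if k = l then a k * cnj (a l) else 0)"
      by (intro sum.cong refl, subst ortho[OF k]) simp_all
    also have "\<dots> = a k * cnj (a k)" using F(1) k by simp
    finally show "(\<Sum>l\<in>F. a k * cnj (a l) * (LINT x|?M. torus_char (k + - l) x)) = a k * cnj (a k)" .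
  qed
  also have "complex_of_real (LINT x|?M. (cmod (f x))\<^sup>2) - (\<Sum>k\<in>F. cnj (a k) * c k) - (\<Sum>k\<in>F. a k * cnj (c k)) + (\<Sum>k\<in>F. a k * cnj (a k))
      = complex_of_real (LINT x|?M. (cmod (f x))\<^sup>2) + (\<Sum>k\<in>F. (a k - c k) * cnj (a k - c k)) - (\<Sum>k\<in>F. c k * cnj (c k))"
    by (simp add: sum.distrib sum_subtractf algebra_simps)
  also have "\<dots> = complex_of_real ((LINT x|?M. (cmod (f x))\<^sup>2) + (\<Sum>k\<in>F. (cmod (a k - c k))\<^sup>2) - (\<Sum>k\<in>F. (cmod (c k))\<^sup>2))"
    by (simp only: of_real_add of_real_diff of_real_sum complex_norm_square)
  finally show "(LINT x|?M. (cmod (f x - ?p x))\<^sup>2)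
      = (LINT x|?M. (cmod (f x))\<^sup>2) + (\<Sum>k\<in>F. (cmod (a k - c k))\<^sup>2) - (\<Sum>k\<in>F. (cmod (c k))\<^sup>2)"
    by (simp only: of_real_eq_iff)
qed

text \<open>Bessel's inequality comes from the polynomial whose coefficients are those of \<open>f\<close>; the converse from any
  polynomial close to \<open>f\<close>, which the one with the coefficients of \<open>f\<close> can only improve.\<close>

theorem Parseval_cube:
  fixes f :: "real^'m \<Rightarrow> complex"
  assumes f: "f \<in> L2_space cube_measure"
  shows "(\<Sum>\<^sub>\<infinity>k\<in>int_vectors. ennreal ((cmod (LINT x|cube_measure. f x * torus_char (- k) x))\<^sup>2)) = L2_normsq cube_measure f"
proof -
  let ?M = "cube_measure :: (real^'m) measure"
  define c where "c = (\<lambda>k. LINT x|?M. f x * torus_char (- k) x)"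
  define N where "N = (LINT x|?M. (cmod (f x))\<^sup>2)"
  have LN: "L2_normsq ?M f = ennreal N"
    unfolding N_def by (rule L2_normsq_eq_integral[OF integrable_L2_square[OF f]])
  have S: "(\<Sum>\<^sub>\<infinity>k\<in>int_vectors. ennreal ((cmod (c k))\<^sup>2)) = (SUP F\<in>{F. finite F \<and> F \<subseteq> int_vectors}. \<Sum>k\<in>F. ennreal ((cmod (c k))\<^sup>2))"
    by (rule nonneg_infsum_complete) simp
  have "(\<Sum>\<^sub>\<infinity>k\<in>int_vectors. ennreal ((cmod (c k))\<^sup>2)) = ennreal N"
  proof (rule antisym)
    show "(\<Sum>\<^sub>\<infinity>k\<in>int_vectors. ennreal ((cmod (c k))\<^sup>2)) \<le> ennreal N"
      unfolding S
    proof (rule SUP_least)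
      fix F :: "(real^'m) set" assume "F \<in> {F. finite F \<and> F \<subseteq> int_vectors}"
      then have F: "finite F" "F \<subseteq> int_vectors" by auto
      have "0 \<le> (LINT x|?M. (cmod (f x - (\<Sum>k\<in>F. c k * torus_char k x)))\<^sup>2)" by simp
      also have "\<dots> = N - (\<Sum>k\<in>F. (cmod (c k))\<^sup>2)"
        unfolding trig_poly_distance(2)[OF f F] by (simp add: c_def N_def)
      finally show "(\<Sum>k\<in>F. ennreal ((cmod (c k))\<^sup>2)) \<le> ennreal N" by (simp add: sum_ennreal ennreal_leI)
    qed
    show "ennreal N \<le> (\<Sum>\<^sub>\<infinity>k\<in>int_vectors. ennreal ((cmod (c k))\<^sup>2))"
    proof (rule ennreal_le_epsilon)
      fix e :: real assume e: "0 < e"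
      then obtain p where p: "p \<in> trig_polys" "L2_normsq ?M (\<lambda>x. f x - p x) \<le> ennreal e"
        using trig_polys_dense[OF f] unfolding L2_approximable_def by blast
      then obtain F a where F: "finite F" "F \<subseteq> int_vectors" and pa: "p = (\<lambda>x. \<Sum>k\<in>F. a k * torus_char k x)"
        by (auto simp: trig_polys_def)
      have "ennreal (LINT x|?M. (cmod (f x - p x))\<^sup>2) \<le> ennreal e"
        using p(2) L2_normsq_eq_integral[OF trig_poly_distance(1)[OF f F, of a]] unfolding pa by simp
      then have "(LINT x|?M. (cmod (f x - p x))\<^sup>2) \<le> e" using e by (simp add: ennreal_le_iff)
      moreover have "(LINT x|?M. (cmod (f x - p x))\<^sup>2) = N + (\<Sum>k\<in>F. (cmod (a k - c k))\<^sup>2) - (\<Sum>k\<in>F. (cmod (c k))\<^sup>2)"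
        unfolding pa trig_poly_distance(2)[OF f F] by (simp add: c_def N_def)
      moreover have "0 \<le> (\<Sum>k\<in>F. (cmod (a k - c k))\<^sup>2)" by (intro sum_nonneg) auto
      ultimately have "N \<le> (\<Sum>k\<in>F. (cmod (c k))\<^sup>2) + e" by linarith
      then have "ennreal N \<le> ennreal ((\<Sum>k\<in>F. (cmod (c k))\<^sup>2) + e)" by (rule ennreal_leI)
      also have "\<dots> = (\<Sum>k\<in>F. ennreal ((cmod (c k))\<^sup>2)) + ennreal e"
        using e by (simp add: ennreal_plus sum_nonneg sum_ennreal)
      also have "\<dots> \<le> (\<Sum>\<^sub>\<infinity>k\<in>int_vectors. ennreal ((cmod (c k))\<^sup>2)) + ennreal e"
        unfolding S using F by (intro add_right_mono SUP_upper) auto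
      finally show "ennreal N \<le> (\<Sum>\<^sub>\<infinity>k\<in>int_vectors. ennreal ((cmod (c k))\<^sup>2)) + ennreal e" .
    qed
  qed
  then show ?thesis unfolding LN c_def .
qed

section \<open>Lebesgue measure under linear maps\<close>

text \<open>Fubini's theorem singles out the coordinate \<open>m\<close>; for fixed other coordinates the shear is a translation
  of the line.\<close>

lemma nn_integral_shear:
  fixes f :: "real^'m \<Rightarrow> ennreal"
  assumes f[measurable]: "f \<in> borel_measurable borel" and mn: "m \<noteq> n"
  shows "(\<integral>\<^sup>+x. f (x + (x $ n) *\<^sub>R axis m 1) \<partial>lborel) = (\<integral>\<^sup>+x. f x \<partial>lborel)"
proof -
  interpret product_sigma_finite "\<lambda>_::real^'m. lborel :: real measure" ..
  let ?a = "axis m 1 :: real^'m" and ?n = "axis n 1 :: real^'m"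
  let ?I = "Basis - {?a} :: (real^'m) set"
  have a: "?a \<in> Basis" and n: "?n \<in> Basis" "?n \<noteq> ?a"
    using mn by (auto simp: Basis_vec_real axis_eq_axis)
  have B: "Basis = insert ?a ?I" using a by auto
  let ?s = "\<lambda>\<phi>. \<Sum>b\<in>(Basis :: (real^'m) set). \<phi> b *\<^sub>R b"
  have int: "(\<integral>\<^sup>+x. g x \<partial>lborel) = (\<integral>\<^sup>+\<phi>. \<integral>\<^sup>+y. g (?s (\<phi>(?a := y))) \<partial>lborel \<partial>(\<Pi>\<^sub>M b\<in>?I. lborel))"
    if [measurable]: "g \<in> borel_measurable borel" for g :: "real^'m \<Rightarrow> ennreal"
  proof -
    have sm[measurable]: "?s \<in> (\<Pi>\<^sub>M b\<in>Basis. lborel) \<rightarrow>\<^sub>M borel" by measurable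
    have "(\<integral>\<^sup>+x. g x \<partial>lborel) = (\<integral>\<^sup>+\<phi>. g (?s \<phi>) \<partial>(\<Pi>\<^sub>M b\<in>Basis. lborel))"
      by (subst lborel_eq, subst nn_integral_distr) auto
    also have "\<dots> = (\<integral>\<^sup>+\<phi>. g (?s \<phi>) \<partial>(\<Pi>\<^sub>M b\<in>insert ?a ?I. lborel))" unfolding B[symmetric] ..
    also have "\<dots> = (\<integral>\<^sup>+\<phi>. \<integral>\<^sup>+y. g (?s (\<phi>(?a := y))) \<partial>lborel \<partial>(\<Pi>\<^sub>M b\<in>?I. lborel))"
      by (rule product_nn_integral_insert) (use sm in \<open>auto simp flip: B\<close>)
    finally show ?thesis .
  qed
  have shear: "?s (\<phi>(?a := y)) + (?s (\<phi>(?a := y)) $ n) *\<^sub>R ?a = ?s (\<phi>(?a := \<phi> ?n + 1 * y))" for \<phi> y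
  proof -
    have sa: "?s (\<phi>(?a := z)) = (\<Sum>b\<in>?I. \<phi> b *\<^sub>R b) + z *\<^sub>R ?a" for z
    proof -
      have "?s (\<phi>(?a := z)) = z *\<^sub>R ?a + (\<Sum>b\<in>?I. (\<phi>(?a := z)) b *\<^sub>R b)"
        by (subst sum.remove[OF finite_Basis a]) simp
      also have "(\<Sum>b\<in>?I. (\<phi>(?a := z)) b *\<^sub>R b) = (\<Sum>b\<in>?I. \<phi> b *\<^sub>R b)" by (intro sum.cong) auto
      finally show ?thesis by simp
    qed
    have "?s (\<phi>(?a := y)) $ n = ?s (\<phi>(?a := y)) \<bullet> ?n" by (simp add: inner_axis)
    also have "\<dots> = (\<phi>(?a := y)) ?n" by (rule inner_sum_left_Basis[OF n(1)])
    also have "\<dots> = \<phi> ?n" using n(2) by simp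
    finally show ?thesis by (simp only: sa) (simp add: algebra_simps)
  qed
  have "(\<integral>\<^sup>+x. f (x + (x $ n) *\<^sub>R ?a) \<partial>lborel)
      = (\<integral>\<^sup>+\<phi>. \<integral>\<^sup>+y. f (?s (\<phi>(?a := \<phi> ?n + 1 * y))) \<partial>lborel \<partial>(\<Pi>\<^sub>M b\<in>?I. lborel))"
    by (subst int) (simp_all only: shear, measurable)
  also have "\<dots> = (\<integral>\<^sup>+\<phi>. \<integral>\<^sup>+y. f (?s (\<phi>(?a := y))) \<partial>lborel \<partial>(\<Pi>\<^sub>M b\<in>?I. lborel))"
  proof (rule nn_integral_cong)
    fix \<phi> :: "real^'m \<Rightarrow> real"
    have "(\<lambda>y. ?s (\<phi>(?a := y))) \<in> borel_measurable borel"
      by (intro borel_measurable_sum borel_measurable_scaleR) (auto simp: fun_upd_def)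
    then have "(\<lambda>y. f (?s (\<phi>(?a := y)))) \<in> borel_measurable borel" by measurable
    from nn_integral_real_affine[OF this, of 1 "\<phi> ?n"]
    show "(\<integral>\<^sup>+y. f (?s (\<phi>(?a := \<phi> ?n + 1 * y))) \<partial>lborel) = (\<integral>\<^sup>+y. f (?s (\<phi>(?a := y))) \<partial>lborel)" by simp
  qed
  also have "\<dots> = (\<integral>\<^sup>+x. f x \<partial>lborel)" by (rule int[symmetric]) measurable
  finally show ?thesis .
qed

lemma lborel_coordinate_permutation:
  fixes p :: "'m::finite \<Rightarrow> 'm"
  assumes p: "bij p"
  shows "lborel = distr lborel borel (\<lambda>x :: real^'m. \<chi> i. x $ p i)"
proof (rule lborel_eqI)
  let ?T = "\<lambda>x :: real^'m. \<chi> i. x $ p i"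
  have [measurable]: "?T \<in> borel \<rightarrow>\<^sub>M borel"
    by (rule borel_measurable_vec_lambda) simp
  let ?q = "inv_into UNIV p"
  fix l u :: "real^'m" assume lu: "\<And>b. b \<in> Basis \<Longrightarrow> l \<bullet> b \<le> u \<bullet> b"
  have prod: "(\<Prod>b\<in>Basis. (u - l) \<bullet> b) = (\<Prod>i\<in>UNIV. u $ i - l $ i)" for l u :: "real^'m"
    unfolding Basis_vec_real by (subst prod.reindex) (auto simp: inj_on_def axis_eq_axis inner_axis)
  have vim: "?T -` box l u = box (\<chi> i. l $ ?q i) (\<chi> i. u $ ?q i)"
  proof (rule Set.set_eqI)
    fix x
    have "(\<forall>i. l $ i < x $ p i \<and> x $ p i < u $ i) \<longleftrightarrow> (\<forall>i. l $ ?q i < x $ i \<and> x $ i < u $ ?q i)"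
      using p by (metis bij_inv_eq_iff)
    then show "x \<in> ?T -` box l u \<longleftrightarrow> x \<in> box (\<chi> i. l $ ?q i) (\<chi> i. u $ ?q i)" by (simp add: mem_box_cart)
  qed
  have le: "l $ i \<le> u $ i" for i using lu[of "axis i 1"] by (simp add: Basis_vec_real inner_axis)
  have "emeasure (distr lborel borel ?T) (box l u) = emeasure lborel (box (\<chi> i. l $ ?q i) (\<chi> i. u $ ?q i))"
    by (simp add: emeasure_distr vim)
  also have "\<dots> = ennreal (\<Prod>b\<in>Basis. ((\<chi> i. u $ ?q i) - (\<chi> i. l $ ?q i)) \<bullet> b)"
    by (rule emeasure_lborel_box) (auto simp: Basis_vec_real inner_axis le)
  also have "(\<Prod>b\<in>Basis. ((\<chi> i. u $ ?q i) - (\<chi> i. l $ ?q i)) \<bullet> b) = (\<Prod>i\<in>UNIV. u $ ?q i - l $ ?q i)"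
    unfolding prod by simp
  also have "\<dots> = (\<Prod>i\<in>UNIV. u $ i - l $ i)"
    using p by (intro prod.reindex_bij_betw[of ?q UNIV UNIV "\<lambda>i. u $ i - l $ i"]) (rule bij_imp_bij_inv)
  finally show "emeasure (distr lborel borel ?T) (box l u) = ennreal (\<Prod>b\<in>Basis. (u - l) \<bullet> b)"
    unfolding prod .
qed simp

lemma measurable_matrix_vector_mult [measurable]: "(*v) (A :: real^'n^'m) \<in> borel \<rightarrow>\<^sub>M borel"
  by (rule borel_measurable_continuous_onI) (intro linear_continuous_on matrix_vector_mul_bounded_linear)

text \<open>The claim is multiplicative in \<open>A\<close>, so that elementary matrices suffice: diagonal matrices, transpositions of
  two coordinates and shears.\<close>

lemma nn_integral_linear_change:
  fixes A :: "real^'m^'m" and f :: "real^'m \<Rightarrow> ennreal"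
  assumes "det A \<noteq> 0" "f \<in> borel_measurable borel"
  shows "(\<integral>\<^sup>+x. f x \<partial>lborel) = ennreal \<bar>det A\<bar> * (\<integral>\<^sup>+x. f (A *v x) \<partial>lborel)"
proof -
  let ?P = "\<lambda>A :: real^'m^'m. det A \<noteq> 0 \<longrightarrow> (\<forall>f :: real^'m \<Rightarrow> ennreal. f \<in> borel_measurable borel \<longrightarrow>
      (\<integral>\<^sup>+x. f x \<partial>lborel) = ennreal \<bar>det A\<bar> * (\<integral>\<^sup>+x. f (A *v x) \<partial>lborel))"
  have "?P A"
  proof (rule induct_matrix_elementary_alt)
    fix A B :: "real^'m^'m" assume AB: "?P A" "?P B"
    show "?P (A ** B)"
    proof (intro impI allI)
      fix f :: "real^'m \<Rightarrow> ennreal" assume d: "det (A ** B) \<noteq> 0" and [measurable]: "f \<in> borel_measurable borel"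
      from d have d': "det A \<noteq> 0" "det B \<noteq> 0" unfolding det_mul mult_eq_0_iff de_Morgan_disj by iprover+
      have fA: "(\<lambda>x. f (A *v x)) \<in> borel_measurable borel" by measurable
      have "(\<integral>\<^sup>+x. f x \<partial>lborel) = ennreal \<bar>det A\<bar> * (\<integral>\<^sup>+x. f (A *v x) \<partial>lborel)"
        by (rule AB(1)[rule_format, OF d'(1)]) measurable
      also have "(\<integral>\<^sup>+x. f (A *v x) \<partial>lborel) = ennreal \<bar>det B\<bar> * (\<integral>\<^sup>+x. f (A *v (B *v x)) \<partial>lborel)"
        by (rule AB(2)[rule_format, OF d'(2) fA])
      finally show "(\<integral>\<^sup>+x. f x \<partial>lborel) = ennreal \<bar>det (A ** B)\<bar> * (\<integral>\<^sup>+x. f (A ** B *v x) \<partial>lborel)"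
        by (simp add: matrix_vector_mul_assoc[symmetric] det_mul abs_mult ennreal_mult mult.assoc)
    qed
  next
    fix A :: "real^'m^'m" and i assume "row i A = 0"
    then have "det A = 0" by (rule det_zero_row)
    then show "?P A" by simp
  next
    fix A :: "real^'m^'m" assume diag: "\<And>i j. i \<noteq> j \<Longrightarrow> A $ i $ j = 0"
    show "?P A"
    proof (intro impI allI)
      fix f :: "real^'m \<Rightarrow> ennreal" assume d: "det A \<noteq> 0" and [measurable]: "f \<in> borel_measurable borel"
      have det: "det A = (\<Prod>i\<in>UNIV. A $ i $ i)" by (rule det_diagonal[OF diag])
      define c where "c b = (A *v b) \<bullet> b" for b :: "real^'m"
      have c: "c (axis i 1) = A $ i $ i" for i by (simp add: c_def inner_axis matrix_vector_mul_component)
      have c0: "b \<in> Basis \<Longrightarrow> c b \<noteq> 0" for b using d by (auto simp: Basis_vec_real c det)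
      have pc: "(\<Prod>b\<in>Basis. \<bar>c b\<bar>) = \<bar>det A\<bar>"
        unfolding Basis_vec_real by (subst prod.reindex) (auto simp: inj_on_def axis_eq_axis c det abs_prod)
      have Ax: "(\<Sum>b\<in>Basis. (c b * (x \<bullet> b)) *\<^sub>R b) = A *v x" for x
      proof -
        have "(\<Sum>b\<in>Basis. (c b * (x \<bullet> b)) *\<^sub>R b) $ i = (A *v x) $ i" for i
        proof -
          have "(\<Sum>b\<in>Basis. (c b * (x \<bullet> b)) *\<^sub>R b) $ i = (\<Sum>b\<in>Basis. (c b * (x \<bullet> b)) *\<^sub>R b) \<bullet> axis i 1"
            by (simp add: inner_axis)
          also have "\<dots> = c (axis i 1) * (x \<bullet> axis i 1)"
            by (rule inner_sum_left_Basis) (simp add: Basis_vec_real)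
          also have "\<dots> = (\<Sum>j\<in>UNIV. if j = i then A $ i $ j * x $ j else 0)" by (simp add: c inner_axis)
          also have "\<dots> = (\<Sum>j\<in>UNIV. A $ i $ j * x $ j)" using diag by (intro sum.cong) auto
          finally show ?thesis by (simp add: matrix_vector_mult_def)
        qed
        then show ?thesis by (simp add: vec_eq_iff)
      qed
      have lb: "(lborel :: (real^'m) measure) = density (distr lborel borel ((*v) A)) (\<lambda>_. \<bar>det A\<bar>)"
        using lborel_affine_euclidean[of c 0, OF c0] by (simp add: Ax pc)
      have "(\<integral>\<^sup>+x. f x \<partial>lborel) = (\<integral>\<^sup>+x. f x \<partial>density (distr lborel borel ((*v) A)) (\<lambda>_. \<bar>det A\<bar>))"
        by (rule arg_cong[OF lb])
      also have "\<dots> = ennreal \<bar>det A\<bar> * (\<integral>\<^sup>+x. f (A *v x) \<partial>lborel)"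
        by (simp add: nn_integral_density nn_integral_cmult nn_integral_distr)
      finally show "(\<integral>\<^sup>+x. f x \<partial>lborel) = ennreal \<bar>det A\<bar> * (\<integral>\<^sup>+x. f (A *v x) \<partial>lborel)" .
    qed
  next
    fix m n :: 'm assume "m \<noteq> n"
    let ?t = "Transposition.transpose m n"
    let ?A = "(\<chi> i j. mat 1 $ i $ ?t j) :: real^'m^'m"
    have Ax: "?A *v x = (\<chi> i. x $ ?t i)" for x
    proof -
      have "(?A *v x) $ i = x $ ?t i" for i
      proof -
        have eq: "i = ?t j \<longleftrightarrow> j = ?t i" for j by (metis transpose_involutory)
        have "(?A *v x) $ i = (\<Sum>j\<in>UNIV. (if i = ?t j then 1 else 0) * x $ j)"
          unfolding matrix_vector_mult_def mat_def by simp
        also have "\<dots> = (\<Sum>j\<in>UNIV. if j = ?t i then x $ j else 0)"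
          unfolding eq by (rule sum.cong) auto
        finally have "(?A *v x) $ i = (\<Sum>j\<in>UNIV. if j = ?t i then x $ j else 0)" .
        then show ?thesis by simp
      qed
      then show ?thesis by (simp add: vec_eq_iff)
    qed
    have "det ?A = of_int (sign ?t) * det (mat 1 :: real^'m^'m)"
      by (rule det_permute_columns) (simp add: permutes_swap_id)
    then have det: "\<bar>det ?A\<bar> = 1" by (simp add: abs_mult sign_def)
    have inv: "(\<integral>\<^sup>+x. f x \<partial>lborel) = (\<integral>\<^sup>+x. f (?A *v x) \<partial>lborel)"
      if [measurable]: "f \<in> borel_measurable borel" for f :: "real^'m \<Rightarrow> ennreal"
    proof -
      have [measurable]: "(\<lambda>x :: real^'m. \<chi> i. x $ ?t i) \<in> borel \<rightarrow>\<^sub>M borel"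
        by (rule borel_measurable_vec_lambda) simp
      have "bij ?t" by simp
      then have "(\<integral>\<^sup>+x. f x \<partial>lborel) = (\<integral>\<^sup>+x. f x \<partial>distr lborel borel (\<lambda>x. \<chi> i. x $ ?t i))"
        by (rule arg_cong[OF lborel_coordinate_permutation])
      also have "\<dots> = (\<integral>\<^sup>+x. f (\<chi> i. x $ ?t i) \<partial>lborel)" by (rule nn_integral_distr) auto
      finally show ?thesis unfolding Ax .
    qed
    show "?P ?A" unfolding det ennreal_1 mult_1 by (intro impI allI inv)
  next
    fix m n :: 'm assume mn: "m \<noteq> n"
    let ?A = "(\<chi> i j. of_bool (i = m \<and> j = n \<or> i = j)) :: real^'m^'m"
    have Ax: "?A *v x = x + (x $ n) *\<^sub>R axis m 1" for x
    proof -
      have "(?A *v x) $ i = (x + (x $ n) *\<^sub>R axis m 1) $ i" for i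
      proof -
        have "(?A *v x) $ i = (\<Sum>j\<in>UNIV. (if j = i then x $ j else 0) + (if j = n then (if i = m then x $ j else 0) else 0))"
          unfolding matrix_vector_mult_def using mn by (auto intro!: sum.cong)
        then show ?thesis by (simp add: sum.distrib axis_def)
      qed
      then show ?thesis by (simp add: vec_eq_iff)
    qed
    have eq: "?A = (\<chi> k. if k = m then row m (mat 1) + 1 *s row n (mat 1) else row k (mat 1))"
      using mn by (auto simp: vec_eq_iff row_def mat_def)
    have det: "\<bar>det ?A\<bar> = 1" unfolding eq det_row_operation[OF mn] by simp
    show "?P ?A" unfolding det ennreal_1 mult_1 Ax
      by (intro impI allI nn_integral_shear[symmetric] mn)
  qed
  then show ?thesis using assms by blast
qed

lemma lborel_linear_change:
  fixes A :: "real^'m^'m"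
  assumes "det A \<noteq> 0"
  shows "lborel = density (distr lborel borel ((*v) A)) (\<lambda>_. ennreal \<bar>det A\<bar>)"
proof (rule measure_eqI)
  fix X :: "(real^'m) set" assume "X \<in> sets lborel"
  then have [measurable]: "X \<in> sets borel" by simp
  have "emeasure lborel X = (\<integral>\<^sup>+x. indicator X x \<partial>lborel)" by simp
  also have "\<dots> = ennreal \<bar>det A\<bar> * (\<integral>\<^sup>+x. indicator X (A *v x) \<partial>lborel)"
    by (rule nn_integral_linear_change[OF assms]) simp
  also have "(\<integral>\<^sup>+x. indicator X (A *v x) \<partial>lborel) = (\<integral>\<^sup>+x. indicator X x \<partial>distr lborel borel ((*v) A))"
    by (rule nn_integral_distr[symmetric]) auto
  also have "ennreal \<bar>det A\<bar> * \<dots> = emeasure (density (distr lborel borel ((*v) A)) (\<lambda>_. ennreal \<bar>det A\<bar>)) X"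
    by (simp add: emeasure_density nn_integral_cmult)
  finally show "emeasure lborel X = emeasure (density (distr lborel borel ((*v) A)) (\<lambda>_. ennreal \<bar>det A\<bar>)) X" .
qed simp

lemma integral_linear_change:
  fixes A :: "real^'m^'m" and f :: "real^'m \<Rightarrow> complex"
  assumes "det A \<noteq> 0" and [measurable]: "f \<in> borel_measurable borel"
  shows "(LINT x|lborel. f x) = complex_of_real \<bar>det A\<bar> * (LINT x|lborel. f (A *v x))"
proof -
  have "(LINT x|lborel. f x) = (LINT x|density (distr lborel borel ((*v) A)) (\<lambda>_. ennreal \<bar>det A\<bar>). f x)"
    by (rule arg_cong[OF lborel_linear_change[OF assms(1)]])
  also have "\<dots> = (LINT x|lborel. \<bar>det A\<bar> *\<^sub>R f (A *v x))"
    by (subst integral_density) (auto simp: integral_distr)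
  finally show ?thesis by (simp add: scaleR_conv_of_real)
qed

section \<open>Parseval's identity over a lattice\<close>

lemma infsum_ennreal_cmult: "(\<Sum>\<^sub>\<infinity>x\<in>A. c * f x) = c * (\<Sum>\<^sub>\<infinity>x\<in>A. f x :: ennreal)"
proof -
  have "(\<Sum>\<^sub>\<infinity>x\<in>A. c * f x) = (SUP F\<in>{F. finite F \<and> F \<subseteq> A}. c * sum f F)"
    by (subst nonneg_infsum_complete) (simp_all add: sum_distrib_left)
  also have "\<dots> = c * (SUP F\<in>{F. finite F \<and> F \<subseteq> A}. sum f F)" by (rule SUP_mult_left_ennreal[symmetric])
  also have "\<dots> = c * (\<Sum>\<^sub>\<infinity>x\<in>A. f x)" by (subst nonneg_infsum_complete[of A f]) auto
  finally show ?thesis .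
qed

lemma finite_bounded_int_vectors: "finite {v \<in> (int_vectors :: (real^'m) set). \<forall>i. \<bar>v $ i\<bar> \<le> R}"
proof (rule finite_subset)
  let ?Z = "real_of_int ` {- \<lceil>R\<rceil>..\<lceil>R\<rceil>}"
  show "{v \<in> (int_vectors :: (real^'m) set). \<forall>i. \<bar>v $ i\<bar> \<le> R} \<subseteq> vec_lambda ` (PiE UNIV (\<lambda>_. ?Z))"
  proof
    fix v :: "real^'m" assume v: "v \<in> {v \<in> int_vectors. \<forall>i. \<bar>v $ i\<bar> \<le> R}"
    have "v $ i \<in> ?Z" for i
    proof -
      from v have "v $ i \<in> \<int>" by (simp add: int_vectors_def)
      then obtain z where z: "v $ i = real_of_int z" by (rule Ints_cases)
      have "\<bar>v $ i\<bar> \<le> R" using v by blast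
      then have "\<bar>real_of_int z\<bar> \<le> real_of_int \<lceil>R\<rceil>" unfolding z by linarith
      then show ?thesis unfolding z by (intro imageI) (simp add: abs_le_iff)
    qed
    then have "(\<lambda>i. v $ i) \<in> PiE UNIV (\<lambda>_. ?Z)" by auto
    then show "v \<in> vec_lambda ` (PiE UNIV (\<lambda>_. ?Z))" by (rule image_eqI[rotated]) simp
  qed
  show "finite (vec_lambda ` (PiE (UNIV :: 'm set) (\<lambda>_. ?Z)))" by (intro finite_imageI finite_PiE) auto
qed

lemma unit_cube_translate_unique:
  assumes "v \<in> int_vectors" "w \<in> int_vectors" "x - v \<in> unit_cube" "x - w \<in> unit_cube" shows "v = w"
proof -
  have "v $ i = w $ i" for i
  proof -
    obtain a b where ab: "v $ i = real_of_int a" "w $ i = real_of_int b"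
      using assms(1,2) by (auto simp: int_vectors_def elim!: Ints_cases allE[of _ i])
    have "0 \<le> x $ i - v $ i" "x $ i - v $ i < 1" "0 \<le> x $ i - w $ i" "x $ i - w $ i < 1"
      using assms(3,4) by (auto simp: unit_cube_def)
    then have "a = b" unfolding ab by linarith
    then show ?thesis by (simp add: ab)
  qed
  then show ?thesis by (simp add: vec_eq_iff)
qed

text \<open>Integer translates of the half-open cube partition the space, and a bounded set meets finitely many.\<close>

lemma bounded_covered_by_cube_translates:
  fixes K :: "(real^'m) set"
  assumes "bounded K"
  shows "\<exists>V. finite V \<and> V \<subseteq> int_vectors \<and> (\<forall>x\<in>K. (\<Sum>v\<in>V. indicator unit_cube (x - v)) = (1 :: real))"
proof -
  obtain R where R: "\<And>x. x \<in> K \<Longrightarrow> norm x \<le> R" using assms by (auto simp: bounded_iff)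
  let ?V = "{v \<in> int_vectors. \<forall>i. \<bar>v $ i\<bar> \<le> R + 1} :: (real^'m) set"
  have fin: "finite ?V" by (rule finite_bounded_int_vectors)
  show ?thesis
  proof (intro exI[of _ ?V] conjI fin ballI)
    fix x assume x: "x \<in> K"
    define w :: "real^'m" where "w = (\<chi> i. real_of_int \<lfloor>x $ i\<rfloor>)"
    have xi: "\<bar>x $ i\<bar> \<le> R" for i using component_le_norm_cart[of x i] R[OF x] by simp
    have w: "w \<in> ?V"
    proof -
      have "\<bar>w $ i\<bar> \<le> R + 1" for i using xi[of i] by (simp add: w_def abs_le_iff) linarith
      then show ?thesis by (auto simp: int_vectors_def w_def)
    qed
    have xw: "x - w \<in> unit_cube" by (auto simp: unit_cube_def w_def) linarith
    have "indicator unit_cube (x - v) = (if v = w then 1 else 0 :: real)" if "v \<in> ?V" for v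
    proof (cases "v = w")
      case False
      then have "x - v \<notin> unit_cube" using unit_cube_translate_unique[of v w x] that w xw by blast
      then show ?thesis using False by simp
    qed (use xw in simp)
    then have "(\<Sum>v\<in>?V. indicator unit_cube (x - v)) = (\<Sum>v\<in>?V. if v = w then 1 else 0 :: real)"
      by (intro sum.cong refl)
    also have "\<dots> = 1" using fin w by simp
    finally show "(\<Sum>v\<in>?V. indicator unit_cube (x - v)) = (1 :: real)" .
  qed auto
qed

lemma norm_sum_squared_disjoint:
  fixes f :: "'a \<Rightarrow> complex"
  assumes "finite V" "\<And>v w. v \<in> V \<Longrightarrow> w \<in> V \<Longrightarrow> v \<noteq> w \<Longrightarrow> f v = 0 \<or> f w = 0"
  shows "(cmod (\<Sum>v\<in>V. f v))\<^sup>2 = (\<Sum>v\<in>V. (cmod (f v))\<^sup>2)"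
proof (cases "\<exists>v\<in>V. f v \<noteq> 0")
  case True
  then obtain v where v: "v \<in> V" "f v \<noteq> 0" by blast
  have z: "f w = 0" if "w \<in> V - {v}" for w using assms(2)[of v w] v that by auto
  have "(\<Sum>v\<in>V. f v) = f v" by (subst sum.remove[OF assms(1) v(1)]) (simp add: z)
  moreover have "(\<Sum>v\<in>V. (cmod (f v))\<^sup>2) = (cmod (f v))\<^sup>2" by (subst sum.remove[OF assms(1) v(1)]) (simp add: z)
  ultimately show ?thesis by simp
qed simp

lemma AE_lborel_not_in_negligible:
  fixes S :: "'a::euclidean_space set"
  assumes "negligible S" "closed S" shows "AE x in lborel. x \<notin> S"
proof (rule AE_I')
  have "S \<in> sets borel" using assms(2) by simp
  then show "S \<in> null_sets lborel"
    using assms(1) by (simp add: negligible_iff_null_sets null_sets_def)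
qed auto

text \<open>The translates of the support by lattice vectors overlap in null sets, so summing a function
  over the lattice folds it into the unit cube without changing its norm or its coefficients.\<close>

lemma Parseval_packing:
  fixes F :: "real^'m \<Rightarrow> complex"
  assumes F[measurable]: "F \<in> borel_measurable borel" and K: "compact K" "\<And>x. x \<notin> K \<Longrightarrow> F x = 0"
    and pack: "\<And>v w. v \<in> int_vectors \<Longrightarrow> w \<in> int_vectors \<Longrightarrow> v \<noteq> w \<Longrightarrow> negligible ((+) v ` K \<inter> (+) w ` K)"
    and fin: "L2_normsq lborel F < \<infinity>"
  shows "(\<Sum>\<^sub>\<infinity>k\<in>int_vectors. ennreal ((cmod (LINT x|lborel. F x * torus_char (- k) x))\<^sup>2)) = L2_normsq lborel F"
proof -
  obtain V where V: "finite V" "V \<subseteq> int_vectors" "\<And>x. x \<in> K \<Longrightarrow> (\<Sum>v\<in>V. indicator unit_cube (x - v)) = (1 :: real)"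
    using bounded_covered_by_cube_translates[OF compact_imp_bounded[OF K(1)]] by auto
  \<comment> \<open>Only the finitely many cubes that meet the support contribute to the folded
    function.\<close>
  define f where "f x = (\<Sum>v\<in>V. F (x + v))" for x
  have fm[measurable]: "f \<in> borel_measurable borel" unfolding f_def by measurable
  have disj: "AE x in lborel. \<forall>v\<in>V. \<forall>w\<in>V. v \<noteq> w \<longrightarrow> F (x + v) = 0 \<or> F (x + w) = 0"
  proof -
    have "AE x in lborel. F (x + v) = 0 \<or> F (x + w) = 0" if vw: "v \<in> V" "w \<in> V" "v \<noteq> w" for v w
    proof -
      let ?S = "(+) (- v) ` K \<inter> (+) (- w) ` K"
      have "negligible ?S" using pack[of "- v" "- w"] vw V(2) by (auto intro: int_vectors_minus)
      moreover have "closed ?S" by (intro closed_Int compact_imp_closed compact_translation K)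
      ultimately have "AE x in lborel. x \<notin> ?S" by (rule AE_lborel_not_in_negligible)
      then show ?thesis
      proof eventually_elim
        case (elim x)
        have "x \<in> (+) (- u) ` K" if "x + u \<in> K" for u using that by (intro image_eqI[of _ _ "x + u"]) auto
        then have "x + v \<notin> K \<or> x + w \<notin> K" using elim by blast
        then show ?case using K(2) by auto
      qed
    qed
    then show ?thesis using V(1) by (intro AE_finite_allI) auto
  qed
  have shift: "(\<integral>\<^sup>+x. g (x + v) \<partial>lborel) = (\<integral>\<^sup>+x. g x \<partial>lborel)"
    if [measurable]: "g \<in> borel_measurable borel" for g :: "real^'m \<Rightarrow> ennreal" and v
    using nn_integral_distr[of "(+) v" lborel borel g] lborel_distr_plus[of v] by (simp add: add.commute)
  have shiftc: "(LINT x|lborel. g (x + v)) = (LINT x|lborel. g x)"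
    if [measurable]: "g \<in> borel_measurable borel" for g :: "real^'m \<Rightarrow> complex" and v
    using integral_distr[of "(+) v" lborel borel g] lborel_distr_plus[of v] by (simp add: add.commute)
  have one: "(\<Sum>v\<in>V. indicator unit_cube (x - v) * g x) = g x" if "x \<notin> K \<Longrightarrow> g x = 0" for x and g :: "real^'m \<Rightarrow> ennreal"
  proof (cases "x \<in> K")
    case True
    have "(\<Sum>v\<in>V. indicator unit_cube (x - v) :: ennreal) = (\<Sum>v\<in>V. ennreal (indicator unit_cube (x - v)))"
      by (intro sum.cong) (auto simp: indicator_def)
    also have "\<dots> = ennreal (\<Sum>v\<in>V. indicator unit_cube (x - v))" by (rule sum_ennreal) auto
    also have "\<dots> = 1" by (simp add: V(3)[OF True])
    finally show ?thesis by (simp add: sum_distrib_right[symmetric])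
  qed (use that in auto)
  have onec: "(\<Sum>v\<in>V. indicator unit_cube (x - v) * F x * c) = F x * c" for x c
  proof (cases "x \<in> K")
    case True
    have "(\<Sum>v\<in>V. indicator unit_cube (x - v) :: complex) = (\<Sum>v\<in>V. complex_of_real (indicator unit_cube (x - v)))"
      by (intro sum.cong) (auto simp: indicator_def)
    also have "\<dots> = complex_of_real (\<Sum>v\<in>V. indicator unit_cube (x - v))" by simp
    also have "\<dots> = 1" by (simp add: V(3)[OF True])
    finally show ?thesis by (simp add: sum_distrib_right[symmetric])
  qed (use K(2) in auto)
  have norm_f: "L2_normsq cube_measure f = L2_normsq lborel F"
  proof -
    have "L2_normsq cube_measure f = (\<integral>\<^sup>+x. ennreal ((cmod (f x))\<^sup>2) * indicator unit_cube x \<partial>lborel)"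
      unfolding L2_normsq_def by (rule nn_integral_restrict_space) simp
    also have "\<dots> = (\<integral>\<^sup>+x. (\<Sum>v\<in>V. indicator unit_cube ((x + v) - v) * ennreal ((cmod (F (x + v)))\<^sup>2)) \<partial>lborel)"
    proof (rule nn_integral_cong_AE)
      show "AE x in lborel. ennreal ((cmod (f x))\<^sup>2) * indicator unit_cube x =
          (\<Sum>v\<in>V. indicator unit_cube ((x + v) - v) * ennreal ((cmod (F (x + v)))\<^sup>2))"
        using disj
      proof eventually_elim
        case (elim x)
        have "(cmod (f x))\<^sup>2 = (\<Sum>v\<in>V. (cmod (F (x + v)))\<^sup>2)"
          unfolding f_def using elim V(1) by (intro norm_sum_squared_disjoint) auto
        then have "ennreal ((cmod (f x))\<^sup>2) = (\<Sum>v\<in>V. ennreal ((cmod (F (x + v)))\<^sup>2))" by (simp add: sum_ennreal)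
        then show ?case by (simp add: sum_distrib_left[symmetric] mult.commute)
      qed
    qed
    also have "\<dots> = (\<Sum>v\<in>V. \<integral>\<^sup>+x. indicator unit_cube ((x + v) - v) * ennreal ((cmod (F (x + v)))\<^sup>2) \<partial>lborel)"
      by (rule nn_integral_sum) measurable
    also have "\<dots> = (\<Sum>v\<in>V. \<integral>\<^sup>+x. indicator unit_cube (x - v) * ennreal ((cmod (F x))\<^sup>2) \<partial>lborel)"
      by (intro sum.cong refl shift) measurable
    also have "\<dots> = (\<integral>\<^sup>+x. (\<Sum>v\<in>V. indicator unit_cube (x - v) * ennreal ((cmod (F x))\<^sup>2)) \<partial>lborel)"
      by (rule nn_integral_sum[symmetric]) measurable
    also have "\<dots> = L2_normsq lborel F"
      unfolding L2_normsq_def by (intro nn_integral_cong one) (use K(2) in auto)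
    finally show ?thesis .
  qed
  have intF: "integrable lborel F"
  proof -
    have [measurable]: "K \<in> sets borel" by (rule borel_compact[OF K(1)])
    have "(\<integral>\<^sup>+x. ennreal (norm (F x)) \<partial>lborel) \<le> (\<integral>\<^sup>+x. indicator K x + ennreal ((cmod (F x))\<^sup>2) \<partial>lborel)"
    proof (rule nn_integral_mono)
      fix x
      have "cmod (F x) \<le> indicator K x + (cmod (F x))\<^sup>2"
      proof (cases "x \<in> K")
        case True
        then show ?thesis
          using zero_le_power2[of "cmod (F x) - 1/2"] by (simp add: power2_eq_square algebra_simps)
      qed (use K(2) in simp)
      then have "ennreal (norm (F x)) \<le> ennreal (indicator K x + (cmod (F x))\<^sup>2)" by (rule ennreal_leI)
      also have "\<dots> = indicator K x + ennreal ((cmod (F x))\<^sup>2)" by (subst ennreal_plus) (auto simp: indicator_def)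
      finally show "ennreal (norm (F x)) \<le> indicator K x + ennreal ((cmod (F x))\<^sup>2)" .
    qed
    also have "\<dots> = emeasure lborel K + L2_normsq lborel F"
      by (subst nn_integral_add) (auto simp: L2_normsq_def)
    also have "\<dots> < \<infinity>" using fin emeasure_compact_finite[OF K(1)] by simp
    finally show ?thesis by (intro integrableI_bounded) auto
  qed
  have coeff: "(LINT x|cube_measure. f x * torus_char (- k) x) = (LINT x|lborel. F x * torus_char (- k) x)"
    if k: "k \<in> int_vectors" for k
  proof -
    let ?g = "\<lambda>v x. indicator unit_cube (x - v) * F x * torus_char (- k) x"
    have int: "integrable lborel (?g v)" for v
      by (rule Bochner_Integration.integrable_bound[OF intF]) (auto simp: norm_mult indicator_def)
    have ints: "integrable lborel (\<lambda>x. ?g v (x + v))" for v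
    proof -
      have "integrable (distr lborel borel ((+) v)) (?g v)" using int lborel_distr_plus[of v] by simp
      then have "integrable lborel (\<lambda>x. ?g v (v + x))" by (subst (asm) integrable_distr_eq) auto
      then show ?thesis by (simp only: add.commute)
    qed
    have "(LINT x|cube_measure. f x * torus_char (- k) x) = (LINT x|lborel. indicator unit_cube x *\<^sub>R (f x * torus_char (- k) x))"
      by (rule integral_restrict_space) simp
    also have "\<dots> = (LINT x|lborel. (\<Sum>v\<in>V. ?g v (x + v)))"
    proof (rule Bochner_Integration.integral_cong[OF refl])
      fix x
      have "torus_char (- k) (x + v) = torus_char (- k) x" if "v \<in> V" for v
        using that V(2) by (intro torus_char_periodic int_vectors_minus k) auto
      then have "(\<Sum>v\<in>V. ?g v (x + v)) = (\<Sum>v\<in>V. indicator unit_cube x * F (x + v) * torus_char (- k) x)"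
        by (intro sum.cong) auto
      then show "indicator unit_cube x *\<^sub>R (f x * torus_char (- k) x) = (\<Sum>v\<in>V. ?g v (x + v))"
        by (simp add: f_def indicator_def sum_distrib_right)
    qed
    also have "\<dots> = (\<Sum>v\<in>V. LINT x|lborel. ?g v (x + v))"
      by (rule Bochner_Integration.integral_sum[OF ints])
    also have "\<dots> = (\<Sum>v\<in>V. LINT x|lborel. ?g v x)"
      by (intro sum.cong refl shiftc) measurable
    also have "\<dots> = (LINT x|lborel. (\<Sum>v\<in>V. ?g v x))"
      by (rule Bochner_Integration.integral_sum[symmetric, OF int])
    also have "\<dots> = (LINT x|lborel. F x * torus_char (- k) x)" unfolding onec ..
    finally show ?thesis .
  qed
  have "f \<in> L2_space cube_measure"
    using fin norm_f by (simp add: L2_space_def measurable_restrict_space1)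
  from Parseval_cube[OF this] show ?thesis
    unfolding norm_f by (simp add: coeff cong: infsum_cong)
qed

lemma matrix_inv_mult:
  fixes L :: "real^'m^'m"
  assumes "invertible L"
  shows "L ** matrix_inv L = mat 1" "matrix_inv L ** L = mat 1"
  using someI_ex[OF assms[unfolded invertible_def]] unfolding matrix_inv_def by auto

text \<open>The inverse transpose generates the dual lattice: its pairings with the original lattice are the integer
  pairings.\<close>

lemma transpose_matrix_inv_inner:
  fixes L :: "real^'m^'m"
  assumes "invertible L"
  shows "(L *v k) \<bullet> (transpose (matrix_inv L) *v x) = k \<bullet> x"
proof -
  have "transpose L ** transpose (matrix_inv L) = mat 1"
    using matrix_inv_mult(2)[OF assms] by (simp add: matrix_transpose_mul[symmetric] transpose_mat)
  then have "transpose L *v (transpose (matrix_inv L) *v x) = x"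
    by (simp only: matrix_vector_mul_assoc matrix_vector_mul_lid)
  then show ?thesis using dot_lmul_matrix[of k "transpose L" "transpose (matrix_inv L) *v x"]
    unfolding vector_transpose_matrix by simp
qed

text \<open>The substitution \<open>x = T y\<close> turns the lattice into the integer vectors. Each coefficient acquires a factor
  \<open>|det T|\<close>, hence its square two of them, one of which is absorbed into the norm of \<open>F\<close>.\<close>

theorem Parseval_lattice:
  fixes F :: "real^'m \<Rightarrow> complex" and L :: "real^'m^'m"
  defines "T \<equiv> transpose (matrix_inv L)"
  assumes L: "invertible L"
    and F[measurable]: "F \<in> borel_measurable borel" and K: "compact K" "\<And>x. x \<notin> K \<Longrightarrow> F x = 0"
    and pack: "\<And>v w. v \<in> (*v) T ` int_vectors \<Longrightarrow> w \<in> (*v) T ` int_vectors \<Longrightarrow> v \<noteq> w \<Longrightarrow>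
        negligible ((+) v ` K \<inter> (+) w ` K)"
    and fin: "L2_normsq lborel F < \<infinity>"
  shows "(\<Sum>\<^sub>\<infinity>k\<in>int_vectors. ennreal ((cmod (LINT x|lborel. F x * cis (- 2 * pi * ((L *v k) \<bullet> x))))\<^sup>2))
    = ennreal \<bar>det T\<bar> * L2_normsq lborel F"
proof -
  have TL: "T ** transpose L = mat 1" "transpose L ** T = mat 1"
    unfolding T_def using matrix_inv_mult[OF L]
    by (simp_all add: matrix_transpose_mul[symmetric] transpose_mat)
  then have invT: "invertible T" unfolding invertible_def by blast
  have det: "det T \<noteq> 0" using invT by (simp add: invertible_det_nz)
  have T1: "transpose L *v (T *v x) = x" "T *v (transpose L *v x) = x" for x
    using TL by (simp_all only: matrix_vector_mul_assoc matrix_vector_mul_lid)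
  define G where "G x = F (T *v x)" for x
  define K' where "K' = (*v) (transpose L) ` K"
  have [measurable]: "G \<in> borel_measurable borel" unfolding G_def by measurable
  have normF: "L2_normsq lborel F = ennreal \<bar>det T\<bar> * L2_normsq lborel G"
    unfolding L2_normsq_def G_def by (rule nn_integral_linear_change[OF det]) measurable
  have "(\<Sum>\<^sub>\<infinity>k\<in>int_vectors. ennreal ((cmod (LINT x|lborel. G x * torus_char (- k) x))\<^sup>2)) = L2_normsq lborel G"
  proof (rule Parseval_packing)
    show "compact K'" unfolding K'_def
      by (intro compact_continuous_image K linear_continuous_on matrix_vector_mul_bounded_linear)
    show "G x = 0" if "x \<notin> K'" for x
    proof -
      have "T *v x \<notin> K" using that T1(1)[of x] unfolding K'_def by (metis image_eqI)
      then show ?thesis unfolding G_def by (rule K(2))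
    qed
    show "negligible ((+) v ` K' \<inter> (+) w ` K')" if vw: "v \<in> int_vectors" "w \<in> int_vectors" "v \<noteq> w" for v w
    proof (rule negligible_subset)
      have "T *v v \<noteq> T *v w" using vw(3) T1(1) by metis
      then have "negligible ((+) (T *v v) ` K \<inter> (+) (T *v w) ` K)" using vw by (intro pack) auto
      then show "negligible ((*v) (transpose L) ` ((+) (T *v v) ` K \<inter> (+) (T *v w) ` K))"
        by (rule negligible_differentiable_image_negligible[OF order_refl])
          (intro linear_imp_differentiable_on matrix_vector_mul_linear)
      have sub: "T *v x \<in> (+) (T *v u) ` K" if x: "x \<in> (+) u ` K'" for x u
      proof -
        obtain y where "y \<in> K" "x = u + transpose L *v y" using x unfolding K'_def by blast
        then show ?thesis by (intro image_eqI[of _ _ y]) (simp_all only: matrix_vector_right_distrib T1)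
      qed
      show "(+) v ` K' \<inter> (+) w ` K' \<subseteq> (*v) (transpose L) ` ((+) (T *v v) ` K \<inter> (+) (T *v w) ` K)"
      proof
        fix x assume "x \<in> (+) v ` K' \<inter> (+) w ` K'"
        then have "T *v x \<in> (+) (T *v v) ` K \<inter> (+) (T *v w) ` K" using sub by (meson IntD1 IntD2 IntI)
        then show "x \<in> (*v) (transpose L) ` ((+) (T *v v) ` K \<inter> (+) (T *v w) ` K)"
          by (intro image_eqI[where x = "T *v x"] T1(1)[symmetric])
      qed
    qed
    show "L2_normsq lborel G < \<infinity>"
      using fin det unfolding normF by (auto simp: ennreal_mult_less_top less_top[symmetric] ennreal_mult_eq_top_iff)
  qed measurable
  moreover have "ennreal ((cmod (LINT x|lborel. F x * cis (- 2 * pi * ((L *v k) \<bullet> x))))\<^sup>2)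
      = ennreal (\<bar>det T\<bar>\<^sup>2) * ennreal ((cmod (LINT x|lborel. G x * torus_char (- k) x))\<^sup>2)" for k
  proof -
    have [measurable]: "cis \<in> borel_measurable borel"
      by (rule borel_measurable_continuous_onI) (intro continuous_intros)
    have "(LINT x|lborel. F x * cis (- 2 * pi * ((L *v k) \<bullet> x)))
       = complex_of_real \<bar>det T\<bar> * (LINT x|lborel. F (T *v x) * cis (- 2 * pi * ((L *v k) \<bullet> (T *v x))))"
      by (rule integral_linear_change[OF det]) measurable
    also have "\<dots> = complex_of_real \<bar>det T\<bar> * (LINT x|lborel. G x * torus_char (- k) x)"
      unfolding T_def transpose_matrix_inv_inner[OF L] by (simp add: G_def T_def torus_char_def)
    finally show ?thesis by (simp add: norm_mult power_mult_distrib ennreal_mult)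
  qed
  ultimately have "(\<Sum>\<^sub>\<infinity>k\<in>int_vectors. ennreal ((cmod (LINT x|lborel. F x * cis (- 2 * pi * ((L *v k) \<bullet> x))))\<^sup>2))
      = ennreal (\<bar>det T\<bar>\<^sup>2) * L2_normsq lborel G"
    by (simp add: infsum_ennreal_cmult)
  moreover have "ennreal (\<bar>det T\<bar>\<^sup>2) = ennreal \<bar>det T\<bar> * ennreal \<bar>det T\<bar>"
    unfolding power2_eq_square by (rule ennreal_mult) auto
  ultimately show ?thesis unfolding normF by (simp only: mult.assoc)
qed

section \<open>Haar measure on a closed subgroup\<close>

text \<open>Sums over countable sets as integrals against counting measure; their interchange with each other
  and with integrals is then a case of Tonelli's theorem.\<close>

lemma infsum_ennreal_eq_nn_integral:
  fixes f :: "'a \<Rightarrow> ennreal"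
  assumes "countable A"
  shows "infsum f A = (\<integral>\<^sup>+x. f x \<partial>count_space A)"
proof (cases "finite A")
  case True
  then show ?thesis by (simp add: nn_integral_count_space_finite)
next
  case False
  have bij: "bij_betw (from_nat_into A) UNIV A" by (rule bij_betw_from_nat_into[OF assms False])
  have "infsum f A = infsum (\<lambda>i. f (from_nat_into A i)) UNIV"
    by (rule infsum_reindex_bij_betw[OF bij, symmetric])
  also have "\<dots> = (\<Sum>i. f (from_nat_into A i))"
    by (rule sums_unique[OF has_sum_imp_sums[OF has_sum_infsum[OF nonneg_summable_on_complete]]]) simp
  also have "\<dots> = (\<integral>\<^sup>+i. f (from_nat_into A i) \<partial>count_space UNIV)" by (rule nn_integral_count_space_nat[symmetric])
  also have "\<dots> = (\<integral>\<^sup>+x. f x \<partial>count_space A)" by (rule nn_integral_bij_count_space[OF bij])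
  finally show ?thesis .
qed

lemma infsum_ennreal_Times:
  fixes f :: "'a \<Rightarrow> 'b \<Rightarrow> ennreal"
  assumes "countable A" "countable B"
  shows "(\<Sum>\<^sub>\<infinity>p\<in>A \<times> B. f (fst p) (snd p)) = (\<Sum>\<^sub>\<infinity>x\<in>A. \<Sum>\<^sub>\<infinity>y\<in>B. f x y)"
proof -
  let ?f = "\<lambda>p. f (fst p) (snd p) * indicator (A \<times> B) p"
  have "(\<Sum>\<^sub>\<infinity>p\<in>A \<times> B. f (fst p) (snd p)) = (\<integral>\<^sup>+p. ?f p \<partial>count_space UNIV)"
    unfolding infsum_ennreal_eq_nn_integral[OF countable_SIGMA[OF assms]]
    by (rule nn_integral_count_space_indicator) simp
  also have "\<dots> = (\<integral>\<^sup>+x. \<integral>\<^sup>+y. ?f (x, y) \<partial>count_space UNIV \<partial>count_space UNIV)"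
    by (rule nn_integral_fst_count_space[symmetric])
  also have "\<dots> = (\<integral>\<^sup>+x. (\<integral>\<^sup>+y. f x y * indicator B y \<partial>count_space UNIV) * indicator A x \<partial>count_space UNIV)"
    by (intro nn_integral_cong) (auto simp: indicator_def)
  also have "\<dots> = (\<Sum>\<^sub>\<infinity>x\<in>A. \<Sum>\<^sub>\<infinity>y\<in>B. f x y)"
    unfolding infsum_ennreal_eq_nn_integral[OF assms(1)] infsum_ennreal_eq_nn_integral[OF assms(2)]
    by (simp add: nn_integral_count_space_indicator)
  finally show ?thesis .
qed

lemma nn_integral_infsum:
  fixes f :: "'i \<Rightarrow> 'a \<Rightarrow> ennreal"
  assumes "countable I" "\<And>i. i \<in> I \<Longrightarrow> f i \<in> borel_measurable M"
  shows "(\<integral>\<^sup>+x. (\<Sum>\<^sub>\<infinity>i\<in>I. f i x) \<partial>M) = (\<Sum>\<^sub>\<infinity>i\<in>I. \<integral>\<^sup>+x. f i x \<partial>M)"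
  unfolding infsum_ennreal_eq_nn_integral[OF assms(1)]
  by (rule nn_integral_count_space_nn_integral[OF assms])

locale closed_haar_subgroup = group G
  for G :: "'G::{t2_space,second_countable_topology} monoid" (structure) +
  fixes M :: "'G set" and \<mu> :: "'G measure"
  assumes carrier: "carrier G = UNIV"
    and continuous_mult: "continuous_on UNIV (\<lambda>(x, y). x \<otimes> y)"
    and continuous_inv: "continuous_on UNIV (\<lambda>x. inv x)"
    and subgroup: "subgroup M G" and closed: "closed M" and haar: "left_haar_measure G M \<mu>"
begin

lemma in_carrier [simp]: "x \<in> carrier G"
  by (simp add: carrier)

lemma continuous_on_gmult:
  "continuous_on S f \<Longrightarrow> continuous_on S g \<Longrightarrow> continuous_on S (\<lambda>x. f x \<otimes> g x)"
  using continuous_on_compose2[OF continuous_mult, of S "\<lambda>x. (f x, g x)"] by (auto intro: continuous_on_Pair)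

lemma continuous_on_ginv: "continuous_on S f \<Longrightarrow> continuous_on S (\<lambda>x. inv (f x))"
  using continuous_on_compose2[OF continuous_inv, of S f] by auto

lemma M_mult: "x \<in> M \<Longrightarrow> y \<in> M \<Longrightarrow> x \<otimes> y \<in> M" and M_inv: "x \<in> M \<Longrightarrow> inv x \<in> M" and M_one: "\<one> \<in> M"
  using subgroup by (auto intro: subgroup.m_closed subgroup.m_inv_closed subgroup.one_closed)

lemma inv_mult_cancel: "inv x \<otimes> (x \<otimes> y) = y" and mult_inv_cancel: "x \<otimes> (inv x \<otimes> y) = y"
  by (simp_all add: m_assoc[symmetric])

lemma open_translate: "open W \<Longrightarrow> open ((\<lambda>y. x \<otimes> y) -` W)"
  by (intro open_vimage continuous_on_gmult continuous_intros)

lemma space_\<mu> [simp]: "space \<mu> = M" and sets_\<mu>: "sets \<mu> = sets (restrict_space borel M)"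
  using haar by (auto simp: left_haar_measure_def)

lemma compact_finite: "compact K \<Longrightarrow> K \<subseteq> M \<Longrightarrow> emeasure \<mu> K < \<infinity>"
  using haar by (simp add: left_haar_measure_def)

lemma sets_\<mu>_iff: "A \<in> sets \<mu> \<longleftrightarrow> A \<in> sets borel \<and> A \<subseteq> M"
  unfolding sets_\<mu> using closed by (subst sets_restrict_space_iff) auto

lemma measurable_\<mu>_iff: "f \<in> measurable \<mu> N \<longleftrightarrow> f \<in> measurable (restrict_space borel M) N"
  by (simp cong: measurable_cong_sets add: sets_\<mu>)

lemma measurable_continuous_on: "continuous_on M f \<Longrightarrow> f \<in> borel_measurable \<mu>"
  unfolding measurable_\<mu>_iff by (rule borel_measurable_continuous_on_restrict)

lemma measurable_into_\<mu>: "f \<in> borel_measurable N \<Longrightarrow> (\<And>x. x \<in> space N \<Longrightarrow> f x \<in> M) \<Longrightarrow> f \<in> measurable N \<mu>"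
proof -
  assume "f \<in> borel_measurable N" "\<And>x. x \<in> space N \<Longrightarrow> f x \<in> M"
  then have "f \<in> measurable N (restrict_space borel M)" by (intro measurable_restrict_space2) auto
  then show ?thesis by (simp cong: measurable_cong_sets add: sets_\<mu>)
qed

lemma measurable_translate: "x \<in> M \<Longrightarrow> (\<lambda>y. x \<otimes> y) \<in> measurable \<mu> \<mu>"
  by (intro measurable_into_\<mu> measurable_continuous_on continuous_on_gmult continuous_intros) (auto intro: M_mult)

lemma distr_translate:
  assumes x: "x \<in> M" shows "distr \<mu> \<mu> (\<lambda>y. x \<otimes> y) = \<mu>"
proof (rule measure_eqI)
  fix S assume "S \<in> sets (distr \<mu> \<mu> (\<lambda>y. x \<otimes> y))"
  then have S: "S \<in> sets \<mu>" by simp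
  then have SM: "S \<subseteq> M" by (simp add: sets_\<mu>_iff)
  have "(\<lambda>y. x \<otimes> y) -` S \<inter> M = (\<lambda>y. inv x \<otimes> y) ` S"
  proof safe
    fix y assume "x \<otimes> y \<in> S"
    then show "y \<in> (\<lambda>y. inv x \<otimes> y) ` S" by (rule image_eqI[rotated]) (simp add: inv_mult_cancel)
  qed (use SM x in \<open>auto simp: mult_inv_cancel intro: M_mult M_inv\<close>)
  then have "emeasure (distr \<mu> \<mu> (\<lambda>y. x \<otimes> y)) S = emeasure \<mu> ((\<lambda>y. inv x \<otimes> y) ` S)"
    using S by (simp add: emeasure_distr measurable_translate[OF x])
  also have "\<dots> = emeasure \<mu> S" using haar M_inv[OF x] S by (simp add: left_haar_measure_def)
  finally show "emeasure (distr \<mu> \<mu> (\<lambda>y. x \<otimes> y)) S = emeasure \<mu> S" .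
qed simp

lemma nn_integral_translate:
  assumes "x \<in> M" "f \<in> borel_measurable \<mu>" shows "(\<integral>\<^sup>+y. f (x \<otimes> y) \<partial>\<mu>) = (\<integral>\<^sup>+y. f y \<partial>\<mu>)"
  using nn_integral_distr[OF measurable_translate[OF assms(1)], of f] assms(2)
  by (simp add: distr_translate[OF assms(1)])

lemma integral_translate:
  fixes f :: "'G \<Rightarrow> complex"
  assumes "x \<in> M" "f \<in> borel_measurable \<mu>" shows "(LINT y|\<mu>. f (x \<otimes> y)) = (LINT y|\<mu>. f y)"
  using integral_distr[OF measurable_translate[OF assms(1)], of f] assms(2)
  by (simp add: distr_translate[OF assms(1)])

text \<open>By the Lindeloef property countably many translates of a nonempty open set cover the group; were one
  of them null, so would be the whole group.\<close>

lemma open_positive: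
  assumes W: "open W" "W \<inter> M \<noteq> {}" shows "emeasure \<mu> (W \<inter> M) > 0"
proof (rule ccontr)
  assume "\<not> ?thesis"
  then have 0: "emeasure \<mu> (W \<inter> M) = 0" by (simp add: not_gr_zero)
  obtain u where u: "u \<in> W" "u \<in> M" using W(2) by blast
  let ?\<F> = "(\<lambda>x. (\<lambda>y. inv x \<otimes> y) -` W) ` M"
  obtain \<F>' where F: "\<F>' \<subseteq> ?\<F>" "countable \<F>'" "\<Union>\<F>' = \<Union>?\<F>"
    using Lindelof[of ?\<F>] open_translate[OF W(1)] by blast
  have null: "S \<inter> M \<in> null_sets \<mu>" if "S \<in> \<F>'" for S
  proof -
    have "S \<in> ?\<F>" using F(1) that by (rule subsetD)
    then obtain x where x: "x \<in> M" "S = (\<lambda>y. inv x \<otimes> y) -` W" by (rule imageE)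
    have "S \<inter> M = (\<lambda>y. x \<otimes> y) ` (W \<inter> M)"
    proof safe
      fix y assume "y \<in> S" "y \<in> M"
      then show "y \<in> (\<lambda>y. x \<otimes> y) ` (W \<inter> M)"
        using x by (intro image_eqI[of _ _ "inv x \<otimes> y"]) (auto simp: mult_inv_cancel intro: M_mult M_inv)
    qed (use x in \<open>auto simp: inv_mult_cancel intro: M_mult\<close>)
    moreover have "W \<inter> M \<in> sets \<mu>" using W(1) closed by (auto simp: sets_\<mu>_iff)
    ultimately have "emeasure \<mu> (S \<inter> M) = emeasure \<mu> (W \<inter> M)"
      using haar x(1) by (simp add: left_haar_measure_def)
    moreover have "S \<inter> M \<in> sets \<mu>" using open_translate[OF W(1)] closed by (auto simp: sets_\<mu>_iff x(2))
    ultimately show ?thesis using 0 by (simp add: null_sets_def)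
  qed
  have "M \<subseteq> (\<Union>S\<in>\<F>'. S \<inter> M)"
  proof
    fix m assume m: "m \<in> M"
    have "inv (m \<otimes> inv u) \<otimes> m = u" by (simp add: inv_mult_group m_assoc)
    then have "m \<in> (\<lambda>y. inv (m \<otimes> inv u) \<otimes> y) -` W" using u by simp
    moreover have "m \<otimes> inv u \<in> M" using m u by (intro M_mult M_inv)
    ultimately have "m \<in> \<Union>?\<F>" by blast
    then show "m \<in> (\<Union>S\<in>\<F>'. S \<inter> M)" using F(3) m by auto
  qed
  then have "M = (\<Union>S\<in>\<F>'. S \<inter> M)" by blast
  moreover have "(\<Union>S\<in>\<F>'. S \<inter> M) \<in> null_sets \<mu>" by (rule null_sets_UN'[OF F(2) null])
  ultimately have "emeasure \<mu> M = 0" by (simp add: null_sets_def)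
  then show False using haar by (simp add: left_haar_measure_def)
qed

text \<open>If \<open>U\<close> is continuous with compact support, a uniform bound on \<open>\<Sum>\<^sub>\<gamma> |U (\<gamma> m)|\<^sup>2\<close> forbids
  accumulation of the index set, so the sum is locally finite.\<close>

context
  fixes U :: "'G \<Rightarrow> complex" and S \<Gamma> :: "'G set" and b :: ennreal and u0 :: 'G
  assumes U: "continuous_on M U" and S: "compact S" "S \<subseteq> M" "\<And>m. m \<in> M \<Longrightarrow> m \<notin> S \<Longrightarrow> U m = 0"
    and \<Gamma>: "\<Gamma> \<subseteq> M" and u0: "u0 \<in> M" "U u0 \<noteq> 0"
    and b: "\<And>m. m \<in> M \<Longrightarrow> (\<Sum>\<^sub>\<infinity>\<gamma>\<in>\<Gamma>. ennreal ((cmod (U (\<gamma> \<otimes> m)))\<^sup>2)) \<le> b" "b < \<infinity>"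
begin

text \<open>At the point \<open>x\<^sup>-\<^sup>1 u\<^sub>0\<close> every \<open>\<gamma>\<close> close to \<open>x\<close> contributes at least \<open>|U u\<^sub>0|\<^sup>2 / 2\<close> to the sum, so there are only
  finitely many of them.\<close>

lemma finite_near:
  assumes x: "x \<in> M" obtains W where "open W" "x \<in> W" "finite (\<Gamma> \<inter> W)"
proof -
  let ?y = "inv x \<otimes> u0"
  have y: "?y \<in> M" "x \<otimes> ?y = u0" using x u0 by (auto intro: M_mult M_inv simp: mult_inv_cancel)
  define d where "d = (cmod (U u0))\<^sup>2 / 2"
  have d: "d > 0" "d < (cmod (U u0))\<^sup>2" using u0 by (auto simp: d_def)
  have "continuous_on M (\<lambda>\<gamma>. (cmod (U (\<gamma> \<otimes> ?y)))\<^sup>2)"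
    by (intro continuous_intros continuous_on_compose2[OF U] continuous_on_gmult) (auto intro: M_mult y)
  then obtain W where W: "open W" "W \<inter> M = (\<lambda>\<gamma>. (cmod (U (\<gamma> \<otimes> ?y)))\<^sup>2) -` {d<..} \<inter> M"
    unfolding continuous_on_open_invariant using open_greaterThan by blast
  have xW: "x \<in> W" using W(2) x y(2) d by auto
  obtain n where n: "b < of_nat n * ennreal d"
  proof -
    obtain r where r: "b = ennreal r" "r \<ge> 0" using b(2) by (cases b) auto
    obtain n where "r / d < of_nat n" using reals_Archimedean2 by blast
    then have "r < of_nat n * d" using d by (simp add: field_simps)
    then have "b < ennreal (of_nat n * d)" using r by (simp add: ennreal_lessI)
    then show thesis using that[of n] d by (simp add: ennreal_mult ennreal_of_nat_eq_real_of_nat)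
  qed
  have "finite (\<Gamma> \<inter> W)"
  proof (rule ccontr)
    assume "infinite (\<Gamma> \<inter> W)"
    then obtain F where F: "F \<subseteq> \<Gamma> \<inter> W" "finite F" "card F = n" by (meson infinite_arbitrarily_large)
    have "of_nat n * ennreal d = (\<Sum>\<gamma>\<in>F. ennreal d)" using F by simp
    also have "\<dots> \<le> (\<Sum>\<gamma>\<in>F. ennreal ((cmod (U (\<gamma> \<otimes> ?y)))\<^sup>2))"
    proof (intro sum_mono ennreal_leI)
      fix \<gamma> assume "\<gamma> \<in> F"
      then have "\<gamma> \<in> W \<inter> M" using F \<Gamma> by blast
      then show "d \<le> (cmod (U (\<gamma> \<otimes> ?y)))\<^sup>2" unfolding W(2) by simp
    qed
    also have "\<dots> \<le> (\<Sum>\<^sub>\<infinity>\<gamma>\<in>\<Gamma>. ennreal ((cmod (U (\<gamma> \<otimes> ?y)))\<^sup>2))"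
      by (subst nonneg_infsum_complete) (use F in \<open>auto intro!: SUP_upper\<close>)
    also have "\<dots> \<le> b" by (rule b(1)[OF y(1)])
    finally show False using n by simp
  qed
  then show thesis using that W(1) xW by blast
qed

lemma countable_index: "countable \<Gamma>"
proof -
  let ?\<F> = "{W. open W \<and> finite (\<Gamma> \<inter> W)}"
  obtain \<F>' where F: "\<F>' \<subseteq> ?\<F>" "countable \<F>'" "\<Union>\<F>' = \<Union>?\<F>" using Lindelof[of ?\<F>] by blast
  have "\<Gamma> \<subseteq> \<Union>?\<F>" using finite_near \<Gamma> by blast
  then have "\<Gamma> \<subseteq> (\<Union>W\<in>\<F>'. \<Gamma> \<inter> W)" using F(3) by blast
  moreover have "countable (\<Union>W\<in>\<F>'. \<Gamma> \<inter> W)" using F by (intro countable_UN) (auto intro: countable_finite)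
  ultimately show ?thesis by (rule countable_subset)
qed

text \<open>If \<open>\<gamma> m\<close> lies in \<open>S\<close> then \<open>\<gamma> \<in> S m\<^sup>-\<^sup>1\<close>; for \<open>m\<close> near \<open>m\<^sub>0\<close> these sets stay in a finite union of neighbourhoods that
  each contain finitely many \<open>\<gamma>\<close>, by compactness of \<open>S\<close>.\<close>

lemma locally_finite:
  assumes m0: "m0 \<in> M"
  obtains N F where "open N" "m0 \<in> N" "finite F" "F \<subseteq> \<Gamma>"
    "\<And>m \<gamma>. m \<in> N \<Longrightarrow> m \<in> M \<Longrightarrow> \<gamma> \<in> \<Gamma> - F \<Longrightarrow> U (\<gamma> \<otimes> m) = 0"
proof -
  have "\<exists>Z N F. open Z \<and> z \<in> Z \<and> open N \<and> m0 \<in> N \<and> finite F \<and> F \<subseteq> \<Gamma> \<and>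
      (\<forall>z'\<in>Z. \<forall>m\<in>N. z' \<otimes> inv m \<in> \<Gamma> \<longrightarrow> z' \<otimes> inv m \<in> F)" if z: "z \<in> S" for z
  proof -
    have "z \<otimes> inv m0 \<in> M" using z S(2) m0 by (auto intro: M_mult M_inv)
    then obtain W where W: "open W" "z \<otimes> inv m0 \<in> W" "finite (\<Gamma> \<inter> W)" by (rule finite_near)
    have "continuous_on UNIV (\<lambda>p. fst p \<otimes> inv (snd p))"
      by (intro continuous_on_gmult continuous_on_ginv continuous_intros)
    then have "open ((\<lambda>p. fst p \<otimes> inv (snd p)) -` W)" by (rule open_vimage[OF W(1)])
    moreover have "(z, m0) \<in> (\<lambda>p. fst p \<otimes> inv (snd p)) -` W" using W(2) by simp
    ultimately obtain Z N where ZN: "open Z" "open N" "(z, m0) \<in> Z \<times> N" "Z \<times> N \<subseteq> (\<lambda>p. fst p \<otimes> inv (snd p)) -` W"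
      by (rule open_prod_elim)
    then have "\<forall>z'\<in>Z. \<forall>m\<in>N. z' \<otimes> inv m \<in> W" by auto
    then show ?thesis using ZN W(3) by (intro exI[of _ Z] exI[of _ N] exI[of _ "\<Gamma> \<inter> W"]) auto
  qed
  then obtain Z N F where ZNF: "\<And>z. z \<in> S \<Longrightarrow> open (Z z) \<and> z \<in> Z z \<and> open (N z) \<and> m0 \<in> N z \<and> finite (F z) \<and> F z \<subseteq> \<Gamma> \<and>
      (\<forall>z'\<in>Z z. \<forall>m\<in>N z. z' \<otimes> inv m \<in> \<Gamma> \<longrightarrow> z' \<otimes> inv m \<in> F z)" by metis
  have "S \<subseteq> (\<Union>z\<in>S. Z z)" using ZNF by blast
  from compactE_image[OF S(1) _ this] ZNF obtain C where C: "C \<subseteq> S" "finite C" "S \<subseteq> (\<Union>z\<in>C. Z z)"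
    by metis
  show thesis
  proof (rule that[of "\<Inter>z\<in>C. N z" "\<Union>z\<in>C. F z"])
    show "open (\<Inter>z\<in>C. N z)" using C ZNF by (intro open_INT) blast+
    show "m0 \<in> (\<Inter>z\<in>C. N z)" "finite (\<Union>z\<in>C. F z)" "(\<Union>z\<in>C. F z) \<subseteq> \<Gamma>" using C ZNF by blast+
    fix m \<gamma> assume m: "m \<in> (\<Inter>z\<in>C. N z)" "m \<in> M" and \<gamma>: "\<gamma> \<in> \<Gamma> - (\<Union>z\<in>C. F z)"
    have \<gamma>m: "(\<gamma> \<otimes> m) \<otimes> inv m = \<gamma>" by (simp add: m_assoc)
    have "\<gamma> \<otimes> m \<notin> S"
    proof
      assume "\<gamma> \<otimes> m \<in> S"
      then obtain z where z: "z \<in> C" "\<gamma> \<otimes> m \<in> Z z" using C(3) by blast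
      then have "(\<gamma> \<otimes> m) \<otimes> inv m \<in> \<Gamma> \<longrightarrow> (\<gamma> \<otimes> m) \<otimes> inv m \<in> F z" using ZNF[of z] C(1) m(1) by blast
      then show False using \<gamma> z(1) unfolding \<gamma>m by blast
    qed
    then show "U (\<gamma> \<otimes> m) = 0" using \<gamma> \<Gamma> m(2) by (intro S(3) M_mult) auto
  qed
qed

lemma continuous_sum: "continuous_on M (\<lambda>m. \<Sum>\<^sub>\<infinity>\<gamma>\<in>\<Gamma>. ennreal ((cmod (U (\<gamma> \<otimes> m)))\<^sup>2))" (is "continuous_on M ?g")
proof -
  have "\<exists>N. open N \<and> m0 \<in> N \<and> continuous_on (M \<inter> N) ?g" if m0: "m0 \<in> M" for m0
  proof -
    obtain N F where N: "open N" "m0 \<in> N" "finite F" "F \<subseteq> \<Gamma>"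
      "\<And>m \<gamma>. m \<in> N \<Longrightarrow> m \<in> M \<Longrightarrow> \<gamma> \<in> \<Gamma> - F \<Longrightarrow> U (\<gamma> \<otimes> m) = 0" using locally_finite[OF m0] by metis
    have "?g m = ennreal (\<Sum>\<gamma>\<in>F. (cmod (U (\<gamma> \<otimes> m)))\<^sup>2)" if m: "m \<in> M \<inter> N" for m
    proof -
      have "?g m = (\<Sum>\<^sub>\<infinity>\<gamma>\<in>F. ennreal ((cmod (U (\<gamma> \<otimes> m)))\<^sup>2))"
        using N(4) N(5)[of m] m by (intro infsum_cong_neutral) auto
      then show ?thesis using N(3) by (simp add: sum_ennreal)
    qed
    moreover have "continuous_on (M \<inter> N) (\<lambda>m. ennreal (\<Sum>\<gamma>\<in>F. (cmod (U (\<gamma> \<otimes> m)))\<^sup>2))"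
      using N(4) \<Gamma> by (intro continuous_on_ennreal continuous_intros continuous_on_compose2[OF U] continuous_on_gmult)
        (auto intro!: M_mult)
    ultimately have "continuous_on (M \<inter> N) ?g" by (subst continuous_on_cong[OF refl]) auto
    then show ?thesis using N by blast
  qed
  then show ?thesis
    unfolding continuous_on_eq_continuous_within
  proof (intro ballI)
    fix x assume cont: "\<And>m0. m0 \<in> M \<Longrightarrow> \<exists>N. open N \<and> m0 \<in> N \<and> (\<forall>x\<in>M \<inter> N. continuous (at x within M \<inter> N) ?g)"
      and x: "x \<in> M"
    then obtain N where N: "open N" "x \<in> N" "continuous (at x within M \<inter> N) ?g" by blast
    moreover have "at x within M \<inter> N = at x within M" by (rule at_within_nhd[OF N(2,1)]) auto
    ultimately show "continuous (at x within M) ?g" by simp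
  qed
qed

end

end

section \<open>Frames of modulated translates\<close>

lemma countable_int_vectors: "countable (int_vectors :: (real^'m) set)"
proof (rule countable_subset)
  show "int_vectors \<subseteq> vec_lambda ` (PiE (UNIV :: 'm set) (\<lambda>_. \<int> :: real set))"
  proof
    fix v :: "real^'m" assume "v \<in> int_vectors"
    then have "(\<lambda>i. v $ i) \<in> PiE UNIV (\<lambda>_. \<int>)" by (auto simp: int_vectors_def)
    then show "v \<in> vec_lambda ` (PiE UNIV (\<lambda>_. \<int>))" by (rule image_eqI[rotated]) simp
  qed
  show "countable (vec_lambda ` (PiE (UNIV :: 'm set) (\<lambda>_. \<int> :: real set)))"
    by (intro countable_image countable_PiE) (auto simp: Ints_def)
qed

lemma frame_with_optimal_bounds_reindex:
  assumes frame: "frame_with_optimal_bounds \<mu> K u a b" and inj: "inj_on \<kappa> K"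
    and eq: "\<And>p m. p \<in> K \<Longrightarrow> m \<in> space \<mu> \<Longrightarrow> v (\<kappa> p) m = u p m"
  shows "frame_with_optimal_bounds \<mu> (\<kappa> ` K) v a b"
proof -
  have "L2_inner \<mu> h (v (\<kappa> p)) = L2_inner \<mu> h (u p)" if "p \<in> K" for h p
    unfolding L2_inner_def by (intro Bochner_Integration.integral_cong) (simp_all add: eq that)
  then have "(\<Sum>\<^sub>\<infinity>k\<in>\<kappa> ` K. ennreal ((cmod (L2_inner \<mu> h (v k)))\<^sup>2)) = (\<Sum>\<^sub>\<infinity>p\<in>K. ennreal ((cmod (L2_inner \<mu> h (u p)))\<^sup>2))" for h
    unfolding infsum_reindex[OF inj] by (intro infsum_cong) simp
  moreover have "v (\<kappa> p) \<in> L2_space \<mu>" if "p \<in> K" for p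
  proof -
    have "u p \<in> L2_space \<mu>" using frame that by (simp add: frame_with_optimal_bounds_def Let_def)
    then show ?thesis
      unfolding L2_space_def using eq[OF that] measurable_cong[of \<mu> "v (\<kappa> p)" "u p" borel] L2_normsq_cong[of \<mu> "v (\<kappa> p)" "u p"]
      by simp
  qed
  ultimately show ?thesis
    using frame unfolding frame_with_optimal_bounds_def Let_def by simp
qed

text \<open>The analytic data of the theorem: \<open>\<Phi>\<close> is a homeomorphism of \<open>\<Omega>\<close> onto an open subset \<open>B\<close> of Euclidean
  space with inverse \<open>E\<close>, \<open>\<Psi>\<close> is the density of the image measure, and \<open>S\<close> is the support of the
  window \<open>s\<close>. The matrix \<open>T\<close> generates the lattice dual to that of \<open>L\<close>.\<close>

locale lattice_section = closed_haar_subgroup G M \<mu>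
  for G :: "'G::{t2_space,second_countable_topology} monoid" (structure) and M \<mu> +
  fixes B :: "(real^'m) set" and E :: "real^'m \<Rightarrow> 'G" and \<Phi> :: "'G \<Rightarrow> real^'m" and \<Omega> S :: "'G set"
    and \<Psi> :: "real^'m \<Rightarrow> real" and s :: "'G \<Rightarrow> complex" and L T :: "real^'m^'m"
  assumes B: "open B" "continuous_on B E" "\<And>\<xi>. \<xi> \<in> B \<Longrightarrow> E \<xi> \<in> \<Omega>" "\<And>\<xi>. \<xi> \<in> B \<Longrightarrow> \<Phi> (E \<xi>) = \<xi>"
    and \<Omega>: "\<Omega> \<in> sets borel" "\<Omega> \<subseteq> M" "continuous_on \<Omega> \<Phi>" "\<And>m. m \<in> \<Omega> \<Longrightarrow> \<Phi> m \<in> B" "\<And>m. m \<in> \<Omega> \<Longrightarrow> E (\<Phi> m) = m"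
    and \<Psi>: "continuous_on B \<Psi>" "\<And>\<xi>. \<xi> \<in> B \<Longrightarrow> 0 < \<Psi> \<xi>"
    and push: "distr (restrict_space \<mu> \<Omega>) borel \<Phi> = density lborel (\<lambda>\<xi>. indicator B \<xi> * ennreal (\<Psi> \<xi>))"
    and s: "continuous_on M s" "compact S" "S \<subseteq> \<Omega>" "\<And>m. m \<in> M \<Longrightarrow> s m \<noteq> 0 \<Longrightarrow> m \<in> S"
    and L: "invertible L" "T = transpose (matrix_inv L)"
    and pack: "\<And>v w. v \<in> (*v) T ` int_vectors \<Longrightarrow> w \<in> (*v) T ` int_vectors \<Longrightarrow> v \<noteq> w \<Longrightarrow>
        negligible ((+) v ` (\<Phi> ` S) \<inter> (+) w ` (\<Phi> ` S))"
begin

definition Ups :: "'G \<Rightarrow> complex" where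
  "Ups m = (if m \<in> \<Omega> then sqrt (\<Psi> (\<Phi> m) * \<bar>det T\<bar>) * s m else 0)"

definition modulated :: "real^'m \<Rightarrow> 'G \<Rightarrow> complex" where
  "modulated k m = (if m \<in> \<Omega> then cis (2 * pi * ((L *v k) \<bullet> \<Phi> m)) * s m else 0)"

lemma det_T: "\<bar>det T\<bar> > 0"
proof -
  have "det (matrix_inv L) * det L = 1"
    using matrix_inv_mult(2)[OF L(1)] det_mul[of "matrix_inv L" L] by simp
  then have "det (matrix_inv L) \<noteq> 0" by auto
  then show ?thesis by (simp add: L(2))
qed

lemma S_M: "S \<subseteq> M" using s(3) \<Omega>(2) by blast

lemma s_zero: "m \<in> M \<Longrightarrow> m \<notin> S \<Longrightarrow> s m = 0" using s(4) by blast

lemma Ups_zero: "m \<in> M \<Longrightarrow> m \<notin> S \<Longrightarrow> Ups m = 0" by (simp add: Ups_def s_zero)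

text \<open>Continuity of the extension by zero is at issue only at those points of \<open>S\<close> that are limits of points of \<open>M\<close>
  outside \<open>\<Omega>\<close>; at such points \<open>s\<close> vanishes by continuity.\<close>

lemma continuous_Ups: "continuous_on M Ups"
  unfolding continuous_on_def
proof
  fix x assume x: "x \<in> M"
  show "(Ups \<longlongrightarrow> Ups x) (at x within M)"
  proof (cases "x \<in> S")
    case False
    have "open (- S)" using s(2) by (simp add: compact_imp_closed open_Compl)
    then have "\<forall>\<^sub>F m in at x within M. m \<in> - S"
      by (intro filter_leD[OF at_le[OF subset_UNIV] eventually_at_in_open']) (use False in auto)
    moreover have "\<forall>\<^sub>F m in at x within M. m \<in> M" by (simp add: eventually_at_filter)
    ultimately have "\<forall>\<^sub>F m in at x within M. Ups m = Ups x"
      by eventually_elim (use x False in \<open>simp add: Ups_zero\<close>)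
    then show ?thesis by (rule tendsto_eventually)
  next
    case True
    then have xO: "x \<in> \<Omega>" using s(3) by blast
    have "continuous_on \<Omega> (\<lambda>m. complex_of_real (sqrt (\<Psi> (\<Phi> m) * \<bar>det T\<bar>)) * s m)"
      by (intro continuous_intros continuous_on_compose2[OF \<Psi>(1) \<Omega>(3)] continuous_on_subset[OF s(1) \<Omega>(2)])
        (use \<Omega>(4) in auto)
    then have "continuous_on \<Omega> Ups" by (rule continuous_on_eq) (simp add: Ups_def)
    then have t1: "(Ups \<longlongrightarrow> Ups x) (at x within \<Omega>)" using xO by (simp add: continuous_on_def)
    have t2: "(Ups \<longlongrightarrow> Ups x) (at x within (M - \<Omega>))"
    proof (cases "at x within (M - \<Omega>) = bot")
      case False
      have ev: "\<forall>\<^sub>F m in at x within (M - \<Omega>). m \<in> M - \<Omega>" by (simp add: eventually_at_filter)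
      have "(s \<longlongrightarrow> s x) (at x within (M - \<Omega>))"
        using s(1) x by (auto simp: continuous_on_def intro: tendsto_within_subset)
      moreover have "(s \<longlongrightarrow> 0) (at x within (M - \<Omega>))"
        by (rule tendsto_eventually) (use ev in eventually_elim, use s(3) s_zero in auto)
      ultimately have "s x = 0" using tendsto_unique False by blast
      then have "Ups x = 0" by (simp add: Ups_def)
      moreover have "\<forall>\<^sub>F m in at x within (M - \<Omega>). Ups m = 0"
        using ev by eventually_elim (simp add: Ups_def)
      ultimately show ?thesis by (simp add: tendsto_eventually)
    qed simp
    have "M = \<Omega> \<union> (M - \<Omega>)" using \<Omega>(2) by blast
    then have "at x within M = sup (at x within \<Omega>) (at x within (M - \<Omega>))" by (metis at_within_union)
    then show ?thesis using t1 t2 by (simp add: filterlim_sup)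
  qed
qed

lemma measurable_borel_\<mu>: "f \<in> borel_measurable borel \<Longrightarrow> f \<in> borel_measurable \<mu>"
  unfolding measurable_\<mu>_iff by (rule measurable_restrict_space1)

lemma measurable_modulated [measurable]: "modulated k \<in> borel_measurable \<mu>"
proof -
  have "(\<lambda>m. indicator \<Omega> m *\<^sub>R (cis (2 * pi * ((L *v k) \<bullet> \<Phi> m)) * s m)) \<in> borel_measurable borel"
    by (intro borel_measurable_continuous_on_indicator \<Omega>(1) continuous_intros \<Omega>(3) continuous_on_subset[OF s(1) \<Omega>(2)])
  then have "(\<lambda>m. indicator \<Omega> m *\<^sub>R (cis (2 * pi * ((L *v k) \<bullet> \<Phi> m)) * s m)) \<in> borel_measurable \<mu>"
    by (rule measurable_borel_\<mu>)
  also have "(\<lambda>m. indicator \<Omega> m *\<^sub>R (cis (2 * pi * ((L *v k) \<bullet> \<Phi> m)) * s m)) = modulated k"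
    by (auto simp: modulated_def indicator_def)
  finally show ?thesis .
qed

lemma modulated_L2: "modulated k \<in> L2_space \<mu>"
proof -
  have "bounded (s ` S)"
    by (intro compact_imp_bounded compact_continuous_image s continuous_on_subset[OF s(1) S_M])
  then obtain C where C: "\<And>m. m \<in> S \<Longrightarrow> cmod (s m) \<le> C" unfolding bounded_iff by blast
  have S_sets: "S \<in> sets \<mu>" using S_M s(2) by (simp add: sets_\<mu>_iff borel_compact)
  have "L2_normsq \<mu> (modulated k) \<le> (\<integral>\<^sup>+m. ennreal (C\<^sup>2) * indicator S m \<partial>\<mu>)"
    unfolding L2_normsq_def
  proof (rule nn_integral_mono)
    fix m assume m: "m \<in> space \<mu>"
    show "ennreal ((cmod (modulated k m))\<^sup>2) \<le> ennreal (C\<^sup>2) * indicator S m"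
    proof (cases "m \<in> S")
      case True
      then have "(cmod (modulated k m))\<^sup>2 \<le> C\<^sup>2"
        using C[OF True] by (auto simp: modulated_def norm_mult intro!: power_mono)
      then show ?thesis using True by (simp add: ennreal_leI)
    next
      case False
      then show ?thesis using m by (simp add: modulated_def s_zero)
    qed
  qed
  also have "\<dots> = ennreal (C\<^sup>2) * emeasure \<mu> S" using S_sets by (rule nn_integral_cmult_indicator)
  also have "\<dots> < \<infinity>" using compact_finite[OF s(2) S_M] by (simp add: ennreal_mult_less_top)
  finally show ?thesis by (simp add: L2_space_def)
qed

lemma translate_L2:
  assumes "f \<in> L2_space \<mu>" "\<gamma> \<in> M" shows "(\<lambda>m. f (\<gamma> \<otimes> m)) \<in> L2_space \<mu>"
proof -
  have f: "f \<in> borel_measurable \<mu>" using assms by (simp add: L2_space_def)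
  have "(\<lambda>m. f (\<gamma> \<otimes> m)) \<in> borel_measurable \<mu>"
    using measurable_compose[OF measurable_translate[OF assms(2)] f] .
  moreover have "L2_normsq \<mu> (\<lambda>m. f (\<gamma> \<otimes> m)) = L2_normsq \<mu> f"
    unfolding L2_normsq_def using f by (intro nn_integral_translate[OF assms(2), of "\<lambda>m. ennreal ((cmod (f m))\<^sup>2)"]) measurable
  ultimately show ?thesis using assms(1) by (simp add: L2_space_def)
qed

lemma measurable_\<Phi>: "\<Phi> \<in> borel_measurable (restrict_space \<mu> \<Omega>)"
proof -
  have "\<Phi> \<in> borel_measurable (restrict_space borel \<Omega>)"
    by (rule borel_measurable_continuous_on_restrict[OF \<Omega>(3)])
  moreover have "sets (restrict_space \<mu> \<Omega>) = sets (restrict_space borel \<Omega>)"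
    using sets_restrict_space_cong[OF sets_\<mu>, of \<Omega>] \<Omega>(2)
    by (simp only: sets_restrict_restrict_space Int_absorb1)
  ultimately show ?thesis by (simp cong: measurable_cong_sets)
qed

text \<open>The heart of the matter. After a translation, the inner products with the functions
  \<open>modulated k\<close> are the Fourier coefficients with respect to the lattice of one function \<open>F\<close> on
  Euclidean space whose support is packed by the dual lattice. Boundedness of \<open>Ups\<close> makes \<open>F\<close>
  square-integrable.\<close>

lemma sum_coefficients:
  assumes h: "h \<in> L2_space \<mu>" and \<gamma>: "\<gamma> \<in> M"
    and bdd: "\<And>m. m \<in> M \<Longrightarrow> ennreal ((cmod (Ups m))\<^sup>2) \<le> b" "b < \<infinity>"
  shows "(\<Sum>\<^sub>\<infinity>k\<in>int_vectors. ennreal ((cmod (L2_inner \<mu> h (\<lambda>m. modulated k (\<gamma> \<otimes> m))))\<^sup>2))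
    = (\<integral>\<^sup>+m. ennreal ((cmod (h m))\<^sup>2) * ennreal ((cmod (Ups (\<gamma> \<otimes> m)))\<^sup>2) \<partial>\<mu>)"
proof -
  define h' where "h' m = h (inv \<gamma> \<otimes> m)" for m
  have h'L2: "h' \<in> L2_space \<mu>" unfolding h'_def by (rule translate_L2[OF h M_inv[OF \<gamma>]])
  then have h'm[measurable]: "h' \<in> borel_measurable \<mu>" by (simp add: L2_space_def)
  have h'\<gamma>: "h' (\<gamma> \<otimes> m) = h m" for m by (simp add: h'_def inv_mult_cancel)
  have cs[measurable]: "(\<lambda>m. cnj (s m)) \<in> borel_measurable \<mu>"
    by (rule measurable_continuous_on) (intro continuous_intros s)
  have Um[measurable]: "Ups \<in> borel_measurable \<mu>" by (rule measurable_continuous_on[OF continuous_Ups])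
  have cm[measurable]: "(\<lambda>m. cnj (modulated k m)) \<in> borel_measurable \<mu>" for k
    by (rule borel_measurable_continuous_on[OF _ measurable_modulated]) (intro continuous_intros)
  have E: "E \<in> measurable (restrict_space borel B) \<mu>"
    by (intro measurable_into_\<mu> borel_measurable_continuous_on_restrict B(2)) (use B(3) \<Omega>(2) in \<open>auto simp: space_restrict_space\<close>)
  have Bb[measurable]: "B \<in> sets borel" using B(1) by simp
  have \<Omega>\<mu>: "\<Omega> \<inter> space \<mu> \<in> sets \<mu>" using \<Omega>(1,2) by (simp add: sets_\<mu>_iff Int_absorb2)
  define H where "H \<xi> = indicator B \<xi> *\<^sub>R (h' (E \<xi>) * cnj (s (E \<xi>)))" for \<xi>
  have Hm[measurable]: "H \<in> borel_measurable borel"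
  proof -
    have "(\<lambda>\<xi>. h' (E \<xi>) * cnj (s (E \<xi>))) \<in> borel_measurable (restrict_space borel B)"
      using measurable_compose[OF E h'm] measurable_compose[OF E cs] by (rule borel_measurable_times)
    then show ?thesis unfolding H_def by (subst (asm) borel_measurable_restrict_space_iff) auto
  qed
  have \<Psi>m[measurable]: "(\<lambda>\<xi>. indicator B \<xi> * \<Psi> \<xi>) \<in> borel_measurable borel"
    using borel_measurable_continuous_on_indicator[OF Bb \<Psi>(1)] by simp
  have \<Psi>0: "0 \<le> indicator B \<xi> * \<Psi> \<xi>" for \<xi> using \<Psi>(2)[of \<xi>] by (cases "\<xi> \<in> B") auto
  have D: "(\<lambda>\<xi>. indicator B \<xi> * ennreal (\<Psi> \<xi>)) = (\<lambda>\<xi>. ennreal (indicator B \<xi> * \<Psi> \<xi>))"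
    by (auto simp: indicator_def)
  define F where "F \<xi> = (indicator B \<xi> * \<Psi> \<xi>) *\<^sub>R H \<xi>" for \<xi>
  have Fm: "F \<in> borel_measurable borel" unfolding F_def by measurable
  have coeff: "L2_inner \<mu> h (\<lambda>m. modulated k (\<gamma> \<otimes> m)) = (LINT \<xi>|lborel. F \<xi> * cis (- 2 * pi * ((L *v k) \<bullet> \<xi>)))" for k
  proof -
    let ?c = "\<lambda>\<xi>. cis (- 2 * pi * ((L *v k) \<bullet> \<xi>))"
    have [measurable]: "?c \<in> borel_measurable borel"
      by (rule borel_measurable_continuous_onI) (intro continuous_intros)
    have "L2_inner \<mu> h (\<lambda>m. modulated k (\<gamma> \<otimes> m)) = (LINT m|\<mu>. (h' (\<gamma> \<otimes> m) * cnj (modulated k (\<gamma> \<otimes> m))))"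
      by (simp add: L2_inner_def h'\<gamma>)
    also have "\<dots> = (LINT m|\<mu>. h' m * cnj (modulated k m))"
      by (rule integral_translate[OF \<gamma>, of "\<lambda>m. h' m * cnj (modulated k m)"]) measurable
    also have "\<dots> = (LINT m|\<mu>. indicator \<Omega> m *\<^sub>R (h' m * cnj (modulated k m)))"
      by (intro Bochner_Integration.integral_cong) (auto simp: indicator_def modulated_def)
    also have "\<dots> = (LINT m|restrict_space \<mu> \<Omega>. h' m * cnj (modulated k m))"
      by (rule integral_restrict_space[symmetric, OF \<Omega>\<mu>])
    also have "\<dots> = (LINT m|restrict_space \<mu> \<Omega>. H (\<Phi> m) * ?c (\<Phi> m))"
      by (intro Bochner_Integration.integral_cong refl)
        (auto simp: space_restrict_space H_def \<Omega>(4,5) modulated_def cis_cnj)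
    also have "\<dots> = (LINT \<xi>|distr (restrict_space \<mu> \<Omega>) borel \<Phi>. H \<xi> * ?c \<xi>)"
      by (rule integral_distr[symmetric, OF measurable_\<Phi>]) measurable
    also have "\<dots> = (LINT \<xi>|lborel. (indicator B \<xi> * \<Psi> \<xi>) *\<^sub>R (H \<xi> * ?c \<xi>))"
    proof -
      have Q: "(\<lambda>\<xi>. H \<xi> * ?c \<xi>) \<in> borel_measurable lborel" by measurable
      have P: "(\<lambda>\<xi>. indicator B \<xi> * \<Psi> \<xi>) \<in> borel_measurable lborel" by measurable
      show ?thesis unfolding push D
        by (rule integral_density[OF Q P AE_I2]) (rule \<Psi>0)
    qed
    finally show ?thesis by (simp add: F_def)
  qed
  have norm_F: "ennreal \<bar>det T\<bar> * L2_normsq lborel F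
      = (\<integral>\<^sup>+m. ennreal ((cmod (h m))\<^sup>2) * ennreal ((cmod (Ups (\<gamma> \<otimes> m)))\<^sup>2) \<partial>\<mu>)"
  proof -
    let ?n = "\<lambda>\<xi>. ennreal ((indicator B \<xi> * \<Psi> \<xi>) * (cmod (H \<xi>))\<^sup>2 * \<bar>det T\<bar>)"
    have "ennreal \<bar>det T\<bar> * L2_normsq lborel F = (\<integral>\<^sup>+\<xi>. ennreal \<bar>det T\<bar> * ennreal ((cmod (F \<xi>))\<^sup>2) \<partial>lborel)"
      unfolding L2_normsq_def using Fm by (intro nn_integral_cmult[symmetric]) measurable
    also have "\<dots> = (\<integral>\<^sup>+\<xi>. ennreal (indicator B \<xi> * \<Psi> \<xi>) * ?n \<xi> \<partial>lborel)"
    proof (rule nn_integral_cong)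
      fix \<xi>
      have "\<bar>det T\<bar> * (cmod (F \<xi>))\<^sup>2 = (indicator B \<xi> * \<Psi> \<xi>) * ((indicator B \<xi> * \<Psi> \<xi>) * (cmod (H \<xi>))\<^sup>2 * \<bar>det T\<bar>)"
        by (simp add: F_def power2_eq_square)
      then show "ennreal \<bar>det T\<bar> * ennreal ((cmod (F \<xi>))\<^sup>2) = ennreal (indicator B \<xi> * \<Psi> \<xi>) * ?n \<xi>"
        using \<Psi>0[of \<xi>] by (simp only: ennreal_mult[symmetric] abs_ge_zero zero_le_power2 mult_nonneg_nonneg)
    qed
    also have "\<dots> = (\<integral>\<^sup>+\<xi>. ?n \<xi> \<partial>density lborel (\<lambda>\<xi>. ennreal (indicator B \<xi> * \<Psi> \<xi>)))"
      by (rule nn_integral_density[symmetric]) measurable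
    also have "\<dots> = (\<integral>\<^sup>+\<xi>. ?n \<xi> \<partial>distr (restrict_space \<mu> \<Omega>) borel \<Phi>)"
      unfolding push D ..
    also have "\<dots> = (\<integral>\<^sup>+m. ?n (\<Phi> m) \<partial>restrict_space \<mu> \<Omega>)"
      by (rule nn_integral_distr[OF measurable_\<Phi>]) measurable
    also have "\<dots> = (\<integral>\<^sup>+m. ?n (\<Phi> m) * indicator \<Omega> m \<partial>\<mu>)"
      by (rule nn_integral_restrict_space[OF \<Omega>\<mu>])
    also have "\<dots> = (\<integral>\<^sup>+m. ennreal ((cmod (h' m))\<^sup>2) * ennreal ((cmod (Ups m))\<^sup>2) \<partial>\<mu>)"
    proof (rule nn_integral_cong)
      fix m assume "m \<in> space \<mu>"
      show "?n (\<Phi> m) * indicator \<Omega> m = ennreal ((cmod (h' m))\<^sup>2) * ennreal ((cmod (Ups m))\<^sup>2)"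
      proof (cases "m \<in> \<Omega>")
        case True
        then have "indicator B (\<Phi> m) * \<Psi> (\<Phi> m) * (cmod (H (\<Phi> m)))\<^sup>2 * \<bar>det T\<bar> = (cmod (h' m))\<^sup>2 * (cmod (Ups m))\<^sup>2"
          using \<Psi>(2)[OF \<Omega>(4)[OF True]]
          by (simp add: H_def \<Omega>(4,5) Ups_def norm_mult power_mult_distrib)
        then show ?thesis using True by (simp add: ennreal_mult[symmetric])
      qed (simp add: Ups_def)
    qed
    also have "\<dots> = (\<integral>\<^sup>+m. ennreal ((cmod (h' (\<gamma> \<otimes> m)))\<^sup>2) * ennreal ((cmod (Ups (\<gamma> \<otimes> m)))\<^sup>2) \<partial>\<mu>)"
      by (rule nn_integral_translate[symmetric, OF \<gamma>,
            of "\<lambda>m. ennreal ((cmod (h' m))\<^sup>2) * ennreal ((cmod (Ups m))\<^sup>2)"]) measurable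
    finally show ?thesis unfolding h'\<gamma> .
  qed
  have "ennreal \<bar>det T\<bar> * L2_normsq lborel F \<le> (\<integral>\<^sup>+m. ennreal ((cmod (h m))\<^sup>2) * b \<partial>\<mu>)"
    unfolding norm_F by (intro nn_integral_mono mult_left_mono bdd) (auto intro: M_mult[OF \<gamma>])
  also have "\<dots> = L2_normsq \<mu> h * b"
    unfolding L2_normsq_def by (rule nn_integral_multc) (use h in \<open>auto simp: L2_space_def\<close>)
  also have "\<dots> < \<infinity>" using h bdd(2) by (simp add: L2_space_def ennreal_mult_less_top)
  finally have "L2_normsq lborel F < \<infinity>"
    using det_T by (auto simp: ennreal_mult_less_top less_top[symmetric] ennreal_mult_eq_top_iff)
  moreover have "compact (\<Phi> ` S)"
    by (intro compact_continuous_image s continuous_on_subset[OF \<Omega>(3) s(3)])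
  moreover have "F \<xi> = 0" if "\<xi> \<notin> \<Phi> ` S" for \<xi>
  proof (cases "\<xi> \<in> B")
    case True
    have "E \<xi> \<notin> S" using that B(4)[OF True] by (metis image_eqI)
    then have "s (E \<xi>) = 0" using B(3)[OF True] \<Omega>(2) by (intro s_zero) auto
    then show ?thesis by (simp add: F_def H_def)
  qed (simp add: F_def)
  ultimately have "(\<Sum>\<^sub>\<infinity>k\<in>int_vectors. ennreal ((cmod (LINT \<xi>|lborel. F \<xi> * cis (- 2 * pi * ((L *v k) \<bullet> \<xi>))))\<^sup>2))
      = ennreal \<bar>det T\<bar> * L2_normsq lborel F"
    using Parseval_lattice[OF L(1) Fm, of "\<Phi> ` S", folded L(2), OF _ _ pack] by simp
  then show ?thesis unfolding coeff norm_F .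
qed

text \<open>Since \<open>\<Sum>\<^sub>\<gamma> |Ups (\<gamma> m)|\<^sup>2\<close> is continuous in \<open>m\<close>, its infimum and supremum are essential ones:
  they are detected by indicator functions of small open sets.\<close>

theorem frame_of_modulated_translates:
  assumes \<Gamma>: "\<Gamma> \<subseteq> M"
    and a: "a = (INF m\<in>M. \<Sum>\<^sub>\<infinity>\<gamma>\<in>\<Gamma>. ennreal ((cmod (Ups (\<gamma> \<otimes> m)))\<^sup>2))" "a > 0"
    and b: "b = (SUP m\<in>M. \<Sum>\<^sub>\<infinity>\<gamma>\<in>\<Gamma>. ennreal ((cmod (Ups (\<gamma> \<otimes> m)))\<^sup>2))" "b < \<infinity>"
  shows "frame_with_optimal_bounds \<mu> (\<Gamma> \<times> int_vectors) (\<lambda>p m. modulated (snd p) (fst p \<otimes> m)) a b"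
proof -
  define g where "g m = (\<Sum>\<^sub>\<infinity>\<gamma>\<in>\<Gamma>. ennreal ((cmod (Ups (\<gamma> \<otimes> m)))\<^sup>2))" for m
  have ga: "a \<le> g m" and gb: "g m \<le> b" if "m \<in> M" for m
    using that unfolding a(1) b(1) g_def by (auto intro: INF_lower SUP_upper)
  \<comment> \<open>Positivity of the lower bound provides a point at which \<open>Ups\<close> does not
    vanish.\<close>
  have "g \<one> > 0" using a(2) ga[OF M_one] by (rule less_le_trans)
  then have "\<exists>\<gamma>\<in>\<Gamma>. Ups (\<gamma> \<otimes> \<one>) \<noteq> 0"
    unfolding g_def by (rule contrapos_pp) (auto simp: infsum_0)
  then obtain u0 where u0: "u0 \<in> \<Gamma>" "Ups (u0 \<otimes> \<one>) \<noteq> 0" by blast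
  then have u0': "u0 \<in> M" "Ups u0 \<noteq> 0" using \<Gamma> by auto
  note ctx = continuous_Ups s(2) S_M Ups_zero \<Gamma> u0' gb[unfolded g_def] b(2)
  have cnt: "countable \<Gamma>" by (rule countable_index[OF ctx])
  have gc: "continuous_on M g" unfolding g_def by (rule continuous_sum[OF ctx])
  have term_le: "ennreal ((cmod (Ups (\<gamma> \<otimes> m)))\<^sup>2) \<le> g m" if "\<gamma> \<in> \<Gamma>" for \<gamma> m
  proof -
    have "(\<Sum>\<gamma>\<in>{\<gamma>}. ennreal ((cmod (Ups (\<gamma> \<otimes> m)))\<^sup>2)) \<le> g m"
      unfolding g_def by (subst nonneg_infsum_complete, simp, rule SUP_upper) (use that in auto)
    then show ?thesis by simp
  qed
  have bdd: "ennreal ((cmod (Ups m))\<^sup>2) \<le> b" if m: "m \<in> M" for m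
    using term_le[OF u0(1), of "inv u0 \<otimes> m"] gb[of "inv u0 \<otimes> m"] m u0'(1)
    by (auto simp: mult_inv_cancel intro: M_mult M_inv order_trans)
  have Um[measurable]: "Ups \<in> borel_measurable \<mu>" by (rule measurable_continuous_on[OF continuous_Ups])
  have gm[measurable]: "g \<in> borel_measurable \<mu>" by (rule measurable_continuous_on[OF gc])
  define q where "q h = (\<Sum>\<^sub>\<infinity>p\<in>\<Gamma> \<times> int_vectors. ennreal ((cmod (L2_inner \<mu> h (\<lambda>m. modulated (snd p) (fst p \<otimes> m))))\<^sup>2))" for h
  have q: "q h = (\<integral>\<^sup>+m. ennreal ((cmod (h m))\<^sup>2) * g m \<partial>\<mu>)" if h: "h \<in> L2_space \<mu>" for h
  proof -
    have [measurable]: "h \<in> borel_measurable \<mu>" using h by (simp add: L2_space_def)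
    have "q h = (\<Sum>\<^sub>\<infinity>\<gamma>\<in>\<Gamma>. \<Sum>\<^sub>\<infinity>k\<in>int_vectors. ennreal ((cmod (L2_inner \<mu> h (\<lambda>m. modulated k (\<gamma> \<otimes> m))))\<^sup>2))"
      unfolding q_def by (rule infsum_ennreal_Times[OF cnt countable_int_vectors])
    also have "\<dots> = (\<Sum>\<^sub>\<infinity>\<gamma>\<in>\<Gamma>. \<integral>\<^sup>+m. ennreal ((cmod (h m))\<^sup>2) * ennreal ((cmod (Ups (\<gamma> \<otimes> m)))\<^sup>2) \<partial>\<mu>)"
      by (intro infsum_cong sum_coefficients[OF h _ bdd b(2)]) (use \<Gamma> in auto)
    also have "\<dots> = (\<integral>\<^sup>+m. (\<Sum>\<^sub>\<infinity>\<gamma>\<in>\<Gamma>. ennreal ((cmod (h m))\<^sup>2) * ennreal ((cmod (Ups (\<gamma> \<otimes> m)))\<^sup>2)) \<partial>\<mu>)"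
    proof (rule nn_integral_infsum[symmetric, OF cnt])
      fix \<gamma> assume "\<gamma> \<in> \<Gamma>"
      then have [measurable]: "(\<lambda>m. Ups (\<gamma> \<otimes> m)) \<in> borel_measurable \<mu>"
        using \<Gamma> by (intro measurable_compose[OF measurable_translate Um]) auto
      show "(\<lambda>m. ennreal ((cmod (h m))\<^sup>2) * ennreal ((cmod (Ups (\<gamma> \<otimes> m)))\<^sup>2)) \<in> borel_measurable \<mu>" by measurable
    qed
    finally show ?thesis unfolding infsum_ennreal_cmult g_def .
  qed
  have norm_c: "c * L2_normsq \<mu> h = (\<integral>\<^sup>+m. ennreal ((cmod (h m))\<^sup>2) * c \<partial>\<mu>)" if "h \<in> L2_space \<mu>" for c h
    unfolding L2_normsq_def using that by (subst nn_integral_multc) (auto simp: L2_space_def mult.commute)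
  have lower: "a * L2_normsq \<mu> h \<le> q h" and upper: "q h \<le> b * L2_normsq \<mu> h" if "h \<in> L2_space \<mu>" for h
    unfolding q[OF that] norm_c[OF that] using ga gb by (auto intro!: nn_integral_mono mult_left_mono)
  \<comment> \<open>Every neighbourhood of every point carries an indicator function with positive finite norm;
    it is obtained by intersection with a translate of the relatively compact set on which \<open>Ups\<close>
    does not vanish.\<close>
  have test: "\<exists>h\<in>L2_space \<mu>. \<exists>W. L2_normsq \<mu> h = emeasure \<mu> W \<and> q h = (\<integral>\<^sup>+m. g m * indicator W m \<partial>\<mu>) \<and>
      W \<in> sets \<mu> \<and> W \<subseteq> N \<and> 0 < emeasure \<mu> W \<and> emeasure \<mu> W < \<infinity>"
    if N: "open N" "m0 \<in> N" "m0 \<in> M" for N m0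
  proof -
    have "open (- {0 :: complex})" by (simp add: open_Compl)
    then obtain W0 where W0: "open W0" "W0 \<inter> M = Ups -` (- {0}) \<inter> M"
      using continuous_Ups unfolding continuous_on_open_invariant by blast
    define x where "x = m0 \<otimes> inv u0"
    have x: "x \<in> M" "inv x \<otimes> m0 = u0"
      using N(3) u0'(1) by (auto simp: x_def inv_mult_group m_assoc intro: M_mult M_inv)
    define W where "W = (N \<inter> (\<lambda>y. inv x \<otimes> y) -` W0) \<inter> M"
    have oW: "open (N \<inter> (\<lambda>y. inv x \<otimes> y) -` W0)" by (intro open_Int N(1) open_translate W0(1))
    have "u0 \<in> W0" using W0(2) u0' by blast
    then have pos: "0 < emeasure \<mu> W" unfolding W_def
      by (intro open_positive oW) (use N x(2) in auto)
    have Ws: "W \<in> sets \<mu>" unfolding sets_\<mu>_iff W_def using oW closed by auto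
    have "W \<subseteq> (\<lambda>y. x \<otimes> y) ` S"
    proof
      fix m assume m: "m \<in> W"
      then have "inv x \<otimes> m \<in> W0 \<inter> M" using x(1) by (auto simp: W_def intro: M_mult M_inv)
      then have "inv x \<otimes> m \<in> S" unfolding W0(2) using Ups_zero by auto
      then show "m \<in> (\<lambda>y. x \<otimes> y) ` S" by (intro image_eqI[of _ _ "inv x \<otimes> m"]) (simp_all add: mult_inv_cancel)
    qed
    moreover have cS: "compact ((\<lambda>y. x \<otimes> y) ` S)"
      by (intro compact_continuous_image s continuous_on_gmult continuous_intros)
    moreover have SM: "(\<lambda>y. x \<otimes> y) ` S \<subseteq> M" using S_M x(1) by (auto intro: M_mult)
    ultimately have fin: "emeasure \<mu> W < \<infinity>"
      using compact_finite[OF cS SM] emeasure_mono[of W "(\<lambda>y. x \<otimes> y) ` S" \<mu>]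
      by (meson borel_compact le_less_trans sets_\<mu>_iff)
    define h :: "'G \<Rightarrow> complex" where "h = indicator W"
    have hsq: "ennreal ((cmod (h m))\<^sup>2) = indicator W m" for m by (simp add: h_def indicator_def)
    have hn: "L2_normsq \<mu> h = emeasure \<mu> W" unfolding L2_normsq_def hsq using Ws by simp
    have hL: "h \<in> L2_space \<mu>" using Ws fin hn by (auto simp: L2_space_def h_def)
    show ?thesis
      by (intro bexI[OF _ hL] exI[of _ W] conjI) (use hn q[OF hL] hsq Ws pos fin in \<open>auto simp: W_def mult.commute\<close>)
  qed
  have optimal_lower: "c \<le> a" if c: "\<forall>h\<in>L2_space \<mu>. c * L2_normsq \<mu> h \<le> q h" for c
  proof (rule ccontr)
    assume "\<not> c \<le> a"
    then have "(INF m\<in>M. g m) < c" using a(1) by (simp add: g_def)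
    then obtain m0 where m0: "m0 \<in> M" "g m0 < c" by (auto simp: INF_less_iff)
    then obtain c' where c': "g m0 < c'" "c' < c" using dense by blast
    obtain N where N: "open N" "N \<inter> M = g -` {..<c'} \<inter> M"
      using gc unfolding continuous_on_open_invariant using open_lessThan by blast
    have "m0 \<in> N" using N(2) m0 c' by blast
    from test[OF N(1) this m0(1)] obtain h W where h: "h \<in> L2_space \<mu>" "L2_normsq \<mu> h = emeasure \<mu> W"
      "q h = (\<integral>\<^sup>+m. g m * indicator W m \<partial>\<mu>)" "W \<in> sets \<mu>" "W \<subseteq> N" "0 < emeasure \<mu> W" "emeasure \<mu> W < \<infinity>" by blast
    have "c * emeasure \<mu> W \<le> q h" using c h(1,2) by metis
    also have "\<dots> \<le> (\<integral>\<^sup>+m. c' * indicator W m \<partial>\<mu>)"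
      unfolding h(3)
    proof (rule nn_integral_mono)
      fix m assume "m \<in> space \<mu>"
      then have "m \<in> W \<Longrightarrow> g m < c'" using N(2) h(5) by auto
      then show "g m * indicator W m \<le> c' * indicator W m" by (auto simp: indicator_def less_imp_le)
    qed
    also have "\<dots> = c' * emeasure \<mu> W" by (rule nn_integral_cmult_indicator[OF h(4)])
    finally have "c \<le> c'"
      using h(6,7) by (simp add: mult.commute[of _ "emeasure \<mu> W"] ennreal_mult_le_mult_iff)
    then show False using c'(2) by simp
  qed
  have optimal_upper: "b \<le> c" if c: "\<forall>h\<in>L2_space \<mu>. q h \<le> c * L2_normsq \<mu> h" for c
  proof (rule ccontr)
    assume "\<not> b \<le> c"
    then have "c < (SUP m\<in>M. g m)" using b(1) by (simp add: g_def)
    then obtain m0 where m0: "m0 \<in> M" "c < g m0" by (auto simp: less_SUP_iff)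
    then obtain c' where c': "c < c'" "c' < g m0" using dense by blast
    obtain N where N: "open N" "N \<inter> M = g -` {c'<..} \<inter> M"
      using gc unfolding continuous_on_open_invariant using open_greaterThan by blast
    have "m0 \<in> N" using N(2) m0 c' by blast
    from test[OF N(1) this m0(1)] obtain h W where h: "h \<in> L2_space \<mu>" "L2_normsq \<mu> h = emeasure \<mu> W"
      "q h = (\<integral>\<^sup>+m. g m * indicator W m \<partial>\<mu>)" "W \<in> sets \<mu>" "W \<subseteq> N" "0 < emeasure \<mu> W" "emeasure \<mu> W < \<infinity>" by blast
    have "c' * emeasure \<mu> W = (\<integral>\<^sup>+m. c' * indicator W m \<partial>\<mu>)" by (rule nn_integral_cmult_indicator[OF h(4), symmetric])
    also have "\<dots> \<le> q h"
      unfolding h(3)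
    proof (rule nn_integral_mono)
      fix m assume "m \<in> space \<mu>"
      then have "m \<in> W \<Longrightarrow> c' < g m" using N(2) h(5) by auto
      then show "c' * indicator W m \<le> g m * indicator W m" by (auto simp: indicator_def less_imp_le)
    qed
    also have "\<dots> \<le> c * emeasure \<mu> W" using c h(1,2) by metis
    finally have "c' \<le> c"
      using h(6,7) by (simp add: mult.commute[of _ "emeasure \<mu> W"] ennreal_mult_le_mult_iff)
    then show False using c'(1) by simp
  qed
  have "a \<le> b" using ga[OF M_one] gb[OF M_one] by (rule order_trans)
  moreover have "(\<lambda>m. modulated k (\<gamma> \<otimes> m)) \<in> L2_space \<mu>" if "\<gamma> \<in> \<Gamma>" for \<gamma> k
    using \<Gamma> that by (intro translate_L2 modulated_L2) auto
  ultimately show ?thesis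
    unfolding frame_with_optimal_bounds_def Let_def q_def[symmetric]
    using a(2) b(2) lower upper optimal_lower optimal_upper by auto
qed

end

section \<open>The induced representation\<close>

context lie_exp_group
begin

text \<open>Continuity of the window \<open>s\<close>, which is smooth on the closed subgroup in the sense of local extensions.\<close>

lemma smooth_on_subset_continuous:
  assumes "smooth_on_subset \<A> M s" shows "continuous_on M s"
  unfolding continuous_on_eq_continuous_within
proof
  fix x assume x: "x \<in> M"
  then obtain W g where W: "x \<in> W" "smooth_mfd_on \<A> W g" "\<forall>y\<in>M \<inter> W. g y = s y"
    using assms unfolding smooth_on_subset_def by meson
  have oW: "open W" using W(2) by (simp add: smooth_mfd_on_def)
  obtain U \<phi> where U: "(U, \<phi>) \<in> \<A>" "x \<in> U" by (rule chart_exists)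
  have sm: "smooth_on (\<phi> ` (U \<inter> W)) (\<lambda>x. g (inv_into U \<phi> x))"
    using bspec[OF conjunct2[OF W(2)[unfolded smooth_mfd_on_def]] U(1)] by simp
  have "continuous_on (U \<inter> W) (\<lambda>y. g (inv_into U \<phi> (\<phi> y)))"
    by (rule continuous_on_compose2[OF smooth_on_imp_continuous_on[OF sm] continuous_on_subset[OF chart(3)[OF U(1)]]]) auto
  then have "continuous_on (U \<inter> W) g" by (rule continuous_on_eq) (simp add: chart(5)[OF U(1)])
  moreover have "open (U \<inter> W)" "x \<in> U \<inter> W" using oW chart(1)[OF U(1)] U(2) W(1) by auto
  ultimately have "isCont g x" using continuous_on_eq_continuous_at[of "U \<inter> W" g] by simp
  then have g: "(g \<longlongrightarrow> g x) (at x within M)" unfolding isCont_def by (rule tendsto_within_subset) simp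
  have "\<forall>\<^sub>F y in at x within M. y \<in> W"
    by (intro filter_leD[OF at_le[OF subset_UNIV] eventually_at_in_open']) (use oW W(1) in auto)
  moreover have "\<forall>\<^sub>F y in at x within M. y \<in> M" by (simp add: eventually_at_filter)
  ultimately have ev: "\<forall>\<^sub>F y in at x within M. g y = s y" by eventually_elim (use W(3) in simp)
  have "g x = s x" using W(1,3) x by simp
  then show "continuous (at x within M) s"
    using tendsto_cong[OF ev, of "s x"] g by (simp add: continuous_within)
qed

end

lemma independent_family_coefficient_zero:
  fixes Y :: "'i::finite \<Rightarrow> 'a::real_vector"
  assumes "inj Y" "independent (range Y)" "(\<Sum>i\<in>UNIV. c i *\<^sub>R Y i) = 0"
  shows "c i = 0"
proof -
  have "(\<Sum>y\<in>range Y. c (inv_into UNIV Y y) *\<^sub>R y) = 0"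
    using assms(3) by (subst sum.reindex[OF assms(1)]) (simp add: assms(1))
  then have "c (inv_into UNIV Y (Y i)) = 0"
    by (intro independentD[OF assms(2) _ subset_refl]) auto
  then show ?thesis by (simp add: assms(1))
qed

lemma malcev_coord_in_subgroup:
  assumes "subgroup M G" "\<And>k t. Exp (t *\<^sub>R A k) \<in> M"
  shows "malcev_coord G Exp A a \<in> M"
proof -
  have "foldr (\<lambda>k g. Exp ((a $ k) *\<^sub>R A k) \<otimes>\<^bsub>G\<^esub> g) ks \<one>\<^bsub>G\<^esub> \<in> M" for ks
    using assms by (induction ks) (auto intro: subgroup.m_closed subgroup.one_closed)
  then show ?thesis by (simp add: malcev_coord_def)
qed

text \<open>The normal form of \<open>\<gamma>\<^sup>-\<^sup>1 x\<close> with \<open>x \<in> P\<close> is \<open>(\<gamma>\<^sup>-\<^sup>1 x \<gamma>) \<gamma>\<^sup>-\<^sup>1\<close>; inserting it into the formula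
  for the representation makes \<open>\<gamma> m\<close> appear in place of \<open>m\<close> throughout.\<close>

lemma induced_rep_normal_form:
  assumes "group G" and P: "P \<lhd> G" and M: "subgroup M G" and PM: "P \<inter> M = {\<one>\<^bsub>G\<^esub>}"
    and x: "x \<in> P" and \<gamma>: "\<gamma> \<in> M" and m: "m \<in> carrier G"
  shows "induced_rep G Exp P M lam (inv\<^bsub>G\<^esub> \<gamma> \<otimes>\<^bsub>G\<^esub> x) f m =
    cis (2 * pi * lam (inv_into UNIV Exp (inv\<^bsub>G\<^esub> (\<gamma> \<otimes>\<^bsub>G\<^esub> m) \<otimes>\<^bsub>G\<^esub> x \<otimes>\<^bsub>G\<^esub> (\<gamma> \<otimes>\<^bsub>G\<^esub> m)))) * f (\<gamma> \<otimes>\<^bsub>G\<^esub> m)"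
proof -
  interpret group G by fact
  interpret P: normal P G by fact
  note Ms = subgroup.mem_carrier[OF M] and Ps = P.mem_carrier
  note closed = subgroup.m_closed[OF M] subgroup.m_inv_closed[OF M] P.m_closed P.m_inv_closed
  let ?p = "inv\<^bsub>G\<^esub> \<gamma> \<otimes>\<^bsub>G\<^esub> x \<otimes>\<^bsub>G\<^esub> \<gamma>" and ?n = "inv\<^bsub>G\<^esub> \<gamma>"
  have p: "?p \<in> P" by (rule P.inv_op_closed1[OF Ms[OF \<gamma>] x])
  have n: "?n \<in> M" using \<gamma> closed by auto
  have car: "\<gamma> \<in> carrier G" "x \<in> carrier G" using \<gamma> x Ms Ps by auto
  have pn: "inv\<^bsub>G\<^esub> \<gamma> \<otimes>\<^bsub>G\<^esub> x = ?p \<otimes>\<^bsub>G\<^esub> ?n" using car by (simp add: m_assoc)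
  have uniq: "pn = (?p, ?n)" if h: "fst pn \<in> P \<and> snd pn \<in> M \<and> inv\<^bsub>G\<^esub> \<gamma> \<otimes>\<^bsub>G\<^esub> x = fst pn \<otimes>\<^bsub>G\<^esub> snd pn" for pn
  proof -
    define p n where "p = fst pn" and "n = snd pn"
    have h2: "p \<in> P" "n \<in> M" "?p \<otimes>\<^bsub>G\<^esub> ?n = p \<otimes>\<^bsub>G\<^esub> n" using h pn by (auto simp: p_def n_def)
    have c: "p \<in> carrier G" "n \<in> carrier G" "?p \<in> carrier G" "?n \<in> carrier G" using h2 car Ms Ps by auto
    have "inv\<^bsub>G\<^esub> p \<otimes>\<^bsub>G\<^esub> ?p = inv\<^bsub>G\<^esub> p \<otimes>\<^bsub>G\<^esub> (?p \<otimes>\<^bsub>G\<^esub> ?n) \<otimes>\<^bsub>G\<^esub> \<gamma>" using c car by (simp add: m_assoc)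
    also have "\<dots> = n \<otimes>\<^bsub>G\<^esub> \<gamma>" unfolding h2(3) using c car by (simp add: m_assoc[symmetric])
    finally have eq: "inv\<^bsub>G\<^esub> p \<otimes>\<^bsub>G\<^esub> ?p = n \<otimes>\<^bsub>G\<^esub> \<gamma>" .
    have "inv\<^bsub>G\<^esub> p \<otimes>\<^bsub>G\<^esub> ?p \<in> P" using h2(1) p closed by blast
    moreover have "n \<otimes>\<^bsub>G\<^esub> \<gamma> \<in> M" using h2(2) \<gamma> closed by blast
    ultimately have "n \<otimes>\<^bsub>G\<^esub> \<gamma> = \<one>\<^bsub>G\<^esub>" unfolding eq using PM by blast
    then have n_eq: "n = ?n" using inv_equality[of n \<gamma>] c car by simp
    then have "p = ?p" using h2(3) c by (metis right_cancel)
    then show ?thesis using n_eq by (simp add: p_def n_def prod_eq_iff)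
  qed
  have "(THE pn. fst pn \<in> P \<and> snd pn \<in> M \<and> inv\<^bsub>G\<^esub> \<gamma> \<otimes>\<^bsub>G\<^esub> x = fst pn \<otimes>\<^bsub>G\<^esub> snd pn) = (?p, ?n)"
  proof (rule the_equality)
    show "fst (?p, ?n) \<in> P \<and> snd (?p, ?n) \<in> M \<and> inv\<^bsub>G\<^esub> \<gamma> \<otimes>\<^bsub>G\<^esub> x = fst (?p, ?n) \<otimes>\<^bsub>G\<^esub> snd (?p, ?n)"
      using p n pn by simp
  qed (rule uniq)
  moreover have "inv\<^bsub>G\<^esub> m \<otimes>\<^bsub>G\<^esub> ?p \<otimes>\<^bsub>G\<^esub> m = inv\<^bsub>G\<^esub> (\<gamma> \<otimes>\<^bsub>G\<^esub> m) \<otimes>\<^bsub>G\<^esub> x \<otimes>\<^bsub>G\<^esub> (\<gamma> \<otimes>\<^bsub>G\<^esub> m)"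
    using car m by (simp add: inv_mult_group m_assoc)
  ultimately show ?thesis using car by (simp add: induced_rep_def)
qed

theorem theorem3:
  fixes G :: "'G::{t2_space,second_countable_topology} monoid"
    and \<A> :: "('G, 'g::euclidean_space) chart set"
    and vf :: "'g \<Rightarrow> ('G \<Rightarrow> real) \<Rightarrow> 'G \<Rightarrow> real"
    and br :: "'g \<Rightarrow> 'g \<Rightarrow> 'g"
    and Exp :: "'g \<Rightarrow> 'G"
    and P M :: "'G set" and \<pp> \<mm> :: "'g set"
    and \<mu> :: "'G measure"
    and lam :: "'g \<Rightarrow> real"
    and \<rho> :: "'G \<Rightarrow> ('G \<Rightarrow> complex) \<Rightarrow> 'G \<Rightarrow> complex"
    and X :: "'p::{finite,linorder} \<Rightarrow> 'g"
    and A :: "'m::{finite,linorder} \<Rightarrow> 'g"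
    and e :: "real^'m::{finite,linorder} \<Rightarrow> 'G"
    and C :: "real^'m::{finite,linorder} \<Rightarrow> 'g \<Rightarrow> 'g"
    and \<theta> :: "real^'m::{finite,linorder} \<Rightarrow> 'g \<Rightarrow> real"
    and D\<theta> :: "real^'m::{finite,linorder}^'p::{finite,linorder}"
    and J :: "'m::{finite,linorder} \<Rightarrow> 'p::{finite,linorder}"
    and \<beta> :: "real^'m::{finite,linorder} \<Rightarrow> real^'m::{finite,linorder}"
    and Onbhd O\<epsilon> :: "(real^'m::{finite,linorder}) set"
    and \<epsilon> :: real
    and \<Omega> :: "'G set"
    and \<Phi> :: "'G \<Rightarrow> real^'m::{finite,linorder}"
    and \<Psi> :: "real^'m::{finite,linorder} \<Rightarrow> real"
    and L :: "real^'m::{finite,linorder}^'m::{finite,linorder}"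
    and \<Gamma>\<^sub>P \<Gamma>\<^sub>M \<Gamma> :: "'G set"
    and Lstar :: "(real^'m::{finite,linorder}) set"
    and s \<Upsilon> :: "'G \<Rightarrow> complex"
    and supp :: "'G set"
    and A_bound B_bound :: ennreal
  assumes "lie_group G \<A>" "lie_algebra_iso G \<A> vf" "lie_exponential G \<A> vf Exp"
    and "connected (UNIV :: 'G set)" "simply_connected (UNIV :: 'G set)"
    and br: "br = lie_bracket \<A> vf"
    and "completely_solvable br" "bij Exp"
    and "lie_subalgebra br \<pp>" "P = Exp ` \<pp>" "closed P" "P \<lhd> G"
    and "lie_subalgebra br \<mm>" "M = Exp ` \<mm>" "closed M" "subgroup M G"
    and "P <#>\<^bsub>G\<^esub> M = carrier G" "P \<inter> M = {\<one>\<^bsub>G\<^esub>}"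
    and "left_haar_measure G M \<mu>"
    and "\<forall>Y\<in>\<pp>. \<forall>Z\<in>\<pp>. \<forall>a b. lam (a *\<^sub>R Y + b *\<^sub>R Z) = a * lam Y + b * lam Z"
    and "\<forall>Y\<in>\<pp>. \<forall>Z\<in>\<pp>. lam (br Y Z) = 0"
    and rho: "\<rho> = induced_rep G Exp P M lam"
    and "irreducible_on_L2 G \<mu> \<rho>"
    and "strong_malcev_basis br \<pp> X" "strong_malcev_basis br \<mm> A"
    and e: "e = malcev_coord G Exp A"
    and C: "C = ad_exp_prod br A"
    and theta: "\<theta> = (\<lambda>a Y. lam (C a Y))"
    and Dtheta: "D\<theta> = jacobian (\<lambda>a. \<chi> k. \<theta> a (X k)) (at 0)"
    and "strict_mono J" "invertible (\<chi> i. D\<theta> $ J i)"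
    and beta: "\<beta> = (\<lambda>a. \<chi> i. \<theta> a (X (J i)))"
    and "open Onbhd" "connected Onbhd" "0 \<in> Onbhd" "diffeo_onto_image Onbhd \<beta>"
    and "0 < \<epsilon>" "cbox (\<chi> k. - \<epsilon> / 2) (\<chi> k. \<epsilon> / 2) \<subseteq> Onbhd"
    and Oeps: "O\<epsilon> = box (\<chi> k. - \<epsilon> / 2) (\<chi> k. \<epsilon> / 2)"
    and Omega: "\<Omega> = e ` O\<epsilon>"
    and Phi: "\<Phi> = (\<lambda>m. \<beta> (inv_into O\<epsilon> e m))"
    and "smooth_on (\<beta> ` O\<epsilon>) \<Psi>" "\<forall>\<xi>\<in>\<beta> ` O\<epsilon>. 0 < \<Psi> \<xi>"
    and "distr (restrict_space \<mu> \<Omega>) borel \<Phi> =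
           density lborel (\<lambda>\<xi>. indicator (\<beta> ` O\<epsilon>) \<xi> * ennreal (\<Psi> \<xi>))"
    and "smooth_on_subset \<A> M s"
    and supp: "supp = closure {m \<in> M. s m \<noteq> 0}" "compact supp" "supp \<subseteq> \<Omega>"
    and "invertible L"
    and Gamma_P: "\<Gamma>\<^sub>P = Exp ` {\<Sum>i\<in>UNIV. (L *v k) $ i *\<^sub>R X (J i) | k. k \<in> int_vectors}"
    and Lstar: "Lstar = (*v) (transpose (matrix_inv L)) ` int_vectors"
    and "\<exists>F. fundamental_domain Lstar F \<and> \<Phi> ` supp \<subseteq> F"
    and Upsilon: "\<Upsilon> = (\<lambda>m. if m \<in> \<Omega>
           then sqrt (\<Psi> (\<Phi> m) * \<bar>det (transpose (matrix_inv L))\<bar>) * s m else 0)"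
    and "\<Gamma>\<^sub>M \<subseteq> M" "discrete \<Gamma>\<^sub>M"
    and A_bound: "A_bound = (INF m\<in>M. \<Sum>\<^sub>\<infinity>\<gamma>\<in>\<Gamma>\<^sub>M. ennreal ((cmod (\<Upsilon> (\<gamma> \<otimes>\<^bsub>G\<^esub> m)))\<^sup>2))"
    and B_bound: "B_bound = (SUP m\<in>M. \<Sum>\<^sub>\<infinity>\<gamma>\<in>\<Gamma>\<^sub>M. ennreal ((cmod (\<Upsilon> (\<gamma> \<otimes>\<^bsub>G\<^esub> m)))\<^sup>2))"
    and "A_bound > 0" "B_bound < \<infinity>"
    and Gamma: "\<Gamma> = (set_inv\<^bsub>G\<^esub> \<Gamma>\<^sub>M) <#>\<^bsub>G\<^esub> \<Gamma>\<^sub>P"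
  shows "frame_with_optimal_bounds \<mu> \<Gamma> (\<lambda>\<kappa>. \<rho> \<kappa> s) A_bound B_bound"
proof -
  have grp: "group G" and carr: "carrier G = UNIV" using assms(1) by (auto simp: lie_group_def)
  interpret G: lie_exp_group G \<A> vf Exp
    by (intro lie_exp_group.intro lie_exp_group_axioms.intro grp) fact+
  interpret H: closed_haar_subgroup G M \<mu>
    by (intro closed_haar_subgroup.intro closed_haar_subgroup_axioms.intro grp carr G.continuous_mult G.continuous_inv) fact+
  interpret P: normal P G by fact
  have subp: "subspace \<pp>" using \<open>lie_subalgebra br \<pp>\<close> by (simp add: lie_subalgebra_def)
  have subm: "subspace \<mm>" using \<open>lie_subalgebra br \<mm>\<close> by (simp add: lie_subalgebra_def)
  have X: "inj X" "independent (range X)" "span (range X) = \<pp>"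
    using \<open>strong_malcev_basis br \<pp> X\<close> by (simp_all add: strong_malcev_basis_def)
  have A: "span (range A) = \<mm>"
    using \<open>strong_malcev_basis br \<mm> A\<close> by (simp add: strong_malcev_basis_def)
  have Xp: "X j \<in> \<pp>" for j unfolding X(3)[symmetric] by (intro span_base rangeI)
  have Am: "A k \<in> \<mm>" for k unfolding A[symmetric] by (intro span_base rangeI)
  have injExp: "Exp Y = Exp Z \<Longrightarrow> Y = Z" for Y Z using bij_is_inj[OF \<open>bij Exp\<close>] by (rule injD)
  have CAd: "C a = G.Ad_inv (e a)" for a unfolding C e br by (rule G.ad_exp_prod_eq_Ad_inv)
  have conj: "inv\<^bsub>G\<^esub> (e a) \<otimes>\<^bsub>G\<^esub> Exp Z \<otimes>\<^bsub>G\<^esub> e a = Exp (C a Z)" for a Z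
    unfolding CAd by (rule G.conj_Exp)
  have Cp: "C a Z \<in> \<pp>" if "Z \<in> \<pp>" for a Z
  proof -
    have "Exp Z \<in> P" unfolding \<open>P = Exp ` \<pp>\<close> using that by (rule imageI)
    then have "Exp (C a Z) \<in> P" unfolding conj[symmetric] by (intro P.inv_op_closed1) simp_all
    then obtain Y where "Y \<in> \<pp>" "Exp (C a Z) = Exp Y" unfolding \<open>P = Exp ` \<pp>\<close> by (auto elim!: imageE)
    then show ?thesis using injExp[of "C a Z" Y] by simp
  qed
  have lam_lin: "lam (x *\<^sub>R Y + y *\<^sub>R Z) = x * lam Y + y * lam Z" if "Y \<in> \<pp>" "Z \<in> \<pp>" for x y Y Z
    using \<open>\<forall>Y\<in>\<pp>. \<forall>Z\<in>\<pp>. \<forall>a b. lam (a *\<^sub>R Y + b *\<^sub>R Z) = a * lam Y + b * lam Z\<close> that by blast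
  have lam0: "lam 0 = 0" using lam_lin[OF Xp Xp, of 0 undefined 0 undefined] by simp
  have lam_sum: "lam (\<Sum>i\<in>I. c i *\<^sub>R Y i) = (\<Sum>i\<in>I. c i * lam (Y i))"
    if "\<And>i. Y i \<in> \<pp>" for I and c :: "'m \<Rightarrow> real" and Y :: "'m \<Rightarrow> 'g"
  proof (induction I rule: infinite_finite_induct)
    case (insert i I)
    have "(\<Sum>i\<in>I. c i *\<^sub>R Y i) \<in> \<pp>" using subp that by (intro subspace_sum subspace_scale) auto
    from lam_lin[OF that[of i] this, of "c i" 1] insert show ?case by simp
  qed (simp_all add: lam0)
  define l where "l k = (\<Sum>i\<in>UNIV. (L *v k) $ i *\<^sub>R X (J i))" for k :: "real^'m::{finite,linorder}"
  have lp: "l k \<in> \<pp>" for k unfolding l_def using subp Xp by (intro subspace_sum subspace_scale) auto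
  \<comment> \<open>The phase is linear in \<open>\<beta> a\<close>, by linearity of \<open>lam\<close> on
    \<open>\<pp>\<close>.\<close>
  have pairing: "lam (C a (l k)) = (L *v k) \<bullet> \<beta> a" for a k
  proof -
    interpret Ca: linear "C a" unfolding CAd by (rule G.linear_Ad_inv)
    have "C a (l k) = (\<Sum>i\<in>UNIV. (L *v k) $ i *\<^sub>R C a (X (J i)))" unfolding l_def Ca.sum Ca.scaleR ..
    then show ?thesis using lam_sum[of "\<lambda>i. C a (X (J i))" "\<lambda>i. (L *v k) $ i" UNIV] Cp[OF Xp]
      by (simp add: beta theta inner_vec_def)
  qed
  \<comment> \<open>Only \<open>e a\<close> enters \<open>C a\<close>, hence also \<open>\<beta> a\<close>: injectivity of \<open>e\<close> is inherited from \<open>\<beta>\<close>.\<close>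
  have \<beta>_e: "\<beta> a = \<beta> a'" if "e a = e a'" for a a' unfolding beta theta CAd that ..
  \<comment> \<open>On the compact cube \<open>Q\<close> the continuous injection \<open>e\<close> is a
    homeomorphism onto its image; this gives continuity of \<open>\<Phi>\<close> and measurability of
    \<open>\<Omega>\<close>.\<close>
  define Q :: "(real^'m::{finite,linorder}) set" where "Q = cbox (\<chi> k. - \<epsilon> / 2) (\<chi> k. \<epsilon> / 2)"
  have QO: "Q \<subseteq> Onbhd" unfolding Q_def by fact
  have OQ: "O\<epsilon> \<subseteq> Q" unfolding Oeps Q_def by (rule box_subset_cbox)
  have OO: "O\<epsilon> \<subseteq> Onbhd" using OQ QO by (rule order_trans)
  have Oopen: "open O\<epsilon>" unfolding Oeps by (rule open_box)
  have sm: "smooth_on Onbhd \<beta>" "smooth_on (\<beta> ` Onbhd) (inv_into Onbhd \<beta>)" and inj\<beta>: "inj_on \<beta> Onbhd"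
    using \<open>diffeo_onto_image Onbhd \<beta>\<close> by (simp_all add: diffeo_onto_image_def)
  note cont\<beta> = smooth_on_imp_continuous_on[OF sm(1)] and cont_inv = smooth_on_imp_continuous_on[OF sm(2)]
  have op: "open (\<beta> ` Onbhd)" using sm(2) by (simp add: smooth_on_def)
  have inj_e: "inj_on e Q" using \<beta>_e inj\<beta> QO by (meson inj_onD inj_onI subsetD)
  have inj_eO: "inj_on e O\<epsilon>" using inj_e OQ by (rule inj_on_subset)
  have cont_e: "continuous_on UNIV e" unfolding e by (rule G.continuous_malcev_coord)
  have eM: "e a \<in> M" for a
    unfolding e
  proof (rule malcev_coord_in_subgroup[OF \<open>subgroup M G\<close>])
    show "Exp (t *\<^sub>R A k) \<in> M" for k t
      unfolding \<open>M = Exp ` \<mm>\<close> by (intro imageI subspace_scale subm Am)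
  qed
  have \<Phi>e: "\<Phi> (e a) = \<beta> a" if "a \<in> O\<epsilon>" for a unfolding Phi using inj_eO that by simp
  define B where "B = \<beta> ` O\<epsilon>"
  define E where "E \<xi> = e (inv_into Onbhd \<beta> \<xi>)" for \<xi>
  have inv\<beta>: "inv_into Onbhd \<beta> (\<beta> a) = a" if "a \<in> Onbhd" for a using inj\<beta> that by simp
  have E\<beta>: "E (\<beta> a) = e a" if "a \<in> O\<epsilon>" for a unfolding E_def using inv\<beta> that OO by (simp add: subset_iff)
  have Bopen: "open B"
  proof -
    have "B = \<beta> ` Onbhd \<inter> inv_into Onbhd \<beta> -` O\<epsilon>"
    proof
      show "B \<subseteq> \<beta> ` Onbhd \<inter> inv_into Onbhd \<beta> -` O\<epsilon>" unfolding B_def using inv\<beta> OO by auto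
      show "\<beta> ` Onbhd \<inter> inv_into Onbhd \<beta> -` O\<epsilon> \<subseteq> B" unfolding B_def using inv\<beta> by auto
    qed
    then show ?thesis using continuous_open_preimage[OF cont_inv op Oopen] by simp
  qed
  have contE: "continuous_on B E"
    unfolding E_def B_def
    by (rule continuous_on_compose2[OF cont_e continuous_on_subset[OF cont_inv]]) (use OO in auto)
  let ?g = "inv_into Q e"
  have g: "?g (e a) = a" if "a \<in> Q" for a using inj_e that by simp
  have contg: "continuous_on (e ` Q) ?g"
    by (rule continuous_on_inv[OF continuous_on_subset[OF cont_e subset_UNIV]]) (use g in \<open>auto simp: Q_def\<close>)
  have \<Omega>Q: "\<Omega> \<subseteq> e ` Q" unfolding Omega using OQ by (rule image_mono)
  have cont\<Phi>: "continuous_on \<Omega> \<Phi>"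
  proof -
    have "continuous_on \<Omega> (\<lambda>m. \<beta> (?g m))"
      by (rule continuous_on_compose2[OF cont\<beta> continuous_on_subset[OF contg \<Omega>Q]])
        (use OO OQ g in \<open>auto simp: Omega subset_iff\<close>)
    then show ?thesis
      by (rule continuous_on_eq) (use OQ g \<Phi>e in \<open>auto simp: Omega subset_iff\<close>)
  qed
  have \<Omega>borel: "\<Omega> \<in> sets borel"
  proof -
    obtain W where W: "open W" "W \<inter> e ` Q = ?g -` O\<epsilon> \<inter> e ` Q"
      using contg Oopen unfolding continuous_on_open_invariant by blast
    have eq: "?g -` O\<epsilon> \<inter> e ` Q = \<Omega>"
    proof
      show "?g -` O\<epsilon> \<inter> e ` Q \<subseteq> \<Omega>" unfolding Omega using g by auto
      show "\<Omega> \<subseteq> ?g -` O\<epsilon> \<inter> e ` Q" unfolding Omega using g OQ by auto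
    qed
    have "compact (e ` Q)"
      unfolding Q_def by (intro compact_continuous_image continuous_on_subset[OF cont_e subset_UNIV] compact_cbox)
    then have "W \<inter> e ` Q \<in> sets borel" using W(1) by (intro sets.Int borel_open borel_compact)
    then show ?thesis unfolding W(2) eq .
  qed
  have supp_s: "m \<in> supp" if "m \<in> M" "s m \<noteq> 0" for m
    unfolding supp(1) using that by (intro subsetD[OF closure_subset]) simp
  interpret S: lattice_section G M \<mu> B E \<Phi> \<Omega> supp \<Psi> s L "transpose (matrix_inv L)"
  proof
    show "open B" "continuous_on B E" by fact+
    show "E \<xi> \<in> \<Omega>" "\<Phi> (E \<xi>) = \<xi>" if "\<xi> \<in> B" for \<xi> using that by (auto simp: B_def E\<beta> \<Phi>e Omega)
    show "\<Omega> \<in> sets borel" "continuous_on \<Omega> \<Phi>" by fact+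
    show "\<Omega> \<subseteq> M" using eM by (auto simp: Omega)
    show "\<Phi> m \<in> B" "E (\<Phi> m) = m" if "m \<in> \<Omega>" for m using that by (auto simp: B_def E\<beta> \<Phi>e Omega)
    show "continuous_on B \<Psi>" unfolding B_def by (rule smooth_on_imp_continuous_on) fact
    show "0 < \<Psi> \<xi>" if "\<xi> \<in> B" for \<xi>
      using \<open>\<forall>\<xi>\<in>\<beta> ` O\<epsilon>. 0 < \<Psi> \<xi>\<close> that unfolding B_def by (rule bspec)
    show "distr (restrict_space \<mu> \<Omega>) borel \<Phi> = density lborel (\<lambda>\<xi>. indicator B \<xi> * ennreal (\<Psi> \<xi>))"
      unfolding B_def by fact
    show "continuous_on M s" by (rule G.smooth_on_subset_continuous) fact
    show "compact supp" "supp \<subseteq> \<Omega>" by fact+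
    show "m \<in> supp" if "m \<in> M" "s m \<noteq> 0" for m by (rule supp_s[OF that])
    show "invertible L" by fact
    fix v w assume vw: "v \<in> (*v) (transpose (matrix_inv L)) ` int_vectors"
      "w \<in> (*v) (transpose (matrix_inv L)) ` int_vectors" "v \<noteq> w"
    obtain F where F: "fundamental_domain Lstar F" "\<Phi> ` supp \<subseteq> F"
      using \<open>\<exists>F. fundamental_domain Lstar F \<and> \<Phi> ` supp \<subseteq> F\<close> by blast
    have "negligible ((+) v ` F \<inter> (+) w ` F)"
      using F(1) vw unfolding fundamental_domain_def Lstar by blast
    then show "negligible ((+) v ` (\<Phi> ` supp) \<inter> (+) w ` (\<Phi> ` supp))"
      by (rule negligible_subset) (use F(2) in blast)
  qed simp
  have Ups: "\<Upsilon> = S.Ups" unfolding Upsilon by (rule ext) (simp add: S.Ups_def)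
  have frame: "frame_with_optimal_bounds \<mu> (\<Gamma>\<^sub>M \<times> int_vectors) (\<lambda>p m. S.modulated (snd p) (fst p \<otimes>\<^bsub>G\<^esub> m)) A_bound B_bound"
    by (rule S.frame_of_modulated_translates[OF \<open>\<Gamma>\<^sub>M \<subseteq> M\<close> A_bound[unfolded Ups] \<open>A_bound > 0\<close>
          B_bound[unfolded Ups] \<open>B_bound < \<infinity>\<close>])
  let ?\<kappa> = "\<lambda>p. inv\<^bsub>G\<^esub> (fst p) \<otimes>\<^bsub>G\<^esub> Exp (l (snd p))"
  have lP: "Exp (l k) \<in> P" for k unfolding \<open>P = Exp ` \<pp>\<close> by (intro imageI lp)
  have \<Gamma>_eq: "\<Gamma> = ?\<kappa> ` (\<Gamma>\<^sub>M \<times> int_vectors)"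
  proof -
    have "\<Gamma>\<^sub>P = (\<lambda>k. Exp (l k)) ` int_vectors"
      unfolding Gamma_P l_def by (simp add: Setcompr_eq_image image_image)
    then have "x \<in> \<Gamma> \<longleftrightarrow> (\<exists>\<gamma>\<in>\<Gamma>\<^sub>M. \<exists>k\<in>int_vectors. x = inv\<^bsub>G\<^esub> \<gamma> \<otimes>\<^bsub>G\<^esub> Exp (l k))" for x
      unfolding Gamma set_mult_def SET_INV_def by simp
    then show ?thesis by (intro Set.set_eqI) (simp add: image_iff Bex_def)
  qed
  have inj_l: "k = k'" if "l k = l k'" for k k'
  proof -
    have z: "(\<Sum>i\<in>UNIV. (L *v k - L *v k') $ i *\<^sub>R X (J i)) = 0"
      using that by (simp add: l_def scaleR_diff_left sum_subtractf)
    have "inj J" using \<open>strict_mono J\<close> by (rule strict_mono_imp_inj_on)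
    then have "inj (\<lambda>i. X (J i))" using X(1) by (auto simp: inj_def)
    moreover have "independent (range (\<lambda>i. X (J i)))" by (rule independent_mono[OF X(2)]) auto
    ultimately have "(L *v k - L *v k') $ i = 0" for i
      using z by (rule independent_family_coefficient_zero)
    then have "L *v k = L *v k'" by (simp add: vec_eq_iff)
    then have "matrix_inv L *v (L *v k) = matrix_inv L *v (L *v k')" by (rule arg_cong)
    then show ?thesis using matrix_inv_mult(2)[OF \<open>invertible L\<close>] by (simp add: matrix_vector_mul_assoc)
  qed
  \<comment> \<open>Decompositions into \<open>M\<close> and \<open>P\<close> are unique, so the frame has no
    repetitions and may be indexed by pairs.\<close>
  have inj\<kappa>: "inj_on ?\<kappa> (\<Gamma>\<^sub>M \<times> int_vectors)"
  proof (rule inj_onI)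
    fix p p' assume p: "p \<in> \<Gamma>\<^sub>M \<times> int_vectors" "p' \<in> \<Gamma>\<^sub>M \<times> int_vectors"
      and eq: "inv\<^bsub>G\<^esub> (fst p) \<otimes>\<^bsub>G\<^esub> Exp (l (snd p)) = inv\<^bsub>G\<^esub> (fst p') \<otimes>\<^bsub>G\<^esub> Exp (l (snd p'))"
    have pM: "fst p \<in> M" "fst p' \<in> M" using p \<open>\<Gamma>\<^sub>M \<subseteq> M\<close> by auto
    have "fst p' \<otimes>\<^bsub>G\<^esub> inv\<^bsub>G\<^esub> (fst p) = fst p' \<otimes>\<^bsub>G\<^esub> (inv\<^bsub>G\<^esub> (fst p) \<otimes>\<^bsub>G\<^esub> Exp (l (snd p))) \<otimes>\<^bsub>G\<^esub> inv\<^bsub>G\<^esub> (Exp (l (snd p)))"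
      by (simp add: G.m_assoc)
    also have "\<dots> = Exp (l (snd p')) \<otimes>\<^bsub>G\<^esub> inv\<^bsub>G\<^esub> (Exp (l (snd p)))"
      unfolding eq by (simp add: G.m_assoc[symmetric])
    finally have e1: "fst p' \<otimes>\<^bsub>G\<^esub> inv\<^bsub>G\<^esub> (fst p) = Exp (l (snd p')) \<otimes>\<^bsub>G\<^esub> inv\<^bsub>G\<^esub> (Exp (l (snd p)))" .
    have "fst p' \<otimes>\<^bsub>G\<^esub> inv\<^bsub>G\<^esub> (fst p) \<in> M" by (intro H.M_mult H.M_inv pM)
    moreover have "fst p' \<otimes>\<^bsub>G\<^esub> inv\<^bsub>G\<^esub> (fst p) \<in> P" unfolding e1 by (intro P.m_closed P.m_inv_closed lP)
    ultimately have "fst p' \<otimes>\<^bsub>G\<^esub> inv\<^bsub>G\<^esub> (fst p) = \<one>\<^bsub>G\<^esub>" using \<open>P \<inter> M = {\<one>\<^bsub>G\<^esub>}\<close> by blast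
    then have gg: "fst p = fst p'" using G.inv_equality[of "fst p'" "inv\<^bsub>G\<^esub> (fst p)"] by simp
    have "Exp (l (snd p)) = Exp (l (snd p'))" using eq unfolding gg by simp
    then have "snd p = snd p'" by (intro inj_l injExp)
    then show "p = p'" using gg by (rule prod_eqI[rotated])
  qed
  have rep: "\<rho> (?\<kappa> p) s m = S.modulated (snd p) (fst p \<otimes>\<^bsub>G\<^esub> m)"
    if p: "p \<in> \<Gamma>\<^sub>M \<times> int_vectors" and m: "m \<in> space \<mu>" for p m
  proof -
    have \<gamma>: "fst p \<in> M" and mM: "m \<in> M" using p m \<open>\<Gamma>\<^sub>M \<subseteq> M\<close> by auto
    let ?y = "fst p \<otimes>\<^bsub>G\<^esub> m"
    have yM: "?y \<in> M" by (intro H.M_mult \<gamma> mM)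
    have eq: "\<rho> (?\<kappa> p) s m = cis (2 * pi * lam (inv_into UNIV Exp (inv\<^bsub>G\<^esub> ?y \<otimes>\<^bsub>G\<^esub> Exp (l (snd p)) \<otimes>\<^bsub>G\<^esub> ?y))) * s ?y"
      unfolding rho
      by (rule induced_rep_normal_form[OF grp \<open>P \<lhd> G\<close> \<open>subgroup M G\<close> \<open>P \<inter> M = {\<one>\<^bsub>G\<^esub>}\<close> lP \<gamma>]) simp
    show ?thesis
    proof (cases "?y \<in> \<Omega>")
      case True
      then obtain a where a: "a \<in> O\<epsilon>" "?y = e a" unfolding Omega by (auto elim!: imageE)
      have "inv_into UNIV Exp (Exp (C a (l (snd p)))) = C a (l (snd p))"
        by (rule inv_into_f_f[OF bij_is_inj[OF \<open>bij Exp\<close>]]) simp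
      then show ?thesis using True unfolding eq S.modulated_def unfolding a(2) conj
        by (simp add: pairing \<Phi>e[OF a(1)])
    next
      case False
      then have "s ?y = 0" using supp_s[OF yM] \<open>supp \<subseteq> \<Omega>\<close> by (auto dest: subsetD)
      then show ?thesis using False unfolding eq S.modulated_def by simp
    qed
  qed
  show ?thesis unfolding \<Gamma>_eq by (rule frame_with_optimal_bounds_reindex[OF frame inj\<kappa> rep])
qed

end
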